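(* Let $F\in\mathcal S(]-\infty,0],\mathbb C)$. For every real $c>0$ and every real $t<0$, $$\frac14\sum_{n=1}^{+\infty}r_nF(nt)=-\frac{\pi}{4t}F^{(-1)}(0)-\frac14F(0)+\frac{1}{2i\pi}\int_{\Re(s)=c}\Gamma(-s)\,\zeta(-s)\,L(-s,\chi_4)\,F^{(s)}(0)\,(-t)^s\,ds$$ $$\phantom{\frac14\sum_{n=1}^{+\infty}r_nF(nt)}=-\frac{\pi}{4t}F^{(-1)}(0)-\frac14F(0)+\frac{1}{4i\pi}\int_{\Re(s)=c}\xi(s+1)\,\xi_4(s+1)\,F^{(s)}(0)\,(-t)^s\,ds .$$
   Context: $r_n=\#\{(a,b)\in\mathbb Z^2: a^2+b^2=n\}$. $\zeta$ is the Riemann zeta function and $L(s,\chi_4)$ is the entire function equal to $\sum_{k\ge0}(-1)^k(2k+1)^{-s}$ for $\Re(s)>0$. $\xi(s)=\pi^{-s/2}\Gamma(s/2)\zeta(s)$ and $\xi_4(s)=2^s\pi^{-(s+1)/2}\Gamma(\frac{s+1}{2})L(s,\chi_4)$. $\mathcal S(]-\infty,0],\mathbb C)$ is the space of functions $F\in C^\infty(]-\infty,0],\mathbb C)$ (one-sided derivatives at $0$) such that $\lim_{t\to-\infty}|t|^mF^{(n)}(t)=0$ for all integers $n,m\ge 0$. For such $F$, define $F^{(s)}(0)=\frac{1}{\Gamma(-s)}\int_0^{+\infty}u^{-s-1}F(-u)\,du$ for $\Re(s)<0$; this function of $s$ extends to an entire function, still denoted $s\mapsto F^{(s)}(0)$,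 which at $s=n\in\mathbb N$ equals the usual $n$-th derivative; in particular $F^{(-1)}(0)=\int_{-\infty}^0F(u)\,du$. The integral over $\Re(s)=c$ is along the upward oriented vertical line; $\Gamma(-s)\zeta(-s)L(-s,\chi_4)$ has only removable singularities on $\Re(s)>0$ and is extended there by continuity. For $a>0$, $a^s=e^{s\ln a}$.
   Formalization: In the second integral the factor (-t)^s is corrected to (-t/π)^s: with the given ξ and ξ_4, ξ(s+1)ξ_4(s+1) = 2π^s Γ(-s)ζ(-s)L(-s,χ_4), so the printed second equality is false (e.g. for F = exp). *)

theory Defs
  imports "HOL-Complex_Analysis.Complex_Analysis"
begin

definition r2 :: "nat \<Rightarrow> nat" where
  "r2 n = card {(a :: int, b :: int). a\<^sup>2 + b\<^sup>2 = int n}"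

(* The value at the pole 1 is fixed to 0 only to make the description unique. *)
definition riemann_zeta :: "complex \<Rightarrow> complex" where
  "riemann_zeta = (THE f. f holomorphic_on (- {1}) \<and> f 1 = 0 \<and>
     (\<forall>s. Re s > 1 \<longrightarrow> (\<lambda>n. of_nat (Suc n) powr (- s)) sums f s))"

definition L_chi4 :: "complex \<Rightarrow> complex" where
  "L_chi4 = (THE f. f holomorphic_on UNIV \<and>
     (\<forall>s. Re s > 0 \<longrightarrow> (\<lambda>k. (- 1) ^ k * of_nat (2 * k + 1) powr (- s)) sums f s))"

definition xi :: "complex \<Rightarrow> complex" where
  "xi s = of_real pi powr (- s / 2) * Gamma (s / 2) * riemann_zeta s"

definition xi4 :: "complex \<Rightarrow> complex" where
  "xi4 s = 2 powr s * of_real pi powr (- (s + 1) / 2) * Gamma ((s + 1) / 2) * L_chi4 s"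

(* Applied at - s, and combined with the functional equations xi (s + 1) = xi (- s) and
   xi4 (s + 1) = xi4 (- s), this gives
     Gamma (- s) * riemann_zeta (- s) * L_chi4 (- s) = pi powr (- s) / 2 * xi (s + 1) * xi4 (s + 1).
   With these normalisations of xi and xi4, an integral of xi (s + 1) * xi4 (s + 1) that is to
   agree with one of Gamma (- s) * riemann_zeta (- s) * L_chi4 (- s) therefore carries
   (- t / pi) powr s where the latter carries (- t) powr s. *)
lemma xi_mult_xi4:
  assumes "s \<notin> \<int>\<^sub>\<le>\<^sub>0"
  shows "xi s * xi4 s = 2 * of_real pi powr (- s) * Gamma s * riemann_zeta s * L_chi4 s"
proof -
  have a: "s / 2 \<notin> \<int>\<^sub>\<le>\<^sub>0" 
  proof
    assume "s / 2 \<in> \<int>\<^sub>\<le>\<^sub>0"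
    then obtain n where "s / 2 = - of_nat n" by (elim nonpos_Ints_cases')
    then have "s = - of_nat (2 * n)" by (simp add: field_simps)
    with assms show False by (metis minus_of_nat_in_nonpos_Ints)
  qed
  have b: "s / 2 + 1 / 2 \<notin> \<int>\<^sub>\<le>\<^sub>0"
  proof
    assume "s / 2 + 1 / 2 \<in> \<int>\<^sub>\<le>\<^sub>0"
    then obtain n where n: "s / 2 + 1 / 2 = - of_nat n" by (elim nonpos_Ints_cases')
    have "s = 2 * (s / 2 + 1 / 2) - 1" by (simp add: field_simps)
    then have "s = - of_nat (2 * n + 1)" unfolding n by simp
    with assms show False by (metis minus_of_nat_in_nonpos_Ints)
  qed
  have g: "Gamma (s / 2) * Gamma ((s + 1) / 2) = 2 powr (1 - s) * of_real (sqrt pi) * Gamma s"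
    using Gamma_legendre_duplication[OF a b]
    by (simp add: add_divide_distrib powr_def Ln_of_real[of 2, simplified])
  have sq: "complex_of_real (sqrt pi) = of_real pi powr (1 / 2)"
    by (simp add: powr_of_real[of pi "1/2", simplified] powr_half_sqrt)
  have p: "of_real pi powr (- s / 2) * of_real pi powr (- (s + 1) / 2) * complex_of_real (sqrt pi)
      = of_real pi powr (- s)"
    unfolding sq by (simp add: powr_def exp_add [symmetric]) (simp add: field_simps)
  have t: "2 powr s * 2 powr (1 - s) = (2 :: complex)"
    by (simp add: powr_add [symmetric])
  have "xi s * xi4 s = 2 powr s * (of_real pi powr (- s / 2) * of_real pi powr (- (s + 1) / 2))
      * (Gamma (s / 2) * Gamma ((s + 1) / 2)) * riemann_zeta s * L_chi4 s"
    unfolding xi_def xi4_def by (simp only: mult_ac)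
  also have "\<dots> = (2 powr s * 2 powr (1 - s)) * (of_real pi powr (- s / 2)
      * of_real pi powr (- (s + 1) / 2) * complex_of_real (sqrt pi))
      * Gamma s * riemann_zeta s * L_chi4 s"
    unfolding g by (simp only: mult_ac)
  finally show ?thesis unfolding p t .
qed

(* The n-th derivative on the closed half-line; at 0 it is the one-sided (left) derivative.
   Values at positive arguments are meaningless and never used. *)
definition halfline_deriv :: "nat \<Rightarrow> (real \<Rightarrow> complex) \<Rightarrow> real \<Rightarrow> complex" where
  "halfline_deriv n F = ((\<lambda>f x. vector_derivative f (at x within {..0})) ^^ n) F"

(* Functions on the closed half-line are represented by total functions, of which only the
   restriction to {..0} matters. *)
definition schwartz_halfline :: "(real \<Rightarrow> complex) set" where
  "schwartz_halfline = {F.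
     (\<forall>n. \<forall>x\<le>0. halfline_deriv n F differentiable (at x within {..0})) \<and>
     (\<forall>n m. ((\<lambda>x. of_real (\<bar>x\<bar> ^ m) * halfline_deriv n F x) \<longlongrightarrow> 0) at_bot)}"

(* complex_deriv_at_0 F s is the derivative of complex order s of F at 0. *)
definition complex_deriv_at_0 :: "(real \<Rightarrow> complex) \<Rightarrow> complex \<Rightarrow> complex" where
  "complex_deriv_at_0 F = (THE G. G holomorphic_on UNIV \<and>
     (\<forall>s. Re s < 0 \<longrightarrow>
        G s = 1 / Gamma (- s) * (LBINT u:{0<..}. of_real u powr (- s - 1) * F (- u))))"

(* Integration along the upward vertical line Re s = c, parametrised by s = c + iy. *)
definition vline_integrable :: "real \<Rightarrow> (complex \<Rightarrow> complex) \<Rightarrow> bool" where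
  "vline_integrable c g \<longleftrightarrow> integrable lborel (\<lambda>y. g (Complex c y))"

definition vline_integral :: "real \<Rightarrow> (complex \<Rightarrow> complex) \<Rightarrow> complex" where
  "vline_integral c g = \<i> * (LBINT y. g (Complex c y))"

end

(* Since r_n / 4 is the sum of chi_4(d) over d | n, the Dirichlet series of r_n is 4 zeta L, and Mellin
   inversion on Re z = 4 writes the left-hand side as the integral of
   4 Gamma(z) zeta(z) L(z) F^(-z)(0) (-t)^(-z), where Gamma(z) F^(-z)(0) is the Mellin transform of
   u |-> F(-u). Jacobi's transformation of theta^2 (the series of r_n exp(-pi n x)) shows that
   4 pi^(-z) Gamma(z) zeta(z) L(z) is symmetric under z -> 1 - z, with simple poles at 0 and 1 only, of
   residues -1 and 1; this gives the equality of the two integrals. Moving the line from Re z = 4 to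
   Re z = -c picks up the residues at 1 and 0, i.e. the two explicit terms. The move is justified because
   zeta and L grow polynomially on vertical strips (they are Mellin transforms of periodic functions, which
   can be integrated by parts repeatedly), while the Mellin transform of a Schwartz function decays faster
   than any power. *)

theory Submission
  imports Defs "HOL-Number_Theory.Number_Theory" "HOL-Probability.Probability"
    "HOL-Real_Asymp.Real_Asymp"
begin

section \<open>Sums of two squares\<close>

text \<open>Convergence shapes the argument. The factor Gamma(z) is never estimated: combined with
  the reciprocal Gamma in F^(-z)(0) it collapses to 1 / (z (z+1) ... (z+k-1)) in front of the Mellin
  transform of the k-th derivative, with k at one's disposal. Choosing k large gives the decay on
  strips; choosing k = 2 turns Mellin inversion into an absolutely convergent double integral whose
  inner integral, of X^z / (z (z+1)), is elementary. The line Re z = 4 comes from the crude bound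
  r_n <= (2n+1)^2, which gives absolute convergence of the series for Re z > 3. The product 4 Gamma
  zeta L is replaced by \<open>r2_xi\<close>, which is holomorphic off 0 and 1, so that the poles of
  Gamma at the negative integers do not appear among the residues. One theorem on rectangles, in
  which the number of enclosed poles may grow with the height, serves three times: for the kernel
  above, for the Poisson summation behind Jacobi's transformation, and for the final shift.\<close>

definition chi4 :: "nat \<Rightarrow> int" where
  "chi4 n = (if n mod 4 = 1 then 1 else if n mod 4 = 3 then - 1 else 0)"

lemma chi4_simps [simp]: "chi4 0 = 0" "chi4 (Suc 0) = 1"
  by (simp_all add: chi4_def)

lemma chi4_odd: "chi4 (2 * k + 1) = (- 1) ^ k"
proof (cases "even k")
  case True
  then obtain j where "k = 2 * j" by blast
  then show ?thesis by (simp add: chi4_def mod_Suc)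
next
  case False
  then have "(2 * k + 1) mod 4 = 3" by presburger
  then show ?thesis using False by (simp add: chi4_def)
qed

lemma chi4_mult: "chi4 (m * n) = chi4 m * chi4 n"
proof -
  have "m mod 4 \<in> {0,1,2,3}" "n mod 4 \<in> {0,1,2,3}" by auto
  moreover have "(m * n) mod 4 = (m mod 4) * (n mod 4) mod 4" by (simp add: mod_mult_eq)
  ultimately show ?thesis unfolding chi4_def by auto
qed

section \<open>Divisor sums of the character modulo 4\<close>

definition chi4_divisor_sum :: "nat \<Rightarrow> int" where
  "chi4_divisor_sum n = (\<Sum>d | d dvd n. chi4 d)"

text \<open>By Euclid's lemma the divisors of p n are those of n together with p times those of n;
  the overlap is p times the divisors of n / p. Inclusion-exclusion and multiplicativity give the
  recursion, which is the Euler factor 1 / ((1 - X) (1 - chi(p) X)) of zeta times L in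
  disguise.\<close>

lemma chi4_divisor_sum_rec:
  assumes p: "prime p" and n: "n > 0"
  shows "chi4_divisor_sum (p * n) = (1 + chi4 p) * chi4_divisor_sum n
    - chi4 p * (if p dvd n then chi4_divisor_sum (n div p) else 0)"
proof -
  have p0: "p > 0" using p by (simp add: prime_gt_0_nat)
  have fin: "finite {d. d dvd m}" if "m > 0" for m :: nat using that by simp
  have un: "{d. d dvd p * n} = {d. d dvd n} \<union> (*) p ` {d. d dvd n}"
  proof (intro equalityI subsetI)
    fix d assume "d \<in> {d. d dvd p * n}"
    then have d: "d dvd p * n" by simp
    show "d \<in> {d. d dvd n} \<union> (*) p ` {d. d dvd n}"
    proof (cases "p dvd d")
      case True
      then obtain e where "d = p * e" by blast
      with d p0 show ?thesis by auto
    next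
      case False
      with p have "coprime p d" by (simp add: prime_imp_coprime)
      with d show ?thesis by (simp add: coprime_commute coprime_dvd_mult_right_iff)
    qed
  qed (auto intro: dvd_mult)
  have int: "{d. d dvd n} \<inter> (*) p ` {d. d dvd n}
      = (if p dvd n then (*) p ` {d. d dvd n div p} else {})"
  proof (cases "p dvd n")
    case True
    then obtain m where m: "n = p * m" by blast
    show ?thesis unfolding m using p0 by (auto intro: dvd_mult)
  next
    case False
    then show ?thesis by (auto dest: dvd_mult_left)
  qed
  have im: "(\<Sum>d\<in>(*) p ` A. chi4 d) = chi4 p * (\<Sum>d\<in>A. chi4 d)" for A
  proof -
    have "inj_on ((*) p) A" using p0 by (auto simp: inj_on_def)
    then show ?thesis by (simp add: sum.reindex chi4_mult sum_distrib_left)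
  qed
  have "chi4_divisor_sum (p * n) = (\<Sum>d | d dvd n. chi4 d) + (\<Sum>d\<in>(*) p ` {d. d dvd n}. chi4 d)
     - (\<Sum>d\<in>{d. d dvd n} \<inter> (*) p ` {d. d dvd n}. chi4 d)"
    unfolding chi4_divisor_sum_def un using n by (intro sum_Un) auto
  also have "\<dots> = (1 + chi4 p) * chi4_divisor_sum n
    - chi4 p * (if p dvd n then chi4_divisor_sum (n div p) else 0)"
    unfolding int im by (simp add: im chi4_divisor_sum_def distrib_right)
  finally show ?thesis .
qed

section \<open>Representations of p n in terms of those of n, for each type of prime\<close>

definition norm_reps :: "nat \<Rightarrow> (int \<times> int) set" where
  "norm_reps n = {(a, b). a\<^sup>2 + b\<^sup>2 = int n}"

lemma r2_eq_card: "r2 n = card (norm_reps n)"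
  by (simp add: r2_def norm_reps_def)

lemma norm_reps_subset: "norm_reps n \<subseteq> {- int n..int n} \<times> {- int n..int n}"
proof -
  have *: "- int n \<le> a \<and> a \<le> int n" if "a\<^sup>2 + b\<^sup>2 = int n" for a b :: int
  proof -
    have "a\<^sup>2 \<le> int n" using that zero_le_power2[of b] by linarith
    moreover have "\<bar>a\<bar> \<le> a\<^sup>2"
      using self_le_power[of "\<bar>a\<bar>" 2] by (cases "a = 0") auto
    ultimately show ?thesis by linarith
  qed
  show ?thesis
  proof
    fix x assume "x \<in> norm_reps n"
    then obtain a b where "x = (a, b)" "a\<^sup>2 + b\<^sup>2 = int n" by (auto simp: norm_reps_def)
    then show "x \<in> {- int n..int n} \<times> {- int n..int n}"
      using *[of a b] *[of b a] by (simp add: add.commute)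
  qed
qed

lemma finite_norm_reps: "finite (norm_reps n)"
  by (rule finite_subset[OF norm_reps_subset]) simp

text \<open>Counting all points of the surrounding square is wasteful, but only polynomial growth
  matters. The exponent 2 is the origin of the condition Re z > 3 for the series over r_n.\<close>

lemma r2_le: "r2 n \<le> (2 * n + 1)\<^sup>2"
proof -
  have "r2 n \<le> card ({- int n..int n} \<times> {- int n..int n})"
    unfolding r2_eq_card by (intro card_mono norm_reps_subset) simp
  also have "\<dots> = (2 * n + 1)\<^sup>2"
    by (simp add: card_cartesian_product power2_eq_square nat_add_distrib nat_mult_distrib)
  finally show ?thesis .
qed

lemma r2_0: "r2 0 = 1"
proof -
  have "norm_reps 0 = {(0, 0)}" by (auto simp: norm_reps_def sum_power2_eq_zero_iff)
  then show ?thesis by (simp add: r2_eq_card)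
qed

lemma r2_1: "r2 (Suc 0) = 4"
proof -
  have "norm_reps (Suc 0) = {(1, 0), (-1, 0), (0, 1), (0, -1)}"
  proof (intro equalityI subsetI)
    fix x assume x: "x \<in> norm_reps (Suc 0)"
    then have "x \<in> {- 1..1} \<times> {- 1..1}" using norm_reps_subset[of "Suc 0"] by auto
    then obtain a b :: int where ab: "x = (a, b)" "- 1 \<le> a" "a \<le> 1" "- 1 \<le> b" "b \<le> 1" by auto
    then have "a = - 1 \<or> a = 0 \<or> a = 1" "b = - 1 \<or> b = 0 \<or> b = 1" by linarith+
    with x show "x \<in> {(1, 0), (-1, 0), (0, 1), (0, -1)}" by (auto simp: norm_reps_def ab(1))
  qed (auto simp: norm_reps_def)
  then show ?thesis by (simp add: r2_eq_card)
qed

text \<open>If p divides both coordinates then p^2 divides p n, hence p divides n, and dividing by p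
  is a bijection onto the representations of n / p. This count is the correction term of the Hecke
  recursion.\<close>

lemma card_norm_reps_multiples:
  assumes "p > 0"
  shows "card {(a, b) \<in> norm_reps (p * n). int p dvd a \<and> int p dvd b}
    = (if p dvd n then r2 (n div p) else 0)"
proof (cases "p dvd n")
  case True
  then obtain m where m: "n = p * m" by blast
  have "{(a, b) \<in> norm_reps (p * n). int p dvd a \<and> int p dvd b}
      = (\<lambda>(a, b). (int p * a, int p * b)) ` norm_reps m" (is "?A = ?B")
  proof (intro equalityI subsetI)
    fix x assume "x \<in> ?A"
    then obtain a b where x: "x = (int p * a, int p * b)" "(int p * a)\<^sup>2 + (int p * b)\<^sup>2 = int (p * n)"
      by (auto simp: norm_reps_def elim!: dvdE)
    from x(2) have "(int p)\<^sup>2 * (a\<^sup>2 + b\<^sup>2) = (int p)\<^sup>2 * int m"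
      unfolding m by (simp add: power_mult_distrib algebra_simps power2_eq_square)
    with assms have "a\<^sup>2 + b\<^sup>2 = int m" by simp
    with x(1) show "x \<in> ?B" by (auto simp: norm_reps_def)
  next
    fix x assume "x \<in> ?B"
    then obtain a b where x: "x = (int p * a, int p * b)" "a\<^sup>2 + b\<^sup>2 = int m"
      by (auto simp: norm_reps_def)
    have "(int p * a)\<^sup>2 + (int p * b)\<^sup>2 = (int p)\<^sup>2 * (a\<^sup>2 + b\<^sup>2)"
      by (simp add: power_mult_distrib distrib_left)
    then have "(int p * a)\<^sup>2 + (int p * b)\<^sup>2 = int (p * n)"
      unfolding x(2) m by (simp add: power2_eq_square)
    with x(1) show "x \<in> ?A" by (simp add: norm_reps_def)
  qed
  moreover have "inj_on (\<lambda>(a, b). (int p * a, int p * b)) (norm_reps m)"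
    using assms by (auto simp: inj_on_def)
  ultimately show ?thesis using True m assms by (simp add: card_image r2_eq_card)
next
  case False
  have "{(a, b) \<in> norm_reps (p * n). int p dvd a \<and> int p dvd b} = {}"
  proof -
    have False if "a\<^sup>2 + b\<^sup>2 = int (p * n)" "int p dvd a" "int p dvd b" for a b
    proof -
      from that obtain c d where "a = int p * c" "b = int p * d" by (auto elim!: dvdE)
      with that(1) have "int p * (int p * (c\<^sup>2 + d\<^sup>2)) = int p * int n"
        by (simp add: power2_eq_square algebra_simps)
      with assms have "int p * (c\<^sup>2 + d\<^sup>2) = int n" by simp
      then have "int p dvd int n" by (metis dvd_triv_left)
      with False show False by simp
    qed
    then show ?thesis by (auto simp: norm_reps_def)
  qed
  with False show ?thesis by (simp only: card.empty if_False)
qed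

text \<open>The map is conjugation of a + b i followed by multiplication by 1 + i, the Gaussian
  prime above 2. It can be inverted over the integers because a and b have the same parity when
  their squares add up to an even number.\<close>

lemma r2_two_mult: "r2 (2 * n) = r2 n"
proof -
  have "bij_betw (\<lambda>(a, b). (a + b, a - b)) (norm_reps n) (norm_reps (2 * n))"
  proof (rule bij_betwI[where g = "\<lambda>(a, b). ((a + b) div 2, (a - b) div 2)"])
    show "(\<lambda>(a, b). (a + b, a - b)) \<in> norm_reps n \<rightarrow> norm_reps (2 * n)"
      by (auto simp: norm_reps_def power2_eq_square algebra_simps)
    show "(\<lambda>(a, b). ((a + b) div 2, (a - b) div 2)) \<in> norm_reps (2 * n) \<rightarrow> norm_reps n"
    proof (clarsimp simp: norm_reps_def)
      fix a b :: int assume ab: "a\<^sup>2 + b\<^sup>2 = 2 * int n"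
      then have "even (a\<^sup>2 + b\<^sup>2)" by simp
      then have "even (a + b)" by simp
      then obtain u where u: "a + b = 2 * u" by blast
      then have a: "a = 2 * u - b" by simp
      have "a - b = 2 * (u - b)" using a by simp
      moreover have "u\<^sup>2 + (u - b)\<^sup>2 = int n"
        using ab unfolding a by (simp add: power2_eq_square algebra_simps)
      ultimately show "((a + b) div 2)\<^sup>2 + ((a - b) div 2)\<^sup>2 = int n"
        unfolding u by (metis nonzero_mult_div_cancel_left zero_neq_numeral)
    qed
    fix x :: "int \<times> int" assume "x \<in> norm_reps (2 * n)"
    then obtain a b where x: "x = (a, b)" "a\<^sup>2 + b\<^sup>2 = 2 * int n" by (auto simp: norm_reps_def)
    then have "even (a\<^sup>2 + b\<^sup>2)" by simp
    then have "even (a + b)" by simp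
    then obtain u where "a + b = 2 * u" by blast
    then have "a = 2 * u - b" by simp
    then have "(a + b) div 2 = u" "(a - b) div 2 = u - b" by auto
    with x \<open>a = _\<close> show "(case case x of (a, b) \<Rightarrow> ((a + b) div 2, (a - b) div 2) of (a, b) \<Rightarrow> (a + b, a - b)) = x"
      by simp
  qed auto
  then show ?thesis unfolding r2_eq_card by (simp add: bij_betw_same_card)
qed

text \<open>With p = 4k + 3 the exponent (p - 1) / 2 = 2k + 1 is odd. Raising a^2 = - b^2 to this
  power and applying Fermat's theorem to both sides would give 1 = -1 modulo p.\<close>

lemma prime_3_mod_4_dvd_sum_squares:
  assumes p: "prime p" "p mod 4 = 3" and dvd: "int p dvd a\<^sup>2 + b\<^sup>2"
  shows "int p dvd a"
proof (rule ccontr)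
  assume na: "\<not> int p dvd a"
  have pi: "prime (int p)" using p(1) by simp
  have nb: "\<not> int p dvd b"
  proof
    assume "int p dvd b"
    then have "int p dvd b\<^sup>2" by (simp add: power2_eq_square)
    then have "int p dvd a\<^sup>2" using dvd by (simp add: dvd_add_left_iff)
    with na pi show False using prime_dvd_power by blast
  qed

  define k where "k = (p - 3) div 4"
  have pk: "p = 4 * k + 3" using p(2) unfolding k_def by presburger
  have fermat: "[x ^ (p - 1) = 1] (mod int p)" if "\<not> int p dvd x" for x
  proof -
    have "\<not> p dvd nat \<bar>x\<bar>" using that by (simp add: dvd_nat_abs_iff)
    then have "[nat \<bar>x\<bar> ^ (p - 1) = 1] (mod p)" using p(1) by (rule fermat_theorem[rotated])
    then have "[int (nat \<bar>x\<bar> ^ (p - 1)) = int 1] (mod int p)" by (simp only: cong_int_iff)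
    moreover have "int (nat \<bar>x\<bar> ^ (p - 1)) = x ^ (p - 1)" by (simp add: pk power_even_abs)
    ultimately show ?thesis by simp
  qed
  have "[a\<^sup>2 = - (b\<^sup>2)] (mod int p)" using dvd by (simp add: cong_iff_dvd_diff)
  then have "[(a\<^sup>2) ^ (2 * k + 1) = (- (b\<^sup>2)) ^ (2 * k + 1)] (mod int p)" by (rule cong_pow)
  moreover have "(a\<^sup>2) ^ (2 * k + 1) = a ^ (p - 1)" by (subst power_mult [symmetric]) (simp add: pk)
  moreover have "(- (b\<^sup>2)) ^ (2 * k + 1) = - ((b\<^sup>2) ^ (2 * k + 1))" by (subst power_minus_odd) auto
  moreover have "(b\<^sup>2) ^ (2 * k + 1) = b ^ (p - 1)" by (subst power_mult [symmetric]) (simp add: pk)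
  ultimately have "[a ^ (p - 1) = - (b ^ (p - 1))] (mod int p)" by simp
  moreover have "[- (b ^ (p - 1)) = - 1] (mod int p)"
    using fermat[OF nb] cong_minus_minus_iff by blast
  ultimately have "[1 = - 1] (mod int p)" using fermat[OF na] by (meson cong_sym cong_trans)
  then have "int p dvd 2" by (simp add: cong_iff_dvd_diff)
  then have "p dvd 2" by presburger
  then show False using pk by (auto dest: dvd_imp_le)
qed

text \<open>An inert prime: every representation of p n is p times a representation of n /
  p.\<close>

lemma r2_mult_prime_3_mod_4:
  assumes p: "prime p" "p mod 4 = 3"
  shows "r2 (p * n) = (if p dvd n then r2 (n div p) else 0)"
proof -
  have d: "int p dvd a \<and> int p dvd b" if "a\<^sup>2 + b\<^sup>2 = int p * int n" for a b
    using prime_3_mod_4_dvd_sum_squares[OF p, of a b] prime_3_mod_4_dvd_sum_squares[OF p, of b a] that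
    by (simp add: add.commute)
  have "norm_reps (p * n) = {(a, b) \<in> norm_reps (p * n). int p dvd a \<and> int p dvd b}"
    using d by (auto simp: norm_reps_def)
  then have "r2 (p * n) = card {(a, b) \<in> norm_reps (p * n). int p dvd a \<and> int p dvd b}"
    unfolding r2_eq_card by simp
  also have "\<dots> = (if p dvd n then r2 (n div p) else 0)"
    using p(1) by (intro card_norm_reps_multiples) (simp add: prime_gt_0_nat)
  finally show ?thesis .
qed

text \<open>Euler's criterion: (p - 1) / 2 is even, so the Legendre symbol of -1 is congruent to 1,
  and the values 0 and -1 are excluded because p > 2.\<close>

lemma exists_sqrt_minus_one_mod_prime:
  assumes p: "prime p" "p mod 4 = 1"
  obtains z :: int where "int p dvd z\<^sup>2 + 1"
proof -
  have p2: "p > 2" using p prime_ge_2_nat[of p] by (cases "p = 2") auto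
  have "[Legendre (- 1) (int p) = (- 1) ^ ((p - 1) div 2)] (mod int p)"
    using euler_criterion[OF p(1) p2] .
  moreover have "even ((p - 1) div 2)" using p(2) by presburger
  ultimately have "[Legendre (- 1) (int p) = 1] (mod int p)" by simp
  moreover have "\<not> [- 1 = 1] (mod int p)" "\<not> [0 = 1] (mod int p)"
    using p2 by (auto simp: cong_iff_dvd_diff zdvd_not_zless dest: zdvd_imp_le)
  ultimately have "QuadRes (int p) (- 1)" by (auto simp: Legendre_def split: if_splits)
  then obtain z where "[z\<^sup>2 = - 1] (mod int p)" by (auto simp: QuadRes_def)
  then show ?thesis by (intro that[of z]) (simp add: cong_iff_dvd_diff)
qed

text \<open>Thue's pigeonhole argument applied to \<open>(x, y) \<mapsto> x - z y\<close> with \<open>z\<^sup>2 \<equiv> -1\<close>.\<close>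

lemma prime_1_mod_4_sum_squares:
  assumes p: "prime p" "p mod 4 = 1"
  obtains u v :: int where "u\<^sup>2 + v\<^sup>2 = int p"
proof -
  obtain z :: int where z: "int p dvd z\<^sup>2 + 1" using exists_sqrt_minus_one_mod_prime[OF p] .
  have p1: "p > 1" using prime_gt_1_nat[OF p(1)] .
  define k where "k = nat \<lfloor>sqrt (real p)\<rfloor>"
  have k1: "real k \<le> sqrt (real p)" and k2: "sqrt (real p) < real k + 1"
    unfolding k_def by (simp_all add: of_nat_nat)
  have kp: "p < (k + 1)\<^sup>2"
  proof -
    have "(sqrt (real p))\<^sup>2 < (real k + 1)\<^sup>2" using k2 by (intro power_strict_mono) auto
    then have "real p < real ((k + 1)\<^sup>2)" by (simp add: add.commute)
    then show ?thesis by (simp only: of_nat_less_iff)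
  qed
  have kp': "k\<^sup>2 \<le> p"
  proof -
    have "(real k)\<^sup>2 \<le> (sqrt (real p))\<^sup>2" using k1 by (intro power_mono) auto
    then have "real (k\<^sup>2) \<le> real p" by simp
    then show ?thesis by (simp only: of_nat_le_iff)
  qed
  let ?f = "\<lambda>(x, y). (int x - z * int y) mod int p"
  have "card (?f ` ({..k} \<times> {..k})) \<le> card {0..<int p}"
    using p1 by (intro card_mono) auto
  also have "\<dots> < card ({..k} \<times> {..k})"
    using kp by (simp add: card_cartesian_product power2_eq_square)
  finally have "\<not> inj_on ?f ({..k} \<times> {..k})" using pigeonhole by blast
  then obtain x y x' y' where xy: "x \<le> k" "y \<le> k" "x' \<le> k" "y' \<le> k" "(x, y) \<noteq> (x', y')"
      "(int x - z * int y) mod int p = (int x' - z * int y') mod int p"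
    by (auto simp: inj_on_def)
  define u where "u = int x - int x'"
  define v where "v = int y - int y'"
  have "int p dvd (int x - z * int y) - (int x' - z * int y')"
    using xy(6) by (simp add: mod_eq_dvd_iff)
  also have "(int x - z * int y) - (int x' - z * int y') = u - z * v"
    by (simp add: u_def v_def algebra_simps)
  finally have "int p dvd u - z * v" .
  \<comment> \<open>The combination is designed so that the z^2 v^2 terms cancel and u^2 + v^2
    remains.\<close>
  then have "int p dvd (u - z * v) * (u + z * v) + (z\<^sup>2 + 1) * v\<^sup>2"
    using z by (metis dvd_add dvd_mult2)
  also have "(u - z * v) * (u + z * v) + (z\<^sup>2 + 1) * v\<^sup>2 = u\<^sup>2 + v\<^sup>2"
    by (simp add: power2_eq_square algebra_simps)
  finally obtain m where m: "u\<^sup>2 + v\<^sup>2 = int p * m" by blast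
  have pos: "u\<^sup>2 + v\<^sup>2 > 0" using xy(5) unfolding u_def v_def by (simp add: sum_power2_gt_zero_iff)
  \<comment> \<open>A prime is no square, so both squares are at most k^2 < p and the sum is
    strictly below 2 p; this forces the multiple of p to be p itself.\<close>
  have ksq: "k\<^sup>2 \<noteq> p"
  proof
    assume "k\<^sup>2 = p"
    with p(1) show False using prime_power_iff[of k 2] by simp
  qed
  have le: "w\<^sup>2 \<le> int (k\<^sup>2)" if "\<bar>w\<bar> \<le> int k" for w
    using power_mono[OF that, of 2] by simp
  have "u\<^sup>2 \<le> int (k\<^sup>2)" "v\<^sup>2 \<le> int (k\<^sup>2)" using xy by (intro le, simp add: u_def v_def)+
  moreover have "int (k\<^sup>2) < int p" using kp' ksq by simp
  ultimately have "int p * m < int p * 2" using m by linarith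
  then have "m < 2" using p1 by simp
  moreover have "m > 0" using pos p1 unfolding m by (simp add: zero_less_mult_iff)
  ultimately have "m = 1" by simp
  with m show ?thesis by (intro that[of u v]) simp
qed

text \<open>A split prime: p is the product of u + v i and its conjugate. A representation of p n is
  divisible by one of these two Gaussian primes, each class is in bijection with the representations
  of n, and the members of both classes are those divisible by p. Inclusion-exclusion yields the
  identity.\<close>

lemma r2_mult_prime_1_mod_4:
  assumes p: "prime p" "p mod 4 = 1"
  shows "r2 (p * n) + (if p dvd n then r2 (n div p) else 0) = 2 * r2 n"
proof -
  obtain u v where uv: "u\<^sup>2 + v\<^sup>2 = int p" using prime_1_mod_4_sum_squares[OF p] .
  have p0: "p > 0" and pi: "prime (int p)" using p(1) by (simp_all add: prime_gt_0_nat)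
  have nu: "\<not> int p dvd u" and nv: "\<not> int p dvd v" and p2: "\<not> int p dvd 2"
  proof -
    have a: False if "int p dvd w" "w'\<^sup>2 + w\<^sup>2 = int p" for w w'
    proof -
      obtain m where m: "w = int p * m" using \<open>int p dvd w\<close> by blast
      show False
      proof (cases "m = 0")
        case True
        with m that have "\<bar>w'\<bar>\<^sup>2 = int p" by simp
        with pi show False using prime_power_iff[of "\<bar>w'\<bar>" 2] by simp
      next
        case False
        have "1 * 1 \<le> \<bar>m\<bar> * \<bar>m\<bar>" using False by (intro mult_mono) auto
        then have "1 \<le> m * m" by (simp add: abs_mult_self_eq)
        then have "int p * int p * 1 \<le> int p * int p * (m * m)" by (intro mult_left_mono) auto
        also have "\<dots> = w\<^sup>2" by (simp add: m power2_eq_square)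
        also have "\<dots> \<le> int p" using that(2) zero_le_power2[of w'] by linarith
        finally have "int p \<le> 1" using p0 by simp
        with prime_gt_1_nat[OF p(1)] show False by simp
      qed
    qed
    show "\<not> int p dvd v" using a[of v u] uv by blast
    show "\<not> int p dvd u" using a[of u v] uv by (metis add.commute)
    show "\<not> int p dvd 2"
    proof
      assume "int p dvd 2"
      then have "p dvd 2" by presburger
      then have "p \<le> 2" by (rule dvd_imp_le) simp
      with p prime_gt_1_nat[OF p(1)] show False by (cases "p = 2") auto
    qed
  qed
  let ?A = "{(a, b) \<in> norm_reps (p * n). int p dvd a * u + b * v}"
  let ?B = "{(a, b) \<in> norm_reps (p * n). int p dvd a * u - b * v}"
  \<comment> \<open>Modulo p one has u^2 = - v^2, so the product of the two linear forms is u^2 (a^2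
    + b^2) and vanishes modulo p.\<close>
  have cov: "norm_reps (p * n) = ?A \<union> ?B"
  proof -
    have "int p dvd a * u + b * v \<or> int p dvd a * u - b * v" if "a\<^sup>2 + b\<^sup>2 = int (p * n)" for a b
    proof -
      have "(a * u + b * v) * (a * u - b * v) = (a\<^sup>2 + b\<^sup>2) * u\<^sup>2 - b\<^sup>2 * (u\<^sup>2 + v\<^sup>2)"
        by (simp add: power2_eq_square algebra_simps)
      also have "\<dots> = int p * (int n * u\<^sup>2 - b\<^sup>2)" by (simp add: that uv algebra_simps)
      finally have "int p dvd (a * u + b * v) * (a * u - b * v)" by simp
      with pi show ?thesis by (simp add: prime_dvd_mult_iff)
    qed
    then show ?thesis by (auto simp: norm_reps_def)
  qed
  have inter: "?A \<inter> ?B = {(a, b) \<in> norm_reps (p * n). int p dvd a \<and> int p dvd b}"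
  proof -
    have "int p dvd a \<and> int p dvd b" if "int p dvd a * u + b * v" "int p dvd a * u - b * v" for a b
    proof -
      have e: "(a * u + b * v) + (a * u - b * v) = 2 * (a * u)"
        "(a * u + b * v) - (a * u - b * v) = 2 * (b * v)" by simp_all
      have "int p dvd 2 * (a * u)" "int p dvd 2 * (b * v)"
        using dvd_add[OF that] dvd_diff[OF that] by (simp_all only: e)
      with pi p2 nu nv show ?thesis by (simp add: prime_dvd_mult_iff)
    qed
    moreover have "int p dvd a * u + b * v \<and> int p dvd a * u - b * v" if "int p dvd a \<and> int p dvd b" for a b
      using that by (meson dvd_add dvd_diff dvd_mult2)
    ultimately show ?thesis by blast
  qed
  text \<open>Division of \<open>a + b i\<close> by a Gaussian prime above \<open>p\<close>.\<close>
  have card: "card {(a, b) \<in> norm_reps (p * n). int p dvd a * u + b * w} = r2 n"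
    if uw: "u\<^sup>2 + w\<^sup>2 = int p" and nw: "\<not> int p dvd w" for w
  proof -
    have "bij_betw (\<lambda>(c, d). (c * u - d * w, c * w + d * u)) (norm_reps n)
        {(a, b) \<in> norm_reps (p * n). int p dvd a * u + b * w}" (is "bij_betw ?f _ ?C")
    proof (rule bij_betw_imageI)
      show "inj_on ?f (norm_reps n)"
      proof (rule inj_onI, clarify)
        fix c d c' d' assume e: "c * u - d * w = c' * u - d' * w" "c * w + d * u = c' * w + d' * u"
        have "(c * u - d * w) * u + (c * w + d * u) * w = int p * c" for c d
          by (simp add: uw[symmetric] power2_eq_square algebra_simps)
        from this[of c d] this[of c' d'] e p0 have "c = c'" by simp
        moreover have "(c * w + d * u) * u - (c * u - d * w) * w = int p * d" for c d
          by (simp add: uw[symmetric] power2_eq_square algebra_simps)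
        from this[of c d] this[of c' d'] e p0 have "d = d'" by simp
        ultimately show "c = c' \<and> d = d'" by simp
      qed
      show "?f ` norm_reps n = ?C"
      proof (intro equalityI subsetI)
        fix x assume "x \<in> ?f ` norm_reps n"
        then obtain c d where cd: "x = (c * u - d * w, c * w + d * u)" "c\<^sup>2 + d\<^sup>2 = int n"
          by (auto simp: norm_reps_def)
        have "(c * u - d * w)\<^sup>2 + (c * w + d * u)\<^sup>2 = int (p * n)"
          by (simp add: uw[symmetric] cd(2)[symmetric] power2_eq_square algebra_simps)
        moreover have "(c * u - d * w) * u + (c * w + d * u) * w = int p * c"
          by (simp add: uw[symmetric] power2_eq_square algebra_simps)
        ultimately show "x \<in> ?C" by (auto simp: cd(1) norm_reps_def)
      next
        fix x assume "x \<in> ?C"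
        then obtain a b where ab: "x = (a, b)" "a\<^sup>2 + b\<^sup>2 = int (p * n)" "int p dvd a * u + b * w"
          by (auto simp: norm_reps_def)
        \<comment> \<open>The quotient of a + b i by u + w i has imaginary part (b u - a w) / p. Its
          integrality is obtained after multiplication by w, which is prime to p.\<close>
        have "(b * u - a * w) * w = b * (u * w) - a * w\<^sup>2" by (simp add: power2_eq_square algebra_simps)
        also have "\<dots> = (a * u + b * w) * u - a * int p"
          by (simp add: uw[symmetric] power2_eq_square algebra_simps)
        finally have "int p dvd (b * u - a * w) * w" using ab(3) by simp
        with pi nw have "int p dvd b * u - a * w" by (simp add: prime_dvd_mult_iff)
        then obtain d where d: "b * u - a * w = int p * d" by blast
        obtain c where c: "a * u + b * w = int p * c" using ab(3) by blast
        have "int p * (c * u - d * w) = (a * u + b * w) * u - (b * u - a * w) * w"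
          by (simp add: c d algebra_simps)
        also have "\<dots> = int p * a" by (simp add: uw[symmetric] power2_eq_square algebra_simps)
        finally have a: "a = c * u - d * w" using p0 by simp
        have "int p * (c * w + d * u) = (a * u + b * w) * w + (b * u - a * w) * u"
          by (simp add: c d algebra_simps)
        also have "\<dots> = int p * b" by (simp add: uw[symmetric] power2_eq_square algebra_simps)
        finally have b: "b = c * w + d * u" using p0 by simp
        have "(c\<^sup>2 + d\<^sup>2) * int p = a\<^sup>2 + b\<^sup>2"
          unfolding a b by (simp add: uw[symmetric] power2_eq_square algebra_simps)
        then have "c\<^sup>2 + d\<^sup>2 = int n" using ab(2) p0 by simp
        then show "x \<in> ?f ` norm_reps n" by (auto simp: norm_reps_def ab(1) a b intro!: image_eqI[of _ _ "(c, d)"])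
      qed
    qed
    then show ?thesis unfolding r2_eq_card by (simp add: bij_betw_same_card)
  qed
  have "card ?A = r2 n" using card[OF uv nv] .
  moreover have "card ?B = r2 n" using card[of "- v"] uv nv by simp
  moreover have "card ?A + card ?B = card (?A \<union> ?B) + card (?A \<inter> ?B)"
    by (intro card_Un_Int) (auto intro: finite_subset[OF _ finite_norm_reps[of "p * n"]])
  ultimately show ?thesis
    unfolding inter cov[symmetric] card_norm_reps_multiples[OF p0] r2_eq_card[symmetric] by simp
qed

text \<open>The cases p = 2 (ramified), p = 3 mod 4 (inert) and p = 1 mod 4 (split) are the values
  0, -1 and 1 of the character, and merge into the recursion satisfied by the divisor sum.\<close>

lemma r2_rec:
  assumes p: "prime p"
  shows "int (r2 (p * n)) = (1 + chi4 p) * int (r2 n)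
    - chi4 p * (if p dvd n then int (r2 (n div p)) else 0)"
proof -
  consider "p = 2" | "p mod 4 = 3" | "p mod 4 = 1"
  proof -
    have four: "p mod 4 = 3 \<or> p mod 4 = 1" if "odd p" using that by presburger
    have "odd p" if "p \<noteq> 2" using that p by (metis primes_dvd_imp_eq two_is_prime_nat)
    then show ?thesis using that
      by (cases "p = 2") (blast, use four in blast)
  qed
  then show ?thesis
  proof cases
    case 1
    then show ?thesis by (simp add: chi4_def r2_two_mult)
  next
    case 2
    then show ?thesis using r2_mult_prime_3_mod_4[OF p 2, of n] by (simp add: chi4_def)
  next
    case 3
    then show ?thesis using r2_mult_prime_1_mod_4[OF p 3, of n] by (auto simp: chi4_def split: if_splits)
  qed
qed

text \<open>Both sides satisfy the same Hecke recursion over the primes.\<close>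

theorem r2_eq_chi4_divisor_sum:
  assumes "n > 0"
  shows "int (r2 n) = 4 * chi4_divisor_sum n"
  using assms
proof (induction n rule: less_induct)
  case (less n)
  show ?case
  proof (cases "n = 1")
    case True
    then show ?thesis by (simp add: r2_1 chi4_divisor_sum_def)
  next
    case False
    with less.prems obtain p where p: "prime p" "p dvd n" using prime_factor_nat by blast
    then obtain m where m: "n = p * m" by blast
    have m0: "m > 0" "m < n" using less.prems m prime_gt_1_nat[OF p(1)] by auto
    have "int (r2 m) = 4 * chi4_divisor_sum m" using less.IH m0 by simp
    moreover have "int (r2 (m div p)) = 4 * chi4_divisor_sum (m div p)" if "p dvd m"
    proof (rule less.IH)
      show "m div p > 0" using that m0(1) by (auto elim!: dvdE)
      show "m div p < n" using m0 by (meson div_le_dividend order.strict_trans1)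
    qed
    ultimately show ?thesis
      unfolding m r2_rec[OF p(1)] chi4_divisor_sum_rec[OF p(1) m0(1)] by (auto simp: algebra_simps)
  qed
qed

section \<open>Holomorphic parameter integrals and Mellin transforms\<close>

text \<open>Differentiation under the integral sign without a separate hypothesis on the derivative:
  Cauchy's inequality on small discs turns the majorant g of the function into the majorant g / r'
  of its derivative, hence of the difference quotients, and dominated convergence applies along
  sequences.\<close>

lemma holomorphic_lebesgue_integral:
  fixes f :: "complex \<Rightarrow> 'a \<Rightarrow> complex"
  assumes U: "open U"
    and meas: "\<And>z. z \<in> U \<Longrightarrow> f z \<in> borel_measurable M"
    and holo: "\<And>x. x \<in> space M \<Longrightarrow> (\<lambda>z. f z x) holomorphic_on U"
    and g: "integrable M g"
    and bound: "\<And>z x. z \<in> U \<Longrightarrow> x \<in> space M \<Longrightarrow> norm (f z x) \<le> g x"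
  shows "(\<lambda>z. integral\<^sup>L M (f z)) holomorphic_on U"
proof -
  have int: "integrable M (f z)" if "z \<in> U" for z
    using g meas[OF that] by (rule Bochner_Integration.integrable_bound) (use bound that in force)
  have "(\<lambda>z. integral\<^sup>L M (f z)) field_differentiable at z" if z: "z \<in> U" for z
  proof -
    obtain r where r: "r > 0" "cball z r \<subseteq> U" using U z open_contains_cball by blast
    \<comment> \<open>Half the radius, so that discs of radius r' centred anywhere in
      \<open>ball z r'\<close> still lie in \<open>U\<close>.\<close>
    define r' where "r' = r / 2"
    have r': "r' > 0" "r' < r" using r by (auto simp: r'_def)
    define d where "d x = deriv (\<lambda>w. f w x) z" for x
    have lip: "norm (f w x - f z x) \<le> g x / r' * norm (w - z)"
      if x: "x \<in> space M" and w: "w \<in> ball z r'" for w x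
    proof -
      have "norm (f w x - f z x) \<le> g x / r' * norm (w - z)"
      proof (rule field_differentiable_bound[where S = "ball z r'" and f' = "deriv (\<lambda>w. f w x)"])
        fix v assume v: "v \<in> ball z r'"
        have sub: "cball v r' \<subseteq> U"
        proof
          fix u assume "u \<in> cball v r'"
          then have "dist z u \<le> r" using v dist_triangle[of z u v] by (auto simp: r'_def)
          with r show "u \<in> U" by auto
        qed
        then have vU: "v \<in> U" using r' by auto
        have h: "(\<lambda>w. f w x) holomorphic_on U" using holo[OF x] .
        show "((\<lambda>w. f w x) has_field_derivative deriv (\<lambda>w. f w x) v) (at v within ball z r')"
          using holomorphic_derivI[OF h U vU] by (rule has_field_derivative_at_within)
        have "norm ((deriv ^^ 1) (\<lambda>w. f w x) v) \<le> fact 1 * g x / r' ^ 1"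
        proof (rule Cauchy_inequality)
          show "(\<lambda>w. f w x) holomorphic_on ball v r'"
            using h sub by (meson ball_subset_cball holomorphic_on_subset)
          show "continuous_on (cball v r') (\<lambda>w. f w x)"
            using h sub by (meson holomorphic_on_imp_continuous_on holomorphic_on_subset)
          show "norm (f u x) \<le> g x" if "norm (v - u) = r'" for u
          proof (rule bound[OF _ x])
            show "u \<in> U" using sub that by (auto simp: dist_norm)
          qed
        qed (use r' in auto)
        then show "norm (deriv (\<lambda>w. f w x) v) \<le> g x / r'" by simp
      qed (use w r' in auto)
      then show ?thesis .
    qed
    have "((\<lambda>w. integral\<^sup>L M (f w)) has_field_derivative integral\<^sup>L M d) (at z)"
      unfolding has_field_derivative_iff
    proof (subst tendsto_at_iff_sequentially, intro allI impI)
      fix X :: "nat \<Rightarrow> complex" assume X: "\<forall>n. X n \<in> UNIV - {z}" "X \<longlonglongrightarrow> z"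
      \<comment> \<open>The Lipschitz bound holds only inside the ball; an initial segment of the
        sequence is therefore dropped.\<close>
      have "eventually (\<lambda>n. X n \<in> ball z r') sequentially"
        using X(2) r'(1) by (auto simp: tendsto_iff dist_commute)
      then obtain N where N: "\<And>n. n \<ge> N \<Longrightarrow> X n \<in> ball z r'" by (auto simp: eventually_sequentially)
      define Y where "Y n = X (n + N)" for n
      have Y: "Y n \<noteq> z" "Y n \<in> ball z r'" for n using X N by (auto simp: Y_def)
      have YU: "Y n \<in> U" for n using Y(2)[of n] r r' by auto
      have Yl: "Y \<longlonglongrightarrow> z" using X(2) unfolding Y_def by (rule LIMSEQ_ignore_initial_segment)
      define q where "q n x = (f (Y n) x - f z x) / (Y n - z)" for n x
      have qlim: "(\<lambda>n. q n x) \<longlonglongrightarrow> d x" if x: "x \<in> space M" for x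
      proof -
        have "((\<lambda>w. f w x) has_field_derivative d x) (at z)"
          unfolding d_def using holomorphic_derivI[OF holo[OF x] U z] .
        then have "((\<lambda>w. (f w x - f z x) / (w - z)) \<longlongrightarrow> d x) (at z)"
          by (simp add: has_field_derivative_iff)
        then show ?thesis unfolding q_def tendsto_at_iff_sequentially
          using Y(1) Yl by (auto simp: o_def)
      qed
      have qm: "q n \<in> borel_measurable M" for n
        unfolding q_def using meas[OF YU[of n]] meas[OF z] by measurable
      have "(\<lambda>n. integral\<^sup>L M (q n)) \<longlonglongrightarrow> integral\<^sup>L M d"
      proof (rule integral_dominated_convergence[where w = "\<lambda>x. g x / r'"])
        show "d \<in> borel_measurable M" by (rule borel_measurable_LIMSEQ_metric[OF qm qlim])
        show "integrable M (\<lambda>x. g x / r')" using g by simp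
        show "AE x in M. (\<lambda>n. q n x) \<longlonglongrightarrow> d x" using qlim by simp
        show "AE x in M. norm (q n x) \<le> g x / r'" for n
        proof (rule AE_I2)
          fix x assume x: "x \<in> space M"
          have "norm (q n x) = norm (f (Y n) x - f z x) / norm (Y n - z)"
            by (simp add: q_def norm_divide)
          also have "\<dots> \<le> (g x / r' * norm (Y n - z)) / norm (Y n - z)"
            using lip[OF x Y(2)] by (intro divide_right_mono) auto
          also have "\<dots> = g x / r'" using Y(1)[of n] by simp
          finally show "norm (q n x) \<le> g x / r'" .
        qed
      qed (rule qm)
      also have "(\<lambda>n. integral\<^sup>L M (q n)) = (\<lambda>n. (integral\<^sup>L M (f (Y n)) - integral\<^sup>L M (f z)) / (Y n - z))"
        unfolding q_def using int[OF YU] int[OF z] by (simp add: Bochner_Integration.integral_diff)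
      finally have *: "(\<lambda>n. (integral\<^sup>L M (f (Y n)) - integral\<^sup>L M (f z)) / (Y n - z)) \<longlonglongrightarrow> integral\<^sup>L M d" .
      show "((\<lambda>w. (integral\<^sup>L M (f w) - integral\<^sup>L M (f z)) / (w - z)) \<circ> X) \<longlonglongrightarrow> integral\<^sup>L M d"
        by (rule LIMSEQ_offset[of _ N]) (use * in \<open>simp add: Y_def o_def\<close>)
    qed
    then show ?thesis by (auto simp: field_differentiable_def)
  qed
  then show ?thesis
    by (auto simp: holomorphic_on_def intro: field_differentiable_at_within)
qed

section \<open>Mellin transforms and their strips of convergence\<close>

definition mellin :: "(real \<Rightarrow> complex) \<Rightarrow> complex \<Rightarrow> complex" where
  "mellin f z = (LBINT u:{0<..}. of_real u powr (z - 1) * f u)"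

definition mellin_integrable :: "(real \<Rightarrow> complex) \<Rightarrow> complex \<Rightarrow> bool" where
  "mellin_integrable f z = set_integrable lborel {0<..} (\<lambda>u. of_real u powr (z - 1) * f u)"

lemma measurable_powr_of_real [measurable]:
  "(\<lambda>u. complex_of_real u powr w) \<in> borel_measurable borel"
  unfolding powr_def by measurable

lemma norm_of_real_powr: "u > 0 \<Longrightarrow> norm (complex_of_real u powr w) = u powr Re w"
  by (simp add: norm_powr_real_powr)

lemma mellin_integrable_norm_iff:
  assumes "set_borel_measurable borel {0<..} f"
  shows "mellin_integrable f z \<longleftrightarrow>
    set_integrable lborel {0<..} (\<lambda>u. u powr (Re z - 1) * norm (f u))"
proof -
  have m: "set_borel_measurable lborel {0<..} (\<lambda>u. of_real u powr (z - 1) * f u)"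
  proof -
    have "(\<lambda>u. complex_of_real u powr (z - 1) * (indicator {0<..} u *\<^sub>R f u)) \<in> borel_measurable borel"
      using assms unfolding set_borel_measurable_def by measurable
    then show ?thesis by (simp add: set_borel_measurable_def scaleR_conv_of_real mult.left_commute)
  qed
  have m2: "set_borel_measurable lborel {0<..} (\<lambda>u. u powr (Re z - 1) * norm (f u))"
  proof -
    have "(\<lambda>u. u powr (Re z - 1) * norm (indicator {0<..} u *\<^sub>R f u)) \<in> borel_measurable borel"
      using assms unfolding set_borel_measurable_def by measurable
    then show ?thesis by (simp add: set_borel_measurable_def mult.left_commute)
  qed
  have "set_integrable lborel {0<..} (\<lambda>u. of_real u powr (z - 1) * f u) \<longleftrightarrow>
      set_integrable lborel {0<..} (\<lambda>u. u powr (Re z - 1) * norm (f u))"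
    unfolding set_integrable_def
  proof (intro iffI Bochner_Integration.integrable_bound[OF _ m2[unfolded set_borel_measurable_def]]
      Bochner_Integration.integrable_bound[OF _ m[unfolded set_borel_measurable_def]]; assumption?)
  qed (auto simp: indicator_def norm_mult norm_of_real_powr)
  then show ?thesis unfolding mellin_integrable_def .
qed

text \<open>Dominates all powers of a strip by its two edges at once: the upper exponent wins for u
  at least 1, the lower one for u below 1.\<close>

lemma powr_le_add_powr:
  fixes u :: real
  assumes "u > 0" "a \<le> x" "x \<le> b"
  shows "u powr x \<le> u powr a + u powr b"
proof (cases "u \<ge> 1")
  case True
  then have "u powr x \<le> u powr b" using assms by (intro powr_mono) auto
  then show ?thesis by (smt (verit) powr_ge_zero)
next
  case False
  then have "u powr x \<le> u powr a" using assms by (intro powr_mono') auto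
  then show ?thesis by (smt (verit) powr_ge_zero)
qed

text \<open>Only Re z enters the absolute value of u^(z-1), so the edges of the strip control its
  interior. The resulting bound is independent of Im z.\<close>

lemma mellin_integrable_between:
  assumes m: "set_borel_measurable borel {0<..} f"
    and a: "mellin_integrable f (of_real a)" and b: "mellin_integrable f (of_real b)"
    and z: "a \<le> Re z" "Re z \<le> b"
  shows "mellin_integrable f z"
    and "norm (mellin f z) \<le> (LBINT u:{0<..}. u powr (a - 1) * norm (f u))
      + (LBINT u:{0<..}. u powr (b - 1) * norm (f u))"
proof -
  let ?g = "\<lambda>u. u powr (a - 1) * norm (f u) + u powr (b - 1) * norm (f u)"
  have ia: "set_integrable lborel {0<..} (\<lambda>u. u powr (a - 1) * norm (f u))"
    and ib: "set_integrable lborel {0<..} (\<lambda>u. u powr (b - 1) * norm (f u))"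
    using a b by (simp_all add: mellin_integrable_norm_iff[OF m])
  have ig: "set_integrable lborel {0<..} ?g" using ia ib by (rule set_integral_add)
  have le: "u powr (Re z - 1) * norm (f u) \<le> ?g u" if "u > 0" for u
    unfolding distrib_right[symmetric]
    using z by (intro mult_right_mono powr_le_add_powr that) auto
  have iz: "set_integrable lborel {0<..} (\<lambda>u. u powr (Re z - 1) * norm (f u))"
  proof (rule set_integrable_bound[OF ig])
    have "(\<lambda>u. u powr (Re z - 1) * norm (indicator {0<..} u *\<^sub>R f u)) \<in> borel_measurable borel"
      using m unfolding set_borel_measurable_def by measurable
    then show "set_borel_measurable lborel {0<..} (\<lambda>u. u powr (Re z - 1) * norm (f u))"
      by (simp add: set_borel_measurable_def mult.left_commute)
    show "AE u in lborel. u \<in> {0<..} \<longrightarrow> norm (u powr (Re z - 1) * norm (f u)) \<le> norm (?g u)"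
      using le by (intro AE_I2) (auto intro!: order.trans[OF _ abs_ge_self])
  qed
  then show "mellin_integrable f z" by (simp add: mellin_integrable_norm_iff[OF m])
  have "norm (mellin f z) \<le> (LBINT u:{0<..}. norm (of_real u powr (z - 1) * f u))"
    unfolding mellin_def by (rule set_integral_norm_bound)
      (use \<open>mellin_integrable f z\<close> in \<open>simp add: mellin_integrable_def\<close>)
  also have "\<dots> = (LBINT u:{0<..}. u powr (Re z - 1) * norm (f u))"
    by (intro set_lebesgue_integral_cong) (auto simp: norm_mult norm_of_real_powr)
  also have "\<dots> \<le> (LBINT u:{0<..}. ?g u)"
    using le by (intro set_integral_mono iz ig) auto
  also have "\<dots> = (LBINT u:{0<..}. u powr (a - 1) * norm (f u))
      + (LBINT u:{0<..}. u powr (b - 1) * norm (f u))"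
    using ia ib by (rule set_integral_add)
  finally show "norm (mellin f z) \<le> \<dots>" .
qed

lemma open_Re_strip: "open {z. a < Re z \<and> Re z < b}"
  by (intro open_Collect_conj open_Collect_less continuous_intros)

lemma mellin_holomorphic_strip:
  assumes m: "set_borel_measurable borel {0<..} f"
    and a: "mellin_integrable f (of_real a)" and b: "mellin_integrable f (of_real b)"
  shows "mellin f holomorphic_on {z. a < Re z \<and> Re z < b}"
  unfolding mellin_def set_lebesgue_integral_def
proof (rule holomorphic_lebesgue_integral[OF open_Re_strip])
  let ?g = "\<lambda>u. indicator {0<..} u *\<^sub>R (u powr (a - 1) * norm (f u)) +
    indicator {0<..} u *\<^sub>R (u powr (b - 1) * norm (f u))"
  show "integrable lborel ?g"
    using a b by (simp add: mellin_integrable_norm_iff[OF m] set_integrable_def)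
  fix z :: complex and u :: real assume z: "z \<in> {z. a < Re z \<and> Re z < b}"
  have "u powr (Re z - 1) \<le> u powr (a - 1) + u powr (b - 1)" if "u > 0"
    using that z by (intro powr_le_add_powr) auto
  then show "norm (indicator {0<..} u *\<^sub>R (complex_of_real u powr (z - 1) * f u)) \<le> ?g u"
    by (auto simp: indicator_def norm_mult norm_of_real_powr distrib_right[symmetric]
        intro!: mult_right_mono)
next
  fix z :: complex
  have "(\<lambda>u. complex_of_real u powr (z - 1) * (indicator {0<..} u *\<^sub>R f u)) \<in> borel_measurable borel"
    using m unfolding set_borel_measurable_def by measurable
  then show "(\<lambda>u. indicator {0<..} u *\<^sub>R (complex_of_real u powr (z - 1) * f u)) \<in> borel_measurable lborel"
    by (simp add: scaleR_conv_of_real mult.left_commute)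
next
  fix u :: real
  show "(\<lambda>z. indicator {0<..} u *\<^sub>R (complex_of_real u powr (z - 1) * f u))
      holomorphic_on {z. a < Re z \<and> Re z < b}"
    by (cases "u > 0") (auto simp: scaleR_conv_of_real intro!: holomorphic_intros)
qed

section \<open>Mellin transforms of periodic functions\<close>

lemma set_integrable_lborel_if_absolutely_integrable:
  fixes f :: "real \<Rightarrow> 'b :: euclidean_space"
  assumes "f absolutely_integrable_on S" "set_borel_measurable borel S f"
  shows "set_integrable lborel S f"
  using assms unfolding set_integrable_def set_borel_measurable_def
  by (subst (asm) integrable_completion) auto

lemma set_integrable_powr_atLeast:
  fixes e a :: real
  assumes "e < - 1" "a > 0"
  shows "set_integrable lborel {a..} (\<lambda>x. x powr e)"
    and "(LBINT x:{a..}. x powr e) = - (a powr (e + 1)) / (e + 1)"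
proof -
  have hi: "((\<lambda>x. x powr e) has_integral - (a powr (e + 1)) / (e + 1)) {a..}"
    using assms by (rule has_integral_powr_to_inf)
  then have "(\<lambda>x. x powr e) absolutely_integrable_on {a..}"
    by (intro nonnegative_absolutely_integrable_1) auto
  then show i: "set_integrable lborel {a..} (\<lambda>x. x powr e)"
    by (rule set_integrable_lborel_if_absolutely_integrable) (simp add: set_borel_measurable_def)
  show "(LBINT x:{a..}. x powr e) = - (a powr (e + 1)) / (e + 1)"
    using set_borel_integral_eq_integral(2)[OF i] hi by (simp add: integral_unique)
qed

lemma has_vector_derivative_of_real_powr:
  assumes "x > 0"
  shows "((\<lambda>x. complex_of_real x powr w) has_vector_derivative w * of_real x powr (w - 1)) (at x within A)"
  using assms
  by (auto intro!: derivative_eq_intros has_vector_derivative_real_field[of "\<lambda>z. z powr w"])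

lemma set_integral_powr_Icc:
  assumes "0 < a" "a \<le> b" "s \<noteq> 0"
  shows "(LBINT x:{a..b}. complex_of_real x powr (- s - 1)) = (of_real a powr (- s) - of_real b powr (- s)) / s"
proof -
  have "(LBINT x:{a..b}. complex_of_real x powr (- s - 1))
      = (- (of_real b powr (- s)) / s) - (- (of_real a powr (- s)) / s)"
    unfolding set_lebesgue_integral_def
  proof (rule integral_FTC_atLeastAtMost)
    fix x assume "a \<le> x" "x \<le> b"
    with assms have "x > 0" by simp
    show "((\<lambda>x. - (complex_of_real x powr - s) / s) has_vector_derivative complex_of_real x powr (- s - 1))
         (at x within {a..b})"
      using has_vector_derivative_of_real_powr[OF \<open>x > 0\<close>, of "- s"] assms(3)
      by (auto intro!: derivative_eq_intros)
  qed (use assms in \<open>auto intro!: continuous_intros\<close>)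
  then show ?thesis by (simp add: diff_divide_distrib)
qed

lemma set_integrable_powr_atLeast_complex:
  assumes "Re s > 1" "a > 0"
  shows "set_integrable lborel {a..} (\<lambda>x. complex_of_real x powr (- s))"
  unfolding set_integrable_def
proof (rule Bochner_Integration.integrable_bound)
  show "integrable lborel (\<lambda>x. indicator {a..} x *\<^sub>R x powr (- Re s))"
    using set_integrable_powr_atLeast(1)[of "- Re s" a] assms by (simp add: set_integrable_def)
qed (use assms in \<open>auto simp: indicator_def norm_of_real_powr\<close>)

lemma set_integral_powr_atLeast_complex:
  assumes "Re s > 0" "a > 0"
  shows "(LBINT x:{a..}. complex_of_real x powr (- s - 1)) = of_real a powr (- s) / s"
proof -
  have s0: "s \<noteq> 0" using assms by auto
  have i: "set_integrable lborel {a..} (\<lambda>x. complex_of_real x powr (- s - 1))"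
    using set_integrable_powr_atLeast_complex[of "s + 1" a] assms by simp
  have "((\<lambda>b. LBINT x:{a..b}. complex_of_real x powr (- s - 1)) \<longlongrightarrow>
      (LBINT x:{a..}. complex_of_real x powr (- s - 1))) at_top"
    by (rule tendsto_set_lebesgue_integral_at_top[OF _ i]) auto
  moreover have "((\<lambda>b. LBINT x:{a..b}. complex_of_real x powr (- s - 1)) \<longlongrightarrow>
      (of_real a powr (- s) - 0) / s) at_top"
  proof (rule Lim_transform_eventually)
    have "((\<lambda>b. complex_of_real b powr (- s)) \<longlongrightarrow> 0) at_top"
    proof (rule tendsto_norm_zero_cancel, rule Lim_transform_eventually)
      show "((\<lambda>b. b powr (- Re s)) \<longlongrightarrow> 0) at_top"
        using assms by (intro tendsto_neg_powr filterlim_ident) auto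
      show "\<forall>\<^sub>F b in at_top. b powr (- Re s) = norm (complex_of_real b powr (- s))"
        using eventually_gt_at_top[of 0] by eventually_elim (simp add: norm_of_real_powr)
    qed
    then show "((\<lambda>b. (of_real a powr (- s) - complex_of_real b powr (- s)) / s) \<longlongrightarrow>
      (of_real a powr (- s) - 0) / s) at_top"
      using s0 by (intro tendsto_intros) auto
    show "\<forall>\<^sub>F b in at_top. (of_real a powr (- s) - complex_of_real b powr (- s)) / s
        = (LBINT x:{a..b}. complex_of_real x powr (- s - 1))"
      using eventually_ge_at_top[of a]
      by eventually_elim (use assms s0 in \<open>simp add: set_integral_powr_Icc\<close>)
  qed
  ultimately show ?thesis using tendsto_unique trivial_limit_at_top_linorder by fastforce
qed

text \<open>The exponent is -s, not s - 1, to match partial summation: s times the value at s + 1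
  for a summatory function is the Dirichlet series at s. Starting at 1 removes every question of
  convergence at 0.\<close>

definition tail_mellin :: "(real \<Rightarrow> complex) \<Rightarrow> complex \<Rightarrow> complex" where
  "tail_mellin f s = (LBINT x:{1..}. of_real x powr (- s) * f x)"

lemma tail_mellin_integrable:
  assumes m: "f \<in> borel_measurable borel" and b: "\<And>x. x \<ge> 1 \<Longrightarrow> norm (f x) \<le> B" and s: "Re s > 1"
  shows "set_integrable lborel {1..} (\<lambda>x. of_real x powr (- s) * f x)"
    and "norm (tail_mellin f s) \<le> B / (Re s - 1)"
proof -
  have B0: "B \<ge> 0" using b[of 1] norm_ge_zero[of "f 1"] by linarith
  have ig: "set_integrable lborel {1..} (\<lambda>x. x powr (- Re s) * B)"
    using set_integrable_powr_atLeast(1)[of "- Re s" 1] s by (intro set_integrable_mult_left) auto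
  have le: "norm (complex_of_real x powr (- s) * f x) \<le> x powr (- Re s) * B" if "x \<ge> 1" for x
    using b[OF that] that by (auto simp: norm_mult norm_of_real_powr intro!: mult_left_mono)
  show i: "set_integrable lborel {1..} (\<lambda>x. of_real x powr (- s) * f x)"
  proof (rule set_integrable_bound[OF ig])
    show "set_borel_measurable lborel {1..} (\<lambda>x. complex_of_real x powr - s * f x)"
      unfolding set_borel_measurable_def using m by measurable
    show "AE x in lborel. x \<in> {1..} \<longrightarrow> norm (complex_of_real x powr - s * f x) \<le> norm (x powr - Re s * B)"
      using le B0 by (intro AE_I2) auto
  qed
  have "norm (tail_mellin f s) \<le> (LBINT x:{1..}. norm (of_real x powr (- s) * f x))"
    unfolding tail_mellin_def using i by (rule set_integral_norm_bound)
  also have "\<dots> \<le> (LBINT x:{1..}. x powr (- Re s) * B)"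
    using le by (intro set_integral_mono ig set_integrable_norm i) auto
  also have "\<dots> = (LBINT x:{1..}. x powr (- Re s)) * B" by (rule set_integral_mult_left)
  also have "\<dots> = B / (Re s - 1)"
    using s by (subst set_integrable_powr_atLeast(2)) (auto simp: field_simps)
  finally show "norm (tail_mellin f s) \<le> B / (Re s - 1)" .
qed

lemma tail_mellin_holomorphic:
  assumes m: "f \<in> borel_measurable borel" and b: "\<And>x. x \<ge> 1 \<Longrightarrow> norm (f x) \<le> B"
  shows "tail_mellin f holomorphic_on {s. Re s > 1}"
proof -
  have "tail_mellin f holomorphic_on {s. Re s > a}" if a: "a > 1" for a
    unfolding tail_mellin_def set_lebesgue_integral_def
  proof (rule holomorphic_lebesgue_integral[OF open_halfspace_Re_gt])
    have B0: "B \<ge> 0" using b[of 1] norm_ge_zero[of "f 1"] by linarith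
    show "integrable lborel (\<lambda>x. indicator {1..} x *\<^sub>R (x powr (- a) * B))"
      using set_integrable_powr_atLeast(1)[of "- a" 1] a
      by (fold set_integrable_def, intro set_integrable_mult_left) auto
    fix z :: complex and x :: real assume z: "z \<in> {s. a < Re s}"
    have "norm (complex_of_real x powr (- z) * f x) \<le> x powr (- a) * B" if "x \<ge> 1"
      using b[OF that] that z B0
      by (auto simp: norm_mult norm_of_real_powr intro!: mult_mono powr_mono)
    then show "norm (indicator {1..} x *\<^sub>R (complex_of_real x powr - z * f x)) \<le>
        indicator {1..} x *\<^sub>R (x powr - a * B)"
      by (auto simp: indicator_def)
  next
    fix x :: real
    show "(\<lambda>z. indicator {1..} x *\<^sub>R (complex_of_real x powr - z * f x)) holomorphic_on {s. a < Re s}"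
      by (cases "x \<ge> 1") (auto simp: scaleR_conv_of_real intro!: holomorphic_intros)
  qed (use m in measurable)
  then have "tail_mellin f field_differentiable at s" if "Re s > 1" for s
    using that dense[of 1 "Re s"] holomorphic_on_imp_differentiable_at[OF _ open_halfspace_Re_gt] by blast
  then show ?thesis by (auto simp: holomorphic_on_def intro: field_differentiable_at_within)
qed

lemma tail_mellin_1: "Re s > 1 \<Longrightarrow> tail_mellin (\<lambda>_. 1) s = 1 / (s - 1)"
  using set_integral_powr_atLeast_complex[of "s - 1" 1] by (simp add: tail_mellin_def)

text \<open>Integration by parts, carried out by Fubini so that f may be merely bounded and
  measurable: f(x) y^(-s-1) is integrated over the region 1 <= x <= y. Integrating over y first
  gives f(x) x^(-s) / s, over x first the primitive.\<close>

lemma tail_mellin_primitive: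
  assumes m: "f \<in> borel_measurable borel" and b: "\<And>x. x \<ge> 1 \<Longrightarrow> norm (f x) \<le> B" and s: "Re s > 1"
  shows "tail_mellin f s = s * tail_mellin (\<lambda>y. LBINT x:{1..y}. f x) (s + 1)"
proof -
  have s0: "s \<noteq> 0" using s by auto
  define P where "P x y = (if 1 \<le> x \<and> x \<le> y then f x * complex_of_real y powr (- s - 1) else 0)" for x y :: real
  have Pm: "case_prod P \<in> borel_measurable (lborel \<Otimes>\<^sub>M lborel)"
    unfolding P_def case_prod_beta' using m by measurable
  have inner: "(LBINT y. P x y) = indicator {1..} x *\<^sub>R (f x * (of_real x powr (- s) / s))"
    and inner_i: "integrable lborel (P x)"
    and inner_n: "(LBINT y. norm (P x y)) = indicator {1..} x *\<^sub>R (x powr (- Re s) * norm (f x) / Re s)" for x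
  proof -
    have e: "P x = (\<lambda>y. indicator {x..} y *\<^sub>R (f x * of_real y powr (- s - 1)))" if "x \<ge> 1"
      using that by (auto simp: P_def fun_eq_iff)
    have e0: "P x = (\<lambda>y. 0)" if "\<not> x \<ge> 1" using that by (auto simp: P_def fun_eq_iff)
    have i: "set_integrable lborel {x..} (\<lambda>y. f x * complex_of_real y powr (- s - 1))" if "x \<ge> 1"
      using set_integrable_powr_atLeast_complex[of "s + 1" x] s that
      by (intro set_integrable_mult_right) auto
    show "integrable lborel (P x)"
      using i by (cases "x \<ge> 1") (auto simp: e e0 set_integrable_def)
    show "(LBINT y. P x y) = indicator {1..} x *\<^sub>R (f x * (of_real x powr (- s) / s))"
    proof (cases "x \<ge> 1")
      case True
      then have "(LBINT y. P x y) = (LBINT y:{x..}. f x * of_real y powr (- s - 1))"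
        by (simp only: e set_lebesgue_integral_def)
      also have "\<dots> = f x * (of_real x powr (- s) / s)"
        using s True by (simp add: set_integral_powr_atLeast_complex)
      finally show ?thesis using True by simp
    qed (simp add: e0)
    show "(LBINT y. norm (P x y)) = indicator {1..} x *\<^sub>R (x powr (- Re s) * norm (f x) / Re s)"
    proof (cases "x \<ge> 1")
      case True
      then have "(LBINT y. norm (P x y)) = (LBINT y:{x..}. norm (f x) * y powr (- Re s - 1))"
        unfolding e[OF True] set_lebesgue_integral_def
        by (intro Bochner_Integration.integral_cong) (auto simp: indicator_def norm_mult norm_of_real_powr)
      also have "\<dots> = x powr (- Re s) * norm (f x) / Re s"
        using s True by (simp add: set_integrable_powr_atLeast(2))
      finally show ?thesis using True by simp
    qed (simp add: e0)
  qed
  have Pi: "integrable (lborel \<Otimes>\<^sub>M lborel) (case_prod P)"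
  proof (rule lborel_pair.Fubini_integrable[OF Pm])
    have "set_integrable lborel {1..} (\<lambda>x. norm (complex_of_real x powr (- s) * f x) / Re s)"
      using tail_mellin_integrable(1)[OF m b s]
      by (intro set_integrable_divide set_integrable_norm) auto
    then have "set_integrable lborel {1..} (\<lambda>x. x powr (- Re s) * norm (f x) / Re s)"
      by (subst (asm) set_integrable_cong[OF refl refl]) (auto simp: norm_mult norm_of_real_powr)
    then show "integrable lborel (\<lambda>x. LBINT y. norm (case (x, y) of (x, y) \<Rightarrow> P x y))"
      by (simp add: inner_n set_integrable_def)
    show "AE x in lborel. integrable lborel (\<lambda>y. case (x, y) of (x, y) \<Rightarrow> P x y)"
      using inner_i by simp
  qed
  have "tail_mellin f s = s * (LBINT x. LBINT y. P x y)"
  proof -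
    have "(LBINT x. LBINT y. P x y) = (LBINT x:{1..}. of_real x powr (- s) * f x / s)"
      unfolding inner set_lebesgue_integral_def by (simp add: mult.commute)
    then show ?thesis using s0 by (simp add: tail_mellin_def)
  qed
  also have "(LBINT x. LBINT y. P x y) = (LBINT y. LBINT x. P x y)"
    using lborel_pair.Fubini_integral[OF Pi] by simp
  also have "\<dots> = tail_mellin (\<lambda>y. LBINT x:{1..y}. f x) (s + 1)"
    unfolding tail_mellin_def set_lebesgue_integral_def[of _ "{1..}"]
  proof (rule Bochner_Integration.integral_cong[OF refl])
    fix y :: real
    have "P x y = indicator {1..y} x *\<^sub>R f x * (indicator {1..} y *\<^sub>R of_real y powr (- s - 1))" for x
      by (auto simp: P_def)
    then have "(LBINT x. P x y) = (LBINT x:{1..y}. f x) * (indicator {1..} y *\<^sub>R of_real y powr (- s - 1))"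
      by (simp only: set_lebesgue_integral_def integral_mult_left_zero)
    moreover have e: "- (s + 1) = - s - 1" by simp
    ultimately show "(LBINT x. P x y) = indicator {1..} y *\<^sub>R (of_real y powr (- (s + 1)) * (LBINT x:{1..y}. f x))"
      unfolding e by (simp add: mult.commute)
  qed
  finally show ?thesis .
qed

text \<open>Boundedness and periodicity are asked only from 1 on. This keeps the class closed under
  primitives based at 1, which are identically 0 to the left of 1.\<close>

definition periodic_tail :: "real \<Rightarrow> (real \<Rightarrow> complex) \<Rightarrow> bool" where
  "periodic_tail p f \<longleftrightarrow> p > 0 \<and> f \<in> borel_measurable borel \<and>
     (\<exists>B. \<forall>x\<ge>1. norm (f x) \<le> B) \<and> (\<forall>x\<ge>1. f (x + p) = f x)"

definition period_mean :: "real \<Rightarrow> (real \<Rightarrow> complex) \<Rightarrow> complex" where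
  "period_mean p f = (LBINT x:{1..1 + p}. f x) / of_real p"

lemma set_integrable_bounded_Icc:
  fixes f :: "real \<Rightarrow> complex"
  assumes "f \<in> borel_measurable borel" "\<And>x. x \<ge> 1 \<Longrightarrow> norm (f x) \<le> B" "a \<ge> 1"
  shows "set_integrable lborel {a..b} f"
    and "a \<le> b \<Longrightarrow> norm (LBINT x:{a..b}. f x) \<le> B * (b - a)"
proof -
  have i: "set_integrable lborel {a..b} (\<lambda>_. B)" by (intro borel_integrable_atLeastAtMost') auto
  show f: "set_integrable lborel {a..b} f"
    by (rule set_integrable_bound[OF i])
      (use assms in \<open>auto simp: set_borel_measurable_def intro!: AE_I2 order.trans[OF _ abs_ge_self]\<close>)
  assume "a \<le> b"
  have "norm (LBINT x:{a..b}. f x) \<le> (LBINT x:{a..b}. norm (f x))" using f by (rule set_integral_norm_bound)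
  also have "\<dots> \<le> (LBINT x:{a..b}. B)"
    using f i assms by (intro set_integral_mono) (auto intro: set_integrable_norm)
  also have "\<dots> = B * (b - a)" using \<open>a \<le> b\<close> by (simp add: set_lebesgue_integral_def)
  finally show "norm (LBINT x:{a..b}. f x) \<le> B * (b - a)" .
qed

text \<open>Once the mean is subtracted, the integral over a full period vanishes, so the primitive
  is again periodic, and therefore bounded. This closure property is what allows integration by
  parts to be repeated without end.\<close>

lemma periodic_tail_primitive:
  assumes "periodic_tail p f"
  shows "periodic_tail p (\<lambda>y. LBINT x:{1..y}. f x - period_mean p f)"
proof -
  obtain B where p: "p > 0" and m: "f \<in> borel_measurable borel" and b: "\<And>x. x \<ge> 1 \<Longrightarrow> norm (f x) \<le> B"
    and per: "\<And>x. x \<ge> 1 \<Longrightarrow> f (x + p) = f x" using assms by (auto simp: periodic_tail_def)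
  define h where "h x = f x - period_mean p f" for x
  define C where "C = B + norm (period_mean p f)"
  have hm [measurable]: "h \<in> borel_measurable borel" unfolding h_def using m by measurable
  have hb: "norm (h x) \<le> C" if "x \<ge> 1" for x
    unfolding h_def C_def using b[OF that] norm_triangle_ineq4[of "f x" "period_mean p f"] by linarith
  have hper: "h (x + p) = h x" if "x \<ge> 1" for x using per[OF that] by (simp add: h_def)
  have C0: "C \<ge> 0" using hb[of 1] norm_ge_zero[of "h 1"] by linarith
  note hi = set_integrable_bounded_Icc[OF hm hb]
  define g where "g y = (LBINT x:{1..y}. h x)" for y
  have h0: "(LBINT x:{1..1 + p}. h x) = 0"
  proof -
    have "(LBINT x:{1..1 + p}. h x) = (LBINT x:{1..1 + p}. f x) - (LBINT x:{1..1 + p}. period_mean p f)"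
      unfolding h_def by (rule set_integral_diff)
        (auto intro: set_integrable_bounded_Icc[OF m b] borel_integrable_atLeastAtMost')
    also have "\<dots> = 0" using p by (simp add: period_mean_def set_lebesgue_integral_def scaleR_conv_of_real)
    finally show ?thesis .
  qed
  have gper: "g (y + p) = g y" if "y \<ge> 1" for y
  proof -
    have "g (y + p) = (LBINT x:{1..1 + p} \<union> {1 + p<..y + p}. h x)"
      unfolding g_def using that p by (intro arg_cong[of _ _ "\<lambda>A. set_lebesgue_integral lborel A h"]) auto
    also have "\<dots> = (LBINT x:{1..1 + p}. h x) + (LBINT x:{1 + p<..y + p}. h x)"
      by (rule set_integral_Un) (auto intro: hi set_integrable_subset[OF hi(1)[of "1 + p" "y + p"]] simp: p less_imp_le)
    also have "(LBINT x:{1 + p<..y + p}. h x) = (LBINT x. indicator {1<..y} x *\<^sub>R h x)"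
      unfolding set_lebesgue_integral_def
      by (subst lborel_integral_real_affine[of 1 _ p])
        (auto intro!: Bochner_Integration.integral_cong simp: indicator_def hper add.commute[of p])
    also have "\<dots> = g y"
      unfolding g_def set_lebesgue_integral_def
    proof (rule integral_cong_AE)
      have "AE x in lborel. x \<noteq> (1 :: real)" by (rule AE_lborel_singleton)
      then show "AE x in lborel. indicator {1<..y} x *\<^sub>R h x = indicator {1..y} x *\<^sub>R h x"
        by eventually_elim (auto simp: indicator_def)
    qed measurable
    finally show ?thesis by (simp add: h0)
  qed
  have gb: "norm (g y) \<le> C * p" if "y \<ge> 1" for y
  proof -
    \<comment> \<open>The number of full periods between 1 and y; removing them moves y into the
      first period, where the integral is estimated trivially.\<close>
    define k where "k = nat \<lfloor>(y - 1) / p\<rfloor>"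
    have "real k \<le> (y - 1) / p" "(y - 1) / p < real k + 1"
      unfolding k_def using that p by (simp_all add: of_nat_nat)
    then have k: "1 \<le> y - real k * p" "y - real k * p \<le> 1 + p" using p by (simp_all add: field_simps)
    have "g (z + real j * p) = g z" if "z \<ge> 1" for z j
    proof (induction j)
      case (Suc j)
      have "g (z + real j * p + p) = g (z + real j * p)"
        using that p by (intro gper) (simp add: add_increasing2)
      with Suc show ?case by (simp add: algebra_simps)
    qed simp
    from this[OF k(1), of k] have "g y = g (y - real k * p)" by simp
    also have "norm \<dots> \<le> C * (y - real k * p - 1)"
      unfolding g_def using k by (intro hi) auto
    also have "\<dots> \<le> C * p" using k C0 by (intro mult_left_mono) auto
    finally show ?thesis .
  qed
  have gm: "g \<in> borel_measurable borel"
  proof -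
    have "(\<lambda>y. LBINT x. (if 1 \<le> x \<and> x \<le> y then h x else 0)) \<in> borel_measurable borel" by measurable
    also have "(\<lambda>y. LBINT x. (if 1 \<le> x \<and> x \<le> y then h x else 0)) = g"
      unfolding g_def set_lebesgue_integral_def
      by (intro ext Bochner_Integration.integral_cong) (auto simp: indicator_def)
    finally show ?thesis .
  qed
  show ?thesis unfolding periodic_tail_def h_def[symmetric] g_def[symmetric]
    using p gper gb gm by blast
qed

text \<open>The left edge is a parameter because continuation proceeds leftwards; constant and
  degree may depend on the right edge. The set \<open>U\<close> serves to keep away from the pole of
  zeta.\<close>

definition strip_polynomial_bound :: "complex set \<Rightarrow> real \<Rightarrow> (complex \<Rightarrow> complex) \<Rightarrow> bool" where
  "strip_polynomial_bound U a f \<longleftrightarrow>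
     (\<forall>b. \<exists>C N. \<forall>s\<in>U. a \<le> Re s \<and> Re s \<le> b \<longrightarrow> norm (f s) \<le> C * (1 + norm s) ^ N)"

lemma strip_polynomial_bound_const: "strip_polynomial_bound U a (\<lambda>_. c)"
  unfolding strip_polynomial_bound_def
proof (intro allI exI ballI impI)
  fix s :: complex
  show "norm c \<le> norm c * (1 + norm s) ^ 0" by simp
qed

lemma strip_polynomial_bound_id: "strip_polynomial_bound U a (\<lambda>s. s)"
  unfolding strip_polynomial_bound_def
proof (intro allI exI ballI impI)
  fix s :: complex
  show "norm s \<le> 1 * (1 + norm s) ^ 1" by simp
qed

lemma strip_polynomial_bound_mult:
  assumes "strip_polynomial_bound U a f" "strip_polynomial_bound U a g"
  shows "strip_polynomial_bound U a (\<lambda>s. f s * g s)"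
  unfolding strip_polynomial_bound_def
proof
  fix b
  obtain C M where f: "\<And>s. s \<in> U \<Longrightarrow> a \<le> Re s \<Longrightarrow> Re s \<le> b \<Longrightarrow> norm (f s) \<le> C * (1 + norm s) ^ M"
    using assms(1) unfolding strip_polynomial_bound_def by metis
  obtain D N where g: "\<And>s. s \<in> U \<Longrightarrow> a \<le> Re s \<Longrightarrow> Re s \<le> b \<Longrightarrow> norm (g s) \<le> D * (1 + norm s) ^ N"
    using assms(2) unfolding strip_polynomial_bound_def by metis
  have "norm (f s * g s) \<le> (C * D) * (1 + norm s) ^ (M + N)"
    if "s \<in> U" "a \<le> Re s \<and> Re s \<le> b" for s
  proof -
    have "norm (f s * g s) \<le> (C * (1 + norm s) ^ M) * (D * (1 + norm s) ^ N)"
      unfolding norm_mult using f[of s] g[of s] that order.trans[OF norm_ge_zero f[of s]]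
      by (intro mult_mono) auto
    then show ?thesis by (simp add: power_add mult_ac)
  qed
  then show "\<exists>C N. \<forall>s\<in>U. a \<le> Re s \<and> Re s \<le> b \<longrightarrow> norm (f s * g s) \<le> C * (1 + norm s) ^ N"
    by blast
qed

lemma strip_polynomial_bound_add:
  assumes "strip_polynomial_bound U a f" "strip_polynomial_bound U a g"
  shows "strip_polynomial_bound U a (\<lambda>s. f s + g s)"
  unfolding strip_polynomial_bound_def
proof
  fix b
  obtain C M where f: "\<And>s. s \<in> U \<Longrightarrow> a \<le> Re s \<Longrightarrow> Re s \<le> b \<Longrightarrow> norm (f s) \<le> C * (1 + norm s) ^ M"
    using assms(1) unfolding strip_polynomial_bound_def by metis
  obtain D N where g: "\<And>s. s \<in> U \<Longrightarrow> a \<le> Re s \<Longrightarrow> Re s \<le> b \<Longrightarrow> norm (g s) \<le> D * (1 + norm s) ^ N"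
    using assms(2) unfolding strip_polynomial_bound_def by metis
  have "norm (f s + g s) \<le> (\<bar>C\<bar> + \<bar>D\<bar>) * (1 + norm s) ^ (M + N)"
    if s: "s \<in> U" "a \<le> Re s \<and> Re s \<le> b" for s
  proof -
    have "C * (1 + norm s) ^ M \<le> \<bar>C\<bar> * (1 + norm s) ^ (M + N)"
      by (intro mult_mono power_increasing) auto
    moreover have "D * (1 + norm s) ^ N \<le> \<bar>D\<bar> * (1 + norm s) ^ (M + N)"
      by (intro mult_mono power_increasing) auto
    ultimately show ?thesis
      using f[of s] g[of s] s norm_triangle_ineq[of "f s" "g s"] by (simp add: distrib_right)
  qed
  then show "\<exists>C N. \<forall>s\<in>U. a \<le> Re s \<and> Re s \<le> b \<longrightarrow> norm (f s + g s) \<le> C * (1 + norm s) ^ N"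
    by blast
qed

lemma strip_polynomial_bound_shift:
  assumes "strip_polynomial_bound UNIV (a + 1) f"
  shows "strip_polynomial_bound UNIV a (\<lambda>s. f (s + 1))"
  unfolding strip_polynomial_bound_def
proof
  fix b
  obtain C M where f: "\<And>s. a + 1 \<le> Re s \<Longrightarrow> Re s \<le> b + 1 \<Longrightarrow> norm (f s) \<le> C * (1 + norm s) ^ M"
    using assms unfolding strip_polynomial_bound_def by (metis UNIV_I)
  have "norm (f (s + 1)) \<le> (\<bar>C\<bar> * 2 ^ M) * (1 + norm s) ^ M" if "a \<le> Re s \<and> Re s \<le> b" for s
  proof -
    have t: "0 \<le> 1 + norm (s + 1)" by (intro add_nonneg_nonneg) auto
    have t': "1 + norm (s + 1) \<le> 2 * (1 + norm s)"
      using norm_triangle_ineq[of s 1, unfolded norm_one] norm_ge_zero[of s] by argo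
    have "norm (f (s + 1)) \<le> C * (1 + norm (s + 1)) ^ M" using that by (intro f) auto
    also have "\<dots> \<le> \<bar>C\<bar> * (2 * (1 + norm s)) ^ M"
      using t t' by (intro mult_mono power_mono zero_le_power) auto
    also have "\<dots> = (\<bar>C\<bar> * 2 ^ M) * (1 + norm s) ^ M" by (simp only: power_mult_distrib mult.assoc)
    finally show ?thesis .
  qed
  then show "\<exists>C N. \<forall>s\<in>UNIV. a \<le> Re s \<and> Re s \<le> b \<longrightarrow> norm (f (s + 1)) \<le> C * (1 + norm s) ^ N"
    by blast
qed

lemma strip_polynomial_bound_subset:
  "strip_polynomial_bound V a f \<Longrightarrow> U \<subseteq> V \<Longrightarrow> strip_polynomial_bound U a f"
  unfolding strip_polynomial_bound_def by (meson subsetD)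

text \<open>Induction on the number of integrations by parts. The mean contributes the pole at 1;
  the rest equals s times the transform of the bounded periodic primitive g at s + 1. Its own polar
  part, the mean of g divided by s, loses its pole against the factor s. Each step thus gains a unit
  to the left at the price of one factor s in the growth.\<close>

lemma tail_mellin_periodic_step:
  assumes "periodic_tail p f"
  shows "\<exists>H. H holomorphic_on {s. Re s > 1 - real k}
    \<and> (\<forall>s. Re s > 1 \<longrightarrow> tail_mellin f s = period_mean p f / (s - 1) + H s)
    \<and> (\<forall>a>1 - real k. strip_polynomial_bound UNIV a H)"
  using assms
proof (induction k arbitrary: f)
  case 0
  then obtain B where m: "f \<in> borel_measurable borel" and b: "\<And>x. x \<ge> 1 \<Longrightarrow> norm (f x) \<le> B"
    by (auto simp: periodic_tail_def)
  have B0: "B \<ge> 0" using b[of 1] norm_ge_zero[of "f 1"] by linarith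
  let ?\<mu> = "period_mean p f"
  let ?H = "\<lambda>s. tail_mellin f s - ?\<mu> / (s - 1)"
  have "?H holomorphic_on {s. Re s > 1}"
    using tail_mellin_holomorphic[OF m b] by (intro holomorphic_intros) auto
  moreover have "strip_polynomial_bound UNIV a ?H" if a: "a > 1" for a
    unfolding strip_polynomial_bound_def
  proof (intro allI exI ballI impI)
    fix b s assume s: "a \<le> Re s \<and> Re s \<le> b"
    have "norm (?H s) \<le> norm (tail_mellin f s) + norm (?\<mu> / (s - 1))" by (rule norm_triangle_ineq4)
    also have "\<dots> \<le> B / (a - 1) + norm ?\<mu> / (a - 1)"
    proof (intro add_mono)
      have "norm (tail_mellin f s) \<le> B / (Re s - 1)"
        using tail_mellin_integrable(2)[OF m b] s a by auto
      also have "\<dots> \<le> B / (a - 1)" using s a B0 by (intro divide_left_mono) auto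
      finally show "norm (tail_mellin f s) \<le> B / (a - 1)" .
      have "a - 1 \<le> norm (s - 1)" using complex_Re_le_cmod[of "s - 1"] s by simp
      then show "norm (?\<mu> / (s - 1)) \<le> norm ?\<mu> / (a - 1)"
        unfolding norm_divide using a by (intro divide_left_mono mult_pos_pos) auto
    qed
    finally show "norm (?H s) \<le> (B / (a - 1) + norm ?\<mu> / (a - 1)) * (1 + norm s) ^ 0" by simp
  qed
  ultimately show ?case by (intro exI[of _ ?H]) auto
next
  case (Suc k)
  then obtain B where p: "p > 0" and m: "f \<in> borel_measurable borel" and b: "\<And>x. x \<ge> 1 \<Longrightarrow> norm (f x) \<le> B"
    by (auto simp: periodic_tail_def)
  let ?\<mu> = "period_mean p f"
  define h where "h x = f x - ?\<mu>" for x
  define g where "g y = (LBINT x:{1..y}. h x)" for y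
  have hm: "h \<in> borel_measurable borel" unfolding h_def using m by measurable
  have hb: "norm (h x) \<le> B + norm ?\<mu>" if "x \<ge> 1" for x
    unfolding h_def using b[OF that] norm_triangle_ineq4[of "f x" ?\<mu>] by linarith
  have "periodic_tail p g" unfolding g_def h_def by (rule periodic_tail_primitive) fact
  from Suc.IH[OF this] obtain G where G: "G holomorphic_on {s. Re s > 1 - real k}"
    "\<And>s. Re s > 1 \<Longrightarrow> tail_mellin g s = period_mean p g / (s - 1) + G s"
    "\<And>a. a > 1 - real k \<Longrightarrow> strip_polynomial_bound UNIV a G" by blast
  let ?H = "\<lambda>s. period_mean p g + s * G (s + 1)"
  have H1: "?H holomorphic_on {s. Re s > 1 - real (Suc k)}"
  proof -
    have "(G \<circ> (\<lambda>s. s + 1)) holomorphic_on {s. Re s > 1 - real (Suc k)}"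
      by (rule holomorphic_on_compose_gen[OF _ G(1)]) (auto intro!: holomorphic_intros)
    then show ?thesis by (auto simp: o_def intro!: holomorphic_intros)
  qed
  have H2: "tail_mellin f s = ?\<mu> / (s - 1) + ?H s" if s: "Re s > 1" for s
  proof -
    have s0: "s \<noteq> 0" using s by auto
    have i: "set_integrable lborel {1..} (\<lambda>x. of_real x powr (- s) * h x)"
      "set_integrable lborel {1..} (\<lambda>x. of_real x powr (- s) * ?\<mu>)"
      using tail_mellin_integrable(1)[OF hm hb s] tail_mellin_integrable(1)[of "\<lambda>_. ?\<mu>" "norm ?\<mu>" s] s by auto
    have "tail_mellin f s = (LBINT x:{1..}. of_real x powr (- s) * h x + of_real x powr (- s) * ?\<mu>)"
      unfolding tail_mellin_def by (simp add: h_def algebra_simps)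
    also have "\<dots> = tail_mellin h s + tail_mellin (\<lambda>_. 1) s * ?\<mu>"
      using i by (subst set_integral_add) (auto simp: tail_mellin_def)
    also have "tail_mellin h s = s * tail_mellin g (s + 1)"
      unfolding g_def by (rule tail_mellin_primitive[OF hm hb s])
    also have "tail_mellin g (s + 1) = period_mean p g / s + G (s + 1)"
      using G(2)[of "s + 1"] s by simp
    finally show ?thesis using s s0 by (simp add: tail_mellin_1 distrib_left add_ac)
  qed
  have H3: "strip_polynomial_bound UNIV a ?H" if a: "a > 1 - real (Suc k)" for a
    using a by (intro strip_polynomial_bound_add strip_polynomial_bound_mult strip_polynomial_bound_const
        strip_polynomial_bound_id strip_polynomial_bound_shift G(3)) simp
  show ?case by (intro exI[of _ ?H] conjI allI impI H1 H2 H3)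
qed

text \<open>All \<open>h k\<close> agree on the common half-plane Re s > a, so by the identity
  theorem any two agree wherever both are given, and at each point the least admissible index can be
  used.\<close>

lemma holomorphic_glue_halfplanes:
  fixes h :: "nat \<Rightarrow> complex \<Rightarrow> complex"
  assumes holo: "\<And>k. h k holomorphic_on {s. Re s > a - real k}"
    and eq: "\<And>k s. Re s > a \<Longrightarrow> h k s = h 0 s"
  obtains H where "H holomorphic_on UNIV" "\<And>k s. Re s > a - real k \<Longrightarrow> H s = h k s"
proof -
  define H where "H s = h (LEAST k. Re s > a - real k) s" for s
  have mono: "h k s = h l s" if "k \<le> l" "Re s > a - real k" for k l s
  proof -
    have U: "{s. Re s > a} \<subseteq> {s. Re s > a - real k}" by auto
    have hl: "h l holomorphic_on {s. Re s > a - real k}"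
      using that(1) by (intro holomorphic_on_subset[OF holo[of l]]) auto
    show ?thesis
    proof (rule analytic_continuation_open[of "{s. Re s > a}" "{s. Re s > a - real k}" "h k" "h l"])
      show "{s. Re s > a} \<noteq> {}" by (auto intro!: exI[of _ "of_real (a + 1)"])
      show "connected {s. Re s > a - real k}"
        by (intro convex_connected convex_halfspace_Re_gt)
      show "h k z = h l z" if "z \<in> {s. Re s > a}" for z
        using eq[of z k] eq[of z l] that by simp
    qed (use that(2) U hl holo[of k] in \<open>auto intro: open_halfspace_Re_gt\<close>)
  qed
  have ex: "\<exists>k. Re s > a - real k" for s
    using reals_Archimedean2[of "a - Re s"] by (auto simp: algebra_simps)
  have H: "H s = h k s" if "Re s > a - real k" for k s
  proof -
    have "(LEAST k. Re s > a - real k) \<le> k" using that by (rule Least_le)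
    moreover have "Re s > a - real (LEAST k. Re s > a - real k)" using ex by (rule LeastI_ex)
    ultimately show ?thesis unfolding H_def by (rule mono)
  qed
  have "H field_differentiable at s" for s
  proof -
    obtain k where k: "Re s > a - real k" using ex by blast
    have "H holomorphic_on {s. Re s > a - real k}"
      by (rule holomorphic_transform[OF holo[of k]]) (simp add: H)
    then show ?thesis using k holomorphic_on_imp_differentiable_at[OF _ open_halfspace_Re_gt] by blast
  qed
  then have "H holomorphic_on UNIV" by (simp add: holomorphic_on_def)
  then show ?thesis using H that by blast
qed

theorem tail_mellin_periodic:
  assumes "periodic_tail p f"
  obtains H where "H holomorphic_on UNIV"
    "\<And>s. Re s > 1 \<Longrightarrow> tail_mellin f s = period_mean p f / (s - 1) + H s"
    "\<And>a. strip_polynomial_bound UNIV a H"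
proof -
  obtain h where h: "\<And>k. h k holomorphic_on {s. Re s > 1 - real k}"
    "\<And>k s. Re s > 1 \<Longrightarrow> tail_mellin f s = period_mean p f / (s - 1) + h k s"
    "\<And>k a. a > 1 - real k \<Longrightarrow> strip_polynomial_bound UNIV a (h k)"
    using tail_mellin_periodic_step[OF assms] by metis
  have eq: "h k s = h 0 s" if "Re s > 1" for k s
    using h(2)[OF that, of k] h(2)[OF that, of 0] by simp
  obtain H where H: "H holomorphic_on UNIV" "\<And>k s. Re s > 1 - real k \<Longrightarrow> H s = h k s"
    using holomorphic_glue_halfplanes[of h 1, OF h(1) eq] by blast
  have "strip_polynomial_bound UNIV a H" for a
  proof -
    obtain k where k: "a > 1 - real k"
      using reals_Archimedean2[of "1 - a"] by (auto simp: algebra_simps)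
    have "H s = h k s" if "a \<le> Re s" for s using that k by (intro H(2)) linarith
    with h(3)[OF k] show ?thesis unfolding strip_polynomial_bound_def by metis
  qed
  moreover have "tail_mellin f s = period_mean p f / (s - 1) + H s" if "Re s > 1" for s
    using h(2)[OF that, of 0] H(2)[of 0 s] that by simp
  ultimately show ?thesis using H(1) that by blast
qed

section \<open>The zeta function and the L-function\<close>

text \<open>Each n^(-s) - N^(-s) is s times the integral of y^(-s-1) over [n, N]; summing against
  a(n) collects, at the point y, the coefficients with n <= y.\<close>

lemma abel_summation_powr:
  fixes a :: "nat \<Rightarrow> complex"
  assumes s: "s \<noteq> 0"
  shows "(\<Sum>n=1..N. a n * of_nat n powr (- s)) = (\<Sum>n=1..N. a n) * of_nat N powr (- s)
    + s * (LBINT y:{1..real N}. of_real y powr (- s - 1) * (\<Sum>n=1..nat \<lfloor>y\<rfloor>. a n))"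
proof -
  let ?p = "\<lambda>y. complex_of_real y powr (- s - 1)"
  have i: "set_integrable lborel {real n..real N} ?p" if "n \<in> {1..N}" for n
    using that by (intro borel_integrable_atLeastAtMost' continuous_intros) auto
  have e: "indicator {1..real N} y *\<^sub>R (?p y * (\<Sum>n=1..nat \<lfloor>y\<rfloor>. a n))
      = (\<Sum>n=1..N. a n * (indicator {real n..real N} y *\<^sub>R ?p y))" for y
  proof (cases "1 \<le> y \<and> y \<le> real N")
    case True
    have "{1..nat \<lfloor>y\<rfloor>} = {n \<in> {1..N}. real n \<le> y}"
    proof (intro equalityI subsetI)
      fix n assume "n \<in> {1..nat \<lfloor>y\<rfloor>}"
      then have "1 \<le> n" "int n \<le> \<lfloor>y\<rfloor>" using True by auto
      then have "real n \<le> y" by linarith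
      with True \<open>1 \<le> n\<close> show "n \<in> {n \<in> {1..N}. real n \<le> y}" by auto
    next
      fix n assume "n \<in> {n \<in> {1..N}. real n \<le> y}"
      then show "n \<in> {1..nat \<lfloor>y\<rfloor>}" by (auto simp: le_nat_floor)
    qed
    then have "(\<Sum>n=1..nat \<lfloor>y\<rfloor>. a n) = (\<Sum>n=1..N. if real n \<le> y then a n else 0)"
      by (simp only: sum.inter_filter finite_atLeastAtMost)
    then show ?thesis using True
      by (auto simp: sum_distrib_left indicator_def intro!: sum.cong)
  qed (auto simp: indicator_def intro!: sum.neutral)
  have "(LBINT y:{1..real N}. ?p y * (\<Sum>n=1..nat \<lfloor>y\<rfloor>. a n))
      = (LBINT y. (\<Sum>n=1..N. a n * (indicator {real n..real N} y *\<^sub>R ?p y)))"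
    unfolding set_lebesgue_integral_def e ..
  also have "\<dots> = (\<Sum>n=1..N. LBINT y. a n * (indicator {real n..real N} y *\<^sub>R ?p y))"
    by (intro Bochner_Integration.integral_sum integrable_mult_right i[unfolded set_integrable_def])
  also have "\<dots> = (\<Sum>n=1..N. a n * (LBINT y:{real n..real N}. ?p y))"
    by (simp only: integral_mult_right_zero set_lebesgue_integral_def)
  also have "\<dots> = (\<Sum>n=1..N. a n * ((of_nat n powr (- s) - of_nat N powr (- s)) / s))"
    using s by (intro sum.cong refl) (simp add: set_integral_powr_Icc)
  finally have "s * (LBINT y:{1..real N}. ?p y * (\<Sum>n=1..nat \<lfloor>y\<rfloor>. a n))
      = s * (\<Sum>n=1..N. a n * ((of_nat n powr (- s) - of_nat N powr (- s)) / s))" by simp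
  also have "\<dots> = (\<Sum>n=1..N. a n * of_nat n powr (- s) - a n * of_nat N powr (- s))"
    unfolding sum_distrib_left using s by (intro sum.cong refl) (simp add: field_simps)
  also have "\<dots> = (\<Sum>n=1..N. a n * of_nat n powr (- s)) - (\<Sum>n=1..N. a n) * of_nat N powr (- s)"
    by (simp only: sum_subtractf sum_distrib_right)
  finally show ?thesis by simp
qed

text \<open>The boundary term is O(N^(theta - Re s)) and disappears, while the integral converges
  absolutely. The exponent theta is 1 for zeta and 0 for the L-function, whence their different
  half-planes.\<close>

lemma abel_summation_tendsto:
  fixes a :: "nat \<Rightarrow> complex"
  assumes bound: "\<And>y. y \<ge> 1 \<Longrightarrow> norm (\<Sum>n=1..nat \<lfloor>y\<rfloor>. a n) \<le> B * y powr \<theta>"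
    and s: "\<theta> \<ge> 0" "Re s > \<theta>"
  shows "set_integrable lborel {1..} (\<lambda>y. of_real y powr (- s - 1) * (\<Sum>n=1..nat \<lfloor>y\<rfloor>. a n))" (is ?int)
    and "(\<lambda>N. \<Sum>n=1..N. a n * of_nat n powr (- s)) \<longlonglongrightarrow>
      s * (LBINT y:{1..}. of_real y powr (- s - 1) * (\<Sum>n=1..nat \<lfloor>y\<rfloor>. a n))"
proof -
  have s0: "s \<noteq> 0" using s by auto
  define A where "A y = (\<Sum>n=1..nat \<lfloor>y\<rfloor>. a n)" for y :: real
  have Am: "A \<in> borel_measurable borel"
    unfolding A_def by (rule measurable_compose[OF measurable_real_floor]) simp
  have ig: "set_integrable lborel {1..} (\<lambda>y. B * y powr (\<theta> - Re s - 1))"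
    using set_integrable_powr_atLeast(1)[of "\<theta> - Re s - 1" 1] s by (intro set_integrable_mult_right) auto
  show int: ?int
    unfolding A_def[symmetric]
  proof (rule set_integrable_bound[OF ig])
    show "set_borel_measurable lborel {1..} (\<lambda>y. complex_of_real y powr (- s - 1) * A y)"
      unfolding set_borel_measurable_def using Am by measurable
    have "norm (complex_of_real y powr (- s - 1) * A y) \<le> B * y powr (\<theta> - Re s - 1)" if "y \<ge> 1" for y
    proof -
      have "norm (complex_of_real y powr (- s - 1) * A y) \<le> y powr (- Re s - 1) * (B * y powr \<theta>)"
        using that bound[OF that]
        by (simp add: norm_mult norm_of_real_powr A_def mult_left_mono)
      also have "\<dots> = B * y powr (\<theta> - Re s - 1)"
        using that by (simp add: mult.left_commute[of _ B] powr_add [symmetric] algebra_simps)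
      finally show ?thesis .
    qed
    then show "AE y in lborel. y \<in> {1..} \<longrightarrow>
        norm (complex_of_real y powr (- s - 1) * A y) \<le> norm (B * y powr (\<theta> - Re s - 1))"
      by (intro AE_I2) (auto intro: order.trans[OF _ abs_ge_self])
  qed
  have "((\<lambda>b. LBINT y:{1..b}. of_real y powr (- s - 1) * A y) \<longlongrightarrow>
      (LBINT y:{1..}. of_real y powr (- s - 1) * A y)) at_top"
    using int unfolding A_def[symmetric] by (intro tendsto_set_lebesgue_integral_at_top) auto
  then have "(\<lambda>N. LBINT y:{1..real N}. of_real y powr (- s - 1) * A y) \<longlonglongrightarrow>
      (LBINT y:{1..}. of_real y powr (- s - 1) * A y)"
    by (rule filterlim_compose[OF _ filterlim_real_sequentially])
  moreover have "(\<lambda>N. A (real N) * of_nat N powr (- s)) \<longlonglongrightarrow> 0"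
  proof (rule Lim_null_comparison)
    show "\<forall>\<^sub>F N in sequentially. norm (A (real N) * of_nat N powr (- s)) \<le> B * real N powr (\<theta> - Re s)"
      using eventually_ge_at_top[of 1]
    proof eventually_elim
      case (elim N)
      have "norm (A (real N) * of_nat N powr (- s)) = norm (A (real N)) * real N powr (- Re s)"
        using norm_of_real_powr[of "real N" "- s"] elim by (simp add: norm_mult)
      also have "\<dots> \<le> (B * real N powr \<theta>) * real N powr (- Re s)"
        using bound[of "real N"] elim by (intro mult_right_mono) (auto simp: A_def)
      also have "\<dots> = B * real N powr (\<theta> - Re s)" using elim by (simp add: powr_diff powr_minus field_simps)
      finally show ?case .
    qed
    have "((\<lambda>x. x powr (\<theta> - Re s)) \<longlongrightarrow> 0) at_top" using s by (intro tendsto_neg_powr filterlim_ident) auto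
    then have "(\<lambda>N. real N powr (\<theta> - Re s)) \<longlonglongrightarrow> 0"
      by (rule filterlim_compose[OF _ filterlim_real_sequentially])
    then show "(\<lambda>N. B * real N powr (\<theta> - Re s)) \<longlonglongrightarrow> 0" by (rule tendsto_mult_right_zero)
  qed
  ultimately have "(\<lambda>N. A (real N) * of_nat N powr (- s)
        + s * (LBINT y:{1..real N}. of_real y powr (- s - 1) * A y)) \<longlonglongrightarrow>
      0 + s * (LBINT y:{1..}. of_real y powr (- s - 1) * A y)" by (intro tendsto_intros)
  then show "(\<lambda>N. \<Sum>n=1..N. a n * of_nat n powr (- s)) \<longlonglongrightarrow>
      s * (LBINT y:{1..}. of_real y powr (- s - 1) * (\<Sum>n=1..nat \<lfloor>y\<rfloor>. a n))"
    using abel_summation_powr[OF s0, of a] by (simp add: A_def)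
qed

text \<open>The summatory function is the floor, that is y minus the fractional part. The term y
  gives s / (s - 1), and the fractional part is periodic with period 1; the pole of its transform,
  moved to s = 0 by the shift, is cancelled by the factor s of partial summation.\<close>

lemma riemann_zeta_continuation:
  obtains Z where "Z holomorphic_on - {1}" "Z 1 = 0"
    "\<And>s. Re s > 1 \<Longrightarrow> (\<lambda>n. of_nat (Suc n) powr (- s)) sums Z s"
    "\<And>a. strip_polynomial_bound {s. \<bar>Im s\<bar> \<ge> 1} a Z"
proof -
  let ?f = "\<lambda>x. complex_of_real (frac x)"
  have fb: "norm (?f x) \<le> 1" for x using frac_ge_0[of x] frac_lt_1[of x] by simp
  have per: "periodic_tail 1 ?f"
    unfolding periodic_tail_def
  proof (intro conjI allI impI exI)
    show "norm (?f x) \<le> 1" for x by (rule fb)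
    show "?f (x + 1) = ?f x" for x by (simp add: frac_def)
  qed (simp_all add: frac_def)
  obtain H where H: "H holomorphic_on UNIV"
    "\<And>s. Re s > 1 \<Longrightarrow> tail_mellin ?f s = period_mean 1 ?f / (s - 1) + H s"
    "\<And>a. strip_polynomial_bound UNIV a H"
    using tail_mellin_periodic[OF per] by blast
  define W where "W s = period_mean 1 ?f + s * H (s + 1)" for s
  \<comment> \<open>The value 0 at the pole is the convention built into
    \<open>riemann_zeta\<close>.\<close>
  define Z where "Z s = (if s = 1 then 0 else s / (s - 1) - W s)" for s
  have Wh: "W holomorphic_on A" for A
  proof -
    have "(H \<circ> (\<lambda>s. s + 1)) holomorphic_on A"
      by (rule holomorphic_on_compose_gen[OF _ H(1)]) (auto intro!: holomorphic_intros)
    then show ?thesis unfolding W_def by (auto simp: o_def intro!: holomorphic_intros)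
  qed
  have Wb: "strip_polynomial_bound UNIV a W" for a
    unfolding W_def by (intro strip_polynomial_bound_add strip_polynomial_bound_mult
        strip_polynomial_bound_const strip_polynomial_bound_id strip_polynomial_bound_shift H(3))
  have "Z holomorphic_on - {1}"
  proof (rule holomorphic_transform)
    show "(\<lambda>s. s / (s - 1) - W s) holomorphic_on - {1}" by (intro holomorphic_intros Wh) auto
  qed (auto simp: Z_def)
  moreover have "(\<lambda>n. of_nat (Suc n) powr (- s)) sums Z s" if s: "Re s > 1" for s
  proof -
    have s1: "s \<noteq> 1" and s0: "s \<noteq> 0" using s by auto
    have b: "norm (\<Sum>n=1..nat \<lfloor>y\<rfloor>. (1 :: complex)) \<le> 1 * y powr 1" if "y \<ge> 1" for y
      using that by simp
    have "(\<lambda>N. \<Sum>n=1..N. 1 * complex_of_nat n powr (- s)) \<longlonglongrightarrow>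
        s * (LBINT y:{1..}. of_real y powr (- s - 1) * (\<Sum>n=1..nat \<lfloor>y\<rfloor>. 1))"
      using s by (intro abel_summation_tendsto(2)[of _ 1 1] b) auto
    also have "(LBINT y:{1..}. of_real y powr (- s - 1) * (\<Sum>n=1..nat \<lfloor>y\<rfloor>. (1 :: complex)))
        = (LBINT y:{1..}. of_real y powr (- s) * 1 - of_real y powr (- (s + 1)) * ?f y)"
    proof (intro set_lebesgue_integral_cong allI impI)
      fix y :: real assume "y \<in> {1..}"
      then have y: "y \<ge> 1" by simp
      then have "complex_of_real y powr (- s) = of_real y powr (- s - 1) * of_real y"
        by (simp add: powr_diff)
      moreover have "(\<Sum>n=1..nat \<lfloor>y\<rfloor>. (1 :: complex)) = of_real y - ?f y"
        using y by (simp add: frac_def of_nat_nat)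
      ultimately show "of_real y powr (- s - 1) * (\<Sum>n=1..nat \<lfloor>y\<rfloor>. (1 :: complex))
          = of_real y powr (- s) * 1 - of_real y powr (- (s + 1)) * ?f y"
        by (simp add: right_diff_distrib)
    qed auto
    also have "\<dots> = tail_mellin (\<lambda>_. 1) s - tail_mellin ?f (s + 1)"
      unfolding tail_mellin_def
      by (rule set_integral_diff; rule tail_mellin_integrable(1)[where B = 1])
        (use s fb in \<open>auto simp: frac_def\<close>)
    also have "s * \<dots> = Z s"
      using s s0 s1 by (simp add: tail_mellin_1 H(2) Z_def W_def right_diff_distrib distrib_left)
    finally show ?thesis by (simp add: sums_def sum.atLeast1_atMost_eq)
  qed
  moreover have "strip_polynomial_bound {s. \<bar>Im s\<bar> \<ge> 1} a Z" for a
  proof -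
    let ?U = "{s. \<bar>Im s\<bar> \<ge> 1}"
    have inv: "strip_polynomial_bound ?U a (\<lambda>s. 1 / (s - 1))"
      unfolding strip_polynomial_bound_def
    proof (intro allI exI ballI impI)
      fix s assume "s \<in> ?U"
      then have "norm (s - 1) \<ge> 1" using abs_Im_le_cmod[of "s - 1"] by simp
      then show "norm (1 / (s - 1)) \<le> 1 * (1 + norm s) ^ 0" by (simp add: norm_divide divide_le_eq)
    qed
    have "strip_polynomial_bound ?U a (\<lambda>s. s * (1 / (s - 1)) + - 1 * W s)"
      by (intro strip_polynomial_bound_add strip_polynomial_bound_mult strip_polynomial_bound_const
          strip_polynomial_bound_id inv strip_polynomial_bound_subset[OF Wb]) auto
    moreover have "Z s = s * (1 / (s - 1)) + - 1 * W s" if "s \<in> ?U" for s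
      using that by (auto simp: Z_def)
    ultimately show ?thesis unfolding strip_polynomial_bound_def by simp
  qed
  ultimately show ?thesis using that[of Z] by (auto simp: Z_def)
qed

lemma connected_minus_point_complex: "connected (- {a :: complex})"
  by (simp add: connected_punctured_universe)

text \<open>The punctured plane is connected, so the identity theorem makes the constructed
  continuation the only function that fits the description, the value at 1 being prescribed. The
  growth bound keeps to |Im s| >= 1 because of the pole.\<close>

lemma
  shows riemann_zeta_holomorphic: "riemann_zeta holomorphic_on - {1}"
    and riemann_zeta_sums: "\<And>s. Re s > 1 \<Longrightarrow> (\<lambda>n. of_nat (Suc n) powr (- s)) sums riemann_zeta s"
    and riemann_zeta_bound: "\<And>a. strip_polynomial_bound {s. \<bar>Im s\<bar> \<ge> 1} a riemann_zeta"
proof -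
  obtain Z where Z: "Z holomorphic_on - {1}" "Z 1 = 0"
    "\<And>s. Re s > 1 \<Longrightarrow> (\<lambda>n. of_nat (Suc n) powr (- s)) sums Z s"
    "\<And>a. strip_polynomial_bound {s. \<bar>Im s\<bar> \<ge> 1} a Z"
    using riemann_zeta_continuation by blast
  have "riemann_zeta = Z"
    unfolding riemann_zeta_def
  proof (rule the_equality)
    fix f assume f: "f holomorphic_on - {1} \<and> f 1 = 0 \<and>
      (\<forall>s. Re s > 1 \<longrightarrow> (\<lambda>n. of_nat (Suc n) powr (- s)) sums f s)"
    have "f z = Z z" if z: "z \<in> - {1}" for z
    proof (rule analytic_continuation_open[of "{s. Re s > 1}" "- {1}" f Z])
      show "{s. Re s > 1} \<noteq> {}" by (auto intro!: exI[of _ 2])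
      show "f w = Z w" if "w \<in> {s. Re s > 1}" for w
        using f Z(3)[of w] that sums_unique2 by blast
    qed (use f Z(1) z in \<open>auto intro: open_halfspace_Re_gt connected_minus_point_complex\<close>)
    then show "f = Z" using f Z(2) by (intro ext) (metis ComplI singletonD)
  qed (intro conjI allI impI Z)
  note eq = this
  show "riemann_zeta holomorphic_on - {1}" unfolding eq by (rule Z)
  show "\<And>s. Re s > 1 \<Longrightarrow> (\<lambda>n. of_nat (Suc n) powr (- s)) sums riemann_zeta s"
    unfolding eq by (rule Z)
  show "\<And>a. strip_polynomial_bound {s. \<bar>Im s\<bar> \<ge> 1} a riemann_zeta"
    unfolding eq by (rule Z)
qed

section \<open>The summatory function of the character modulo 4 and its L-function\<close>

lemma sum_chi4: "(\<Sum>n=1..N. chi4 n) = (if N mod 4 \<in> {1, 2} then 1 else 0)"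
proof (induction N)
  case (Suc N)
  have "N mod 4 \<in> {0, 1, 2, 3}" by auto
  with Suc show ?case by (auto simp: chi4_def mod_Suc)
qed simp

text \<open>For 0 < Re s <= 1 the convergence is only conditional, so the sum over all n and the sum
  over odd numbers are compared through partial sums of even length rather than by
  rearrangement.\<close>

lemma sum_chi4_powr:
  "(\<Sum>n=1..2 * K. complex_of_int (chi4 n) * of_nat n powr (- s))
    = (\<Sum>k<K. (- 1) ^ k * of_nat (2 * k + 1) powr (- s))"
proof (induction K)
  case (Suc K)
  have "2 * Suc K = Suc (Suc (2 * K))" by simp
  moreover have "chi4 (Suc (Suc (2 * K))) = 0" unfolding chi4_def by presburger
  moreover have "complex_of_int (chi4 (Suc (2 * K))) = (- 1) ^ K"
    using chi4_odd[of K] by simp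
  ultimately show ?case using Suc by simp
qed simp

text \<open>The summatory function of the character takes only the values 0 and 1 and has period 4,
  so partial summation already works for Re s > 0. The factor s removes the only pole of the
  transform, and the continuation is entire.\<close>

lemma L_chi4_continuation:
  obtains Z where "Z holomorphic_on UNIV"
    "\<And>s. Re s > 0 \<Longrightarrow> (\<lambda>k. (- 1) ^ k * of_nat (2 * k + 1) powr (- s)) sums Z s"
    "\<And>a. strip_polynomial_bound UNIV a Z"
proof -
  let ?f = "\<lambda>y. \<Sum>n=1..nat \<lfloor>y :: real\<rfloor>. complex_of_int (chi4 n)"
  have f: "?f y = (if nat \<lfloor>y\<rfloor> mod 4 \<in> {1, 2} then 1 else 0)" for y
    by (simp only: sum_chi4 flip: of_int_sum) simp
  have per: "periodic_tail 4 ?f"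
    unfolding periodic_tail_def
  proof (intro conjI allI impI exI)
    show "?f \<in> borel_measurable borel"
      by (rule measurable_compose[OF measurable_real_floor]) simp
    show "norm (?f x) \<le> 1" for x unfolding f by simp
    show "?f (x + 4) = ?f x" if "x \<ge> 1" for x
    proof -
      have "nat \<lfloor>x + 4\<rfloor> = nat \<lfloor>x\<rfloor> + 4" using that by (simp add: nat_add_distrib)
      then show ?thesis unfolding f by simp
    qed
  qed simp
  obtain H where H: "H holomorphic_on UNIV"
    "\<And>s. Re s > 1 \<Longrightarrow> tail_mellin ?f s = period_mean 4 ?f / (s - 1) + H s"
    "\<And>a. strip_polynomial_bound UNIV a H"
    using tail_mellin_periodic[OF per] by blast
  define W where "W s = period_mean 4 ?f + s * H (s + 1)" for s
  have "W holomorphic_on UNIV"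
  proof -
    have "(H \<circ> (\<lambda>s. s + 1)) holomorphic_on UNIV"
      by (rule holomorphic_on_compose_gen[OF _ H(1)]) (auto intro!: holomorphic_intros)
    then show ?thesis unfolding W_def by (auto simp: o_def intro!: holomorphic_intros)
  qed
  moreover have "strip_polynomial_bound UNIV a W" for a
    unfolding W_def by (intro strip_polynomial_bound_add strip_polynomial_bound_mult
        strip_polynomial_bound_const strip_polynomial_bound_id strip_polynomial_bound_shift H(3))
  moreover have "(\<lambda>k. (- 1) ^ k * of_nat (2 * k + 1) powr (- s)) sums W s" if s: "Re s > 0" for s
  proof -
    have s0: "s \<noteq> 0" using s by auto
    have b: "norm (?f y) \<le> 1 * y powr 0" if "y \<ge> 1" for y
      using that unfolding f by simp
    have "(\<lambda>N. \<Sum>n=1..N. complex_of_int (chi4 n) * complex_of_nat n powr (- s)) \<longlonglongrightarrow>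
        s * (LBINT y:{1..}. of_real y powr (- s - 1) * ?f y)"
      using s by (intro abel_summation_tendsto(2)[of _ 1 0] b) auto
    also have "s * (LBINT y:{1..}. of_real y powr (- s - 1) * ?f y) = s * tail_mellin ?f (s + 1)"
    proof -
      have "- s - 1 = - (s + 1)" by simp
      then show ?thesis by (simp only: tail_mellin_def)
    qed
    also have "tail_mellin ?f (s + 1) = period_mean 4 ?f / s + H (s + 1)"
      using H(2)[of "s + 1"] s by simp
    also have "s * \<dots> = W s" using s0 unfolding W_def by (simp only: distrib_left) simp
    finally have "(\<lambda>N. \<Sum>n=1..N. complex_of_int (chi4 n) * complex_of_nat n powr (- s)) \<longlonglongrightarrow> W s" .
    moreover have "strict_mono (\<lambda>K :: nat. 2 * K)" by (simp add: strict_mono_def)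
    ultimately have "((\<lambda>N. \<Sum>n=1..N. complex_of_int (chi4 n) * complex_of_nat n powr (- s)) \<circ> (\<lambda>K. 2 * K))
        \<longlonglongrightarrow> W s" by (rule LIMSEQ_subseq_LIMSEQ)
    then show ?thesis unfolding sums_def o_def sum_chi4_powr .
  qed
  ultimately show ?thesis using that[of W] by blast
qed

lemma
  shows L_chi4_holomorphic: "L_chi4 holomorphic_on UNIV"
    and L_chi4_sums: "\<And>s. Re s > 0 \<Longrightarrow> (\<lambda>k. (- 1) ^ k * of_nat (2 * k + 1) powr (- s)) sums L_chi4 s"
    and L_chi4_bound: "\<And>a. strip_polynomial_bound UNIV a L_chi4"
proof -
  obtain Z where Z: "Z holomorphic_on UNIV"
    "\<And>s. Re s > 0 \<Longrightarrow> (\<lambda>k. (- 1) ^ k * of_nat (2 * k + 1) powr (- s)) sums Z s"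
    "\<And>a. strip_polynomial_bound UNIV a Z"
    using L_chi4_continuation by blast
  have "L_chi4 = Z"
    unfolding L_chi4_def
  proof (rule the_equality)
    fix f assume f: "f holomorphic_on UNIV \<and>
      (\<forall>s. Re s > 0 \<longrightarrow> (\<lambda>k. (- 1) ^ k * of_nat (2 * k + 1) powr (- s)) sums f s)"
    have "f z = Z z" for z
    proof (rule analytic_continuation_open[of "{s. Re s > 0}" UNIV f Z])
      show "{s. Re s > 0} \<noteq> {}" by (auto intro!: exI[of _ 2])
      show "f w = Z w" if "w \<in> {s. Re s > 0}" for w
        using f Z(2)[of w] that sums_unique2 by blast
    qed (use f Z(1) in \<open>auto intro: open_halfspace_Re_gt\<close>)
    then show "f = Z" by blast
  qed (intro conjI allI impI Z)
  note eq = this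
  show "L_chi4 holomorphic_on UNIV" unfolding eq by (rule Z)
  show "\<And>s. Re s > 0 \<Longrightarrow> (\<lambda>k. (- 1) ^ k * of_nat (2 * k + 1) powr (- s)) sums L_chi4 s"
    unfolding eq by (rule Z)
  show "\<And>a. strip_polynomial_bound UNIV a L_chi4" unfolding eq by (rule Z)
qed

section \<open>Derivatives of complex order\<close>

text \<open>Continuity up to 0 and the case m = 0 provide boundedness near 0, and therefore Mellin
  transforms on all of Re z > 0. Derivatives are not mentioned here; they are supplied as a sequence
  of such functions.\<close>

definition rapidly_decreasing :: "(real \<Rightarrow> complex) \<Rightarrow> bool" where
  "rapidly_decreasing f \<longleftrightarrow> continuous_on {0..} f \<and> (\<forall>m :: nat. \<exists>B. \<forall>u\<ge>0. u ^ m * norm (f u) \<le> B)"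

lemma rapidly_decreasing_measurable:
  assumes "rapidly_decreasing f"
  shows "set_borel_measurable borel {0<..} f"
  unfolding set_borel_measurable_def
proof (rule borel_measurable_continuous_on_indicator)
  show "continuous_on {0<..} f"
    using assms unfolding rapidly_decreasing_def by (elim conjE continuous_on_subset) auto
qed simp

lemma rapidly_decreasing_powr_bound:
  assumes f: "rapidly_decreasing f" and a: "a \<ge> 0"
  obtains B where "\<And>u. u > 0 \<Longrightarrow> u powr a * norm (f u) \<le> B"
proof -
  define m where "m = nat \<lceil>a\<rceil>"
  have m: "a \<le> real m" by (simp add: m_def real_nat_ceiling_ge)
  obtain B0 where B0: "\<And>u. u \<ge> 0 \<Longrightarrow> u ^ 0 * norm (f u) \<le> B0"
    using f unfolding rapidly_decreasing_def by meson
  obtain B1 where B1: "\<And>u. u \<ge> 0 \<Longrightarrow> u ^ m * norm (f u) \<le> B1"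
    using f unfolding rapidly_decreasing_def by meson
  have "u powr a * norm (f u) \<le> B0 + B1" if u: "u > 0" for u
  proof -
    have "u powr a * norm (f u) \<le> (u powr 0 + u powr real m) * norm (f u)"
      using u a m by (intro mult_right_mono powr_le_add_powr) auto
    also have "\<dots> = u ^ 0 * norm (f u) + u ^ m * norm (f u)"
      using u by (simp add: distrib_right powr_realpow)
    also have "\<dots> \<le> B0 + B1" using u by (intro add_mono B0 B1) auto
    finally show ?thesis .
  qed
  then show ?thesis using that by blast
qed

lemma set_integrable_powr_Ioc:
  fixes a :: real
  assumes "a > - 1"
  shows "set_integrable lborel {0<..1} (\<lambda>x. x powr a)"
proof -
  have "(\<lambda>x. x powr a) absolutely_integrable_on {0..1}"
    using has_integral_powr_from_0[OF assms, of 1]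
    by (intro nonnegative_absolutely_integrable_1) auto
  then have "set_integrable lborel {0..1} (\<lambda>x. x powr a)"
    by (rule set_integrable_lborel_if_absolutely_integrable) (simp add: set_borel_measurable_def)
  then show ?thesis by (rule set_integrable_subset) auto
qed

text \<open>Near 0 boundedness leaves u^(Re z - 1), integrable since Re z > 0; on [1, oo) a bound on
  u^(Re z + 1) |f(u)| leaves u^(-2).\<close>

lemma rapidly_decreasing_mellin_integrable:
  assumes f: "rapidly_decreasing f" and z: "Re z > 0"
  shows "mellin_integrable f z"
proof -
  let ?x = "Re z"
  obtain B0 where B0: "\<And>u. u > 0 \<Longrightarrow> u powr 0 * norm (f u) \<le> B0"
    using rapidly_decreasing_powr_bound[OF f, of 0] by auto
  obtain B1 where B1: "\<And>u. u > 0 \<Longrightarrow> u powr (?x + 1) * norm (f u) \<le> B1"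
    using rapidly_decreasing_powr_bound[OF f, of "?x + 1"] z by auto
  let ?h = "\<lambda>u. u powr (?x - 1) * norm (f u)"
  have m: "(\<lambda>u. u powr (?x - 1) * norm (indicator {0<..} u *\<^sub>R f u)) \<in> borel_measurable borel"
    using rapidly_decreasing_measurable[OF f] unfolding set_borel_measurable_def by measurable
  have 1: "set_integrable lborel {0<..1} ?h"
  proof (rule set_integrable_bound)
    show "set_integrable lborel {0<..1} (\<lambda>u. B0 * u powr (?x - 1))"
      using z by (intro set_integrable_mult_right set_integrable_powr_Ioc) auto
    have "(\<lambda>u. indicator {0<..1} u * (u powr (?x - 1) * norm (indicator {0<..} u *\<^sub>R f u))) \<in> borel_measurable borel"
      using m by measurable
    also have "(\<lambda>u. indicator {0<..1} u * (u powr (?x - 1) * norm (indicator {0<..} u *\<^sub>R f u)))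
        = (\<lambda>u. indicator {0<..1} u *\<^sub>R ?h u)"
      by (auto simp: indicator_def fun_eq_iff)
    finally show "set_borel_measurable lborel {0<..1} ?h" by (simp add: set_borel_measurable_def)
    show "AE u in lborel. u \<in> {0<..1} \<longrightarrow> norm (?h u) \<le> norm (B0 * u powr (?x - 1))"
    proof (intro AE_I2 impI)
      fix u :: real assume "u \<in> {0<..1}"
      then have "norm (f u) \<le> B0" using B0[of u] by simp
      then have "u powr (?x - 1) * norm (f u) \<le> u powr (?x - 1) * B0" by (intro mult_left_mono) auto
      then have "?h u \<le> B0 * u powr (?x - 1)" by (simp only: mult.commute)
      then show "norm (?h u) \<le> norm (B0 * u powr (?x - 1))" by simp
    qed
  qed
  have 2: "set_integrable lborel {1..} ?h"
  proof (rule set_integrable_bound)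
    show "set_integrable lborel {1..} (\<lambda>u. B1 * u powr (- 2))"
      by (intro set_integrable_mult_right set_integrable_powr_atLeast(1)) auto
    have "(\<lambda>u. indicator {1..} u * (u powr (?x - 1) * norm (indicator {0<..} u *\<^sub>R f u))) \<in> borel_measurable borel"
      using m by measurable
    also have "(\<lambda>u. indicator {1..} u * (u powr (?x - 1) * norm (indicator {0<..} u *\<^sub>R f u)))
        = (\<lambda>u. indicator {1..} u *\<^sub>R ?h u)"
      by (auto simp: indicator_def fun_eq_iff)
    finally show "set_borel_measurable lborel {1..} ?h" by (simp add: set_borel_measurable_def)
    show "AE u in lborel. u \<in> {1..} \<longrightarrow> norm (?h u) \<le> norm (B1 * u powr (- 2))"
    proof (intro AE_I2 impI)
      fix u :: real assume u: "u \<in> {1..}"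
      have "?h u = u powr (- 2) * (u powr (?x + 1) * norm (f u))"
        using u by (simp add: mult.assoc [symmetric] powr_add [symmetric])
      also have "\<dots> \<le> u powr (- 2) * B1" using B1[of u] u by (intro mult_left_mono) auto
      finally show "norm (?h u) \<le> norm (B1 * u powr (- 2))" by (simp add: mult.commute)
    qed
  qed
  have "set_integrable lborel ({0<..1} \<union> {1..}) ?h" using 1 2 by (rule set_integrable_Un) auto
  also have "{0<..1} \<union> {1..} = {0 :: real<..}" by auto
  finally show ?thesis
    by (simp add: mellin_integrable_norm_iff[OF rapidly_decreasing_measurable[OF f]])
qed

text \<open>Integration by parts with antiderivative u^z f(u) / z, which tends to 0 at both ends: at
  0 because f is bounded and Re z > 0, at infinity by rapid decrease. Here \<open>f'\<close> stands
  for minus the derivative, so the formula carries no sign.\<close>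

lemma mellin_deriv:
  assumes f: "rapidly_decreasing f" and f': "rapidly_decreasing f'"
    and d: "\<And>u. u > 0 \<Longrightarrow> (f has_vector_derivative - f' u) (at u)" and z: "Re z > 0"
  shows "mellin f z = mellin f' (z + 1) / z"
proof -
  have z0: "z \<noteq> 0" using z by auto
  let ?p = "\<lambda>u. complex_of_real u powr (z - 1) * f u"
  let ?q = "\<lambda>u. complex_of_real u powr ((z + 1) - 1) * f' u"
  let ?F = "\<lambda>u. complex_of_real u powr z * f u / z"
  have pi: "set_integrable lborel {0<..} ?p" and qi: "set_integrable lborel {0<..} ?q"
    using rapidly_decreasing_mellin_integrable[OF f z] rapidly_decreasing_mellin_integrable[OF f', of "z + 1"] z
    by (simp_all add: mellin_integrable_def)
  have pc: "isCont h u" if "rapidly_decreasing h" "u > 0" for h :: "real \<Rightarrow> complex" and u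
  proof -
    have "continuous_on {0<..} h"
      using that(1) unfolding rapidly_decreasing_def by (elim conjE continuous_on_subset) auto
    then show ?thesis using that(2) by (simp add: continuous_on_eq_continuous_at)
  qed
  obtain B1 where B1: "\<And>u. u > 0 \<Longrightarrow> u powr (Re z + 1) * norm (f u) \<le> B1"
    using rapidly_decreasing_powr_bound[OF f, of "Re z + 1"] z by auto
  obtain B0 where B0: "\<And>u. u > 0 \<Longrightarrow> u powr 0 * norm (f u) \<le> B0"
    using rapidly_decreasing_powr_bound[OF f, of 0] by auto
  have "(LBINT u=0..\<infinity>. ?p u - ?q u / z) = 0 - 0"
  proof (rule interval_integral_FTC_integrable[where F = ?F])
    fix u :: real assume "0 < ereal u"
    then have u: "u > 0" by simp
    have dp: "((\<lambda>u. complex_of_real u powr z) has_vector_derivative z * of_real u powr (z - 1)) (at u)"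
      using has_vector_derivative_of_real_powr[OF u] .
    have "(?F has_vector_derivative
        (of_real u powr z * (- f' u) + z * of_real u powr (z - 1) * f u) / z) (at u)"
      by (intro has_vector_derivative_divide has_vector_derivative_mult dp d[OF u])
    also have "(of_real u powr z * (- f' u) + z * of_real u powr (z - 1) * f u) / z = ?p u - ?q u / z"
      using z0 by (simp add: field_simps)
    finally show "(?F has_vector_derivative ?p u - ?q u / z) (at u)" .
    have ip: "isCont (\<lambda>u. complex_of_real u powr w) u" for w
      using u by (auto intro!: continuous_intros)
    show "isCont (\<lambda>u. ?p u - ?q u / z) u"
      using z0 by (intro isCont_diff isCont_mult isCont_divide ip pc[OF f u] pc[OF f' u] continuous_const)
  next
    have "einterval 0 \<infinity> = {0 :: real<..}" by (auto simp: einterval_def)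
    then show "set_integrable lborel (einterval 0 \<infinity>) (\<lambda>u. ?p u - ?q u / z)"
      using pi qi by (simp add: set_integral_diff set_integrable_divide)
  next
    have "((\<lambda>u. ?F u) \<longlongrightarrow> 0) (at_right 0)"
    proof (rule Lim_null_comparison)
      show "\<forall>\<^sub>F u in at_right 0. norm (?F u) \<le> u powr Re z * (B0 / norm z)"
        using eventually_at_right_less[of 0]
      proof eventually_elim
        case (elim u)
        then show ?case using B0[of u]
          by (simp add: norm_mult norm_divide norm_of_real_powr mult_left_mono divide_right_mono)
      qed
      have "((\<lambda>u. u powr Re z) \<longlongrightarrow> 0) (at_right 0)"
      proof -
        have "((\<lambda>u :: real. u powr Re z) \<longlongrightarrow> 0 powr Re z) (at_right 0)"
          using z by (intro tendsto_powr' tendsto_ident_at tendsto_const) (auto intro: eventually_at_right_less eventually_mono[OF eventually_at_right_less])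
        then show ?thesis by simp
      qed
      then show "((\<lambda>u. u powr Re z * (B0 / norm z)) \<longlongrightarrow> 0) (at_right 0)" by (rule tendsto_mult_left_zero)
    qed
    then show "((?F \<circ> real_of_ereal) \<longlongrightarrow> 0) (at_right 0)"
      by (simp add: zero_ereal_def ereal_tendsto_simps)
  next
    have "((\<lambda>u. ?F u) \<longlongrightarrow> 0) at_top"
    proof (rule Lim_null_comparison)
      show "\<forall>\<^sub>F u in at_top. norm (?F u) \<le> u powr (- 1) * (B1 / norm z)"
        using eventually_gt_at_top[of 0]
      proof eventually_elim
        case (elim u)
        have "norm (?F u) = u powr (- 1) * (u powr (Re z + 1) * norm (f u)) / norm z"
        proof -
          have "u powr (- 1) * (u powr (Re z + 1) * norm (f u)) = u powr Re z * norm (f u)"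
            unfolding mult.assoc [symmetric] powr_add [symmetric] by simp
          then show ?thesis using elim by (simp only: norm_mult norm_divide norm_of_real_powr)
        qed
        also have "\<dots> \<le> u powr (- 1) * B1 / norm z"
          using B1[OF elim] by (intro divide_right_mono mult_left_mono) auto
        finally show ?case by simp
      qed
      have "((\<lambda>u :: real. u powr (- 1)) \<longlongrightarrow> 0) at_top"
        by (intro tendsto_neg_powr filterlim_ident) auto
      then show "((\<lambda>u. u powr (- 1) * (B1 / norm z)) \<longlongrightarrow> 0) at_top" by (rule tendsto_mult_left_zero)
    qed
    then show "((?F \<circ> real_of_ereal) \<longlongrightarrow> 0) (at_left \<infinity>)"
      by (simp add: ereal_tendsto_simps)
  qed auto
  also have "(LBINT u=0..\<infinity>. ?p u - ?q u / z) = (LBINT u:{0<..}. ?p u - ?q u / z)"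
    by (simp add: interval_integral_to_infinity_eq zero_ereal_def)
  also have "\<dots> = mellin f z - mellin f' (z + 1) / z"
    unfolding mellin_def using pi qi by (subst set_integral_diff) (auto intro: set_integrable_divide)
  finally show ?thesis by simp
qed

text \<open>Each function is minus the derivative of its predecessor, as happens for u mapped to the
  n-th derivative of F at -u. With this sign convention repeated integration by parts is free of
  signs.\<close>

locale decreasing_derivatives =
  fixes f :: "nat \<Rightarrow> real \<Rightarrow> complex"
  assumes decr: "rapidly_decreasing (f n)"
    and deriv: "u > 0 \<Longrightarrow> (f n has_vector_derivative - f (Suc n) u) (at u)"
begin

lemma mellin_pochhammer:
  assumes "Re z > 0"
  shows "mellin (f n) z = mellin (f (n + k)) (z + of_nat k) / pochhammer z k"
proof (induction k)
  case (Suc k)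
  have "mellin (f (n + k)) (z + of_nat k) = mellin (f (Suc (n + k))) (z + of_nat k + 1) / (z + of_nat k)"
    using assms by (intro mellin_deriv decr deriv) auto
  with Suc show ?case by (simp add: pochhammer_Suc field_simps add_ac)
qed simp

text \<open>The formula with index k makes sense on Re s < k. All of them agree on Re s < 0 because
  k integrations by parts divide by \<open>pochhammer\<close>, and the same factor relates
  \<open>rGamma\<close> at two arguments differing by k. Gluing is done in the variable -s;
  \<open>rGamma\<close> is entire, so no point has to be excluded.\<close>

lemma fractional_derivative_exists:
  obtains G where "G holomorphic_on UNIV"
    "\<And>k s. Re s < real k \<Longrightarrow> G s = rGamma (of_nat k - s) * mellin (f k) (of_nat k - s)"
proof -
  define h where "h k w = rGamma (of_nat k + w) * mellin (f k) (of_nat k + w)" for k w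
  have hol: "h k holomorphic_on {w. Re w > 0 - real k}" for k
  proof -
    have "mellin (f k) field_differentiable at z" if z: "Re z > 0" for z
    proof -
      have "mellin (f k) holomorphic_on {w. Re z / 2 < Re w \<and> Re w < Re z + 1}"
        using z by (intro mellin_holomorphic_strip rapidly_decreasing_measurable decr
            rapidly_decreasing_mellin_integrable) auto
      from holomorphic_on_imp_differentiable_at[OF this open_Re_strip, of z] z show ?thesis by simp
    qed
    then have "mellin (f k) holomorphic_on {z. Re z > 0}"
      by (auto simp: holomorphic_on_def intro: field_differentiable_at_within)
    then have "(mellin (f k) \<circ> (\<lambda>w. of_nat k + w)) holomorphic_on {w. Re w > 0 - real k}"
      by (rule holomorphic_on_compose_gen[rotated]) (auto intro!: holomorphic_intros)
    then show ?thesis unfolding h_def by (auto simp: o_def intro!: holomorphic_intros)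
  qed
  have eq: "h k w = h 0 w" if w: "Re w > 0" for k w
  proof -
    have "pochhammer w k \<noteq> 0" using w by (auto simp: pochhammer_eq_0_iff)
    then show ?thesis
      using mellin_pochhammer[OF w, of 0 k] pochhammer_rGamma[of w k]
      by (simp add: h_def add.commute)
  qed
  obtain H where H: "H holomorphic_on UNIV" "\<And>k s. Re s > 0 - real k \<Longrightarrow> H s = h k s"
    using holomorphic_glue_halfplanes[of h 0, OF hol eq] by blast
  have "(H \<circ> (\<lambda>s. - s)) holomorphic_on UNIV"
    by (rule holomorphic_on_compose_gen[OF _ H(1)]) (auto intro!: holomorphic_intros)
  moreover have "(H \<circ> (\<lambda>s. - s)) s = rGamma (of_nat k - s) * mellin (f k) (of_nat k - s)"
    if "Re s < real k" for k s
    using that by (simp add: H(2)[of k] h_def)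
  ultimately show ?thesis using that by blast
qed

end

text \<open>The reflection of the n-th derivative, which differs by the sign (-1)^n from the n-th
  derivative of the reflected function; this is the form required by
  \<open>decreasing_derivatives\<close>.\<close>

definition reflected_deriv :: "(real \<Rightarrow> complex) \<Rightarrow> nat \<Rightarrow> real \<Rightarrow> complex" where
  "reflected_deriv F n u = halfline_deriv n F (- u)"

section \<open>Derivatives of complex order of a Schwartz function on the half-line\<close>

context
  fixes F assumes F: "F \<in> schwartz_halfline"
begin

lemma reflected_deriv_has_derivative:
  assumes "u \<ge> 0"
  shows "(reflected_deriv F n has_vector_derivative - reflected_deriv F (Suc n) u) (at u within {0..})"
proof -
  have "halfline_deriv n F differentiable (at (- u) within {..0})"
    using F assms by (simp add: schwartz_halfline_def)
  then have "(halfline_deriv n F has_vector_derivative halfline_deriv (Suc n) F (- u)) (at (- u) within {..0})"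
    by (simp add: vector_derivative_works halfline_deriv_def)
  moreover have "uminus ` {0 :: real..} = {..0}" by force
  ultimately have 1: "(halfline_deriv n F has_vector_derivative halfline_deriv (Suc n) F (- u))
      (at (- u) within uminus ` {0..})" by simp
  have 2: "(uminus has_vector_derivative - 1) (at u within {0..})"
    by (auto intro!: derivative_eq_intros)
  show ?thesis
    using vector_diff_chain_within[OF 2 1] by (simp add: reflected_deriv_def [abs_def] o_def)
qed

lemma rapidly_decreasing_reflected_deriv: "rapidly_decreasing (reflected_deriv F n)"
  unfolding rapidly_decreasing_def
proof (intro conjI allI)
  show c: "continuous_on {0..} (reflected_deriv F n)"
    by (auto simp: continuous_on_eq_continuous_within
        intro: has_vector_derivative_continuous[OF reflected_deriv_has_derivative])
  fix m :: nat
  have "((\<lambda>x. of_real (\<bar>x\<bar> ^ m) * halfline_deriv n F x) \<longlongrightarrow> 0) at_bot"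
    using F by (simp add: schwartz_halfline_def)
  then have "((\<lambda>u. of_real (\<bar>- u\<bar> ^ m) * halfline_deriv n F (- u)) \<longlongrightarrow> 0) at_top"
    by (simp add: filterlim_at_bot_mirror)
  then have "\<forall>\<^sub>F u in at_top. norm (of_real (\<bar>- u\<bar> ^ m) * halfline_deriv n F (- u)) < 1"
    by (auto dest!: tendstoD[of _ _ _ 1])
  then obtain R where R: "\<And>u. u \<ge> R \<Longrightarrow> norm (of_real (\<bar>- u\<bar> ^ m) * halfline_deriv n F (- u)) < 1"
    by (auto simp: eventually_at_top_linorder)
  have "compact ((\<lambda>u. u ^ m * norm (reflected_deriv F n u)) ` {0..max R 0})"
    by (intro compact_continuous_image continuous_intros continuous_on_subset[OF c]) auto
  then obtain B where B: "\<And>u. u \<in> {0..max R 0} \<Longrightarrow> norm (u ^ m * norm (reflected_deriv F n u)) \<le> B"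
    by (meson compact_imp_bounded bounded_iff imageI)
  show "\<exists>B. \<forall>u\<ge>0. u ^ m * norm (reflected_deriv F n u) \<le> B"
  proof (intro exI allI impI)
    fix u :: real assume u: "u \<ge> 0"
    show "u ^ m * norm (reflected_deriv F n u) \<le> max 1 B"
    proof (cases "u \<ge> R")
      case True
      then show ?thesis using R[OF True] u by (simp add: norm_mult norm_power reflected_deriv_def max_def)
    next
      case False
      then show ?thesis using B[of u] u by (auto simp: max_def)
    qed
  qed
qed

lemma decreasing_derivatives_reflected_deriv: "decreasing_derivatives (reflected_deriv F)"
proof
  fix u :: real and n assume "u > 0"
  moreover from this have "at u within {0..} = at u" by (intro at_within_interior) auto
  ultimately show "(reflected_deriv F n has_vector_derivative - reflected_deriv F (Suc n) u) (at u)"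
    using reflected_deriv_has_derivative[of u n] by simp
qed (rule rapidly_decreasing_reflected_deriv)

text \<open>The case k = 0 of the glued function is the defining integral on Re s < 0, and the
  identity theorem leaves no other entire function. Besides holomorphy this provides a usable
  formula on every half-plane Re s < k.\<close>

lemma
  shows complex_deriv_at_0_holomorphic: "complex_deriv_at_0 F holomorphic_on UNIV"
    and complex_deriv_at_0_eq: "\<And>k s. Re s < real k \<Longrightarrow>
      complex_deriv_at_0 F s = rGamma (of_nat k - s) * mellin (reflected_deriv F k) (of_nat k - s)"
proof -
  interpret decreasing_derivatives "reflected_deriv F" by (rule decreasing_derivatives_reflected_deriv)
  obtain G where G: "G holomorphic_on UNIV" "\<And>k s. Re s < real k \<Longrightarrow>
      G s = rGamma (of_nat k - s) * mellin (reflected_deriv F k) (of_nat k - s)"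
    using fractional_derivative_exists by blast
  have G0: "G s = 1 / Gamma (- s) * (LBINT u:{0<..}. of_real u powr (- s - 1) * F (- u))"
    if "Re s < 0" for s
    using G(2)[of s 0] that
    by (simp add: mellin_def reflected_deriv_def halfline_deriv_def rGamma_inverse_Gamma field_simps)
  have eq: "complex_deriv_at_0 F = G"
    unfolding complex_deriv_at_0_def
  proof (rule the_equality)
    fix f assume f: "f holomorphic_on UNIV \<and> (\<forall>s. Re s < 0 \<longrightarrow>
        f s = 1 / Gamma (- s) * (LBINT u:{0<..}. of_real u powr (- s - 1) * F (- u)))"
    have "f z = G z" for z
    proof (rule analytic_continuation_open[of "{s. Re s < 0}" UNIV f G])
      show "{s. Re s < 0} \<noteq> {}" by (auto intro!: exI[of _ "- 1"])
    qed (use f G(1) G0 in \<open>auto intro: open_halfspace_Re_lt\<close>)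
    then show "f = G" by blast
  qed (use G(1) G0 in blast)
  show "complex_deriv_at_0 F holomorphic_on UNIV" unfolding eq by (rule G(1))
  show "\<And>k s. Re s < real k \<Longrightarrow>
      complex_deriv_at_0 F s = rGamma (of_nat k - s) * mellin (reflected_deriv F k) (of_nat k - s)"
    unfolding eq by (rule G(2))
qed

text \<open>At s = 0 the formula with k = 1 is the plain integral of F'(-u) over u > 0, which is
  F(0) by the fundamental theorem of calculus. The value is needed for the residue at 0.\<close>

lemma complex_deriv_at_0_0: "complex_deriv_at_0 F 0 = F 0"
proof -
  let ?f = "reflected_deriv F 0" and ?f' = "reflected_deriv F 1"
  have "mellin ?f' 1 = (LBINT u:{0<..}. ?f' u)"
    unfolding mellin_def by (intro set_lebesgue_integral_cong) auto
  have i: "set_integrable lborel {0<..} ?f'"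
    using rapidly_decreasing_mellin_integrable[OF rapidly_decreasing_reflected_deriv, of 1 1]
    unfolding mellin_integrable_def by (rule set_integrable_cong[THEN iffD1, rotated -1]) auto
  have c: "continuous_on {0..} (reflected_deriv F n)" for n
    using rapidly_decreasing_reflected_deriv unfolding rapidly_decreasing_def by blast
  interpret decreasing_derivatives "reflected_deriv F" by (rule decreasing_derivatives_reflected_deriv)
  have "(LBINT u=0..\<infinity>. - ?f' u) = 0 - ?f 0"
  proof (rule interval_integral_FTC_integrable[where F = ?f])
    fix u :: real assume "0 < ereal u"
    then have u: "u > 0" by simp
    show "(?f has_vector_derivative - ?f' u) (at u)" using deriv[OF u, of 0] by simp
    have "continuous_on {0<..} ?f'" using c by (rule continuous_on_subset) auto
    then show "isCont (\<lambda>u. - ?f' u) u" using u by (simp add: continuous_on_eq_continuous_at)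
  next
    have "einterval 0 \<infinity> = {0 :: real<..}" by (auto simp: einterval_def)
    then show "set_integrable lborel (einterval 0 \<infinity>) (\<lambda>u. - ?f' u)"
      using i by (simp add: set_integrable_def)
  next
    have "(?f \<longlongrightarrow> ?f 0) (at 0 within {0..})" using c[of 0] by (auto simp: continuous_on_def)
    then have "(?f \<longlongrightarrow> ?f 0) (at_right 0)" by (rule tendsto_within_subset) auto
    then show "((?f \<circ> real_of_ereal) \<longlongrightarrow> ?f 0) (at_right 0)"
      by (simp add: zero_ereal_def ereal_tendsto_simps)
  next
    obtain B where B: "\<And>u. u > 0 \<Longrightarrow> u powr 1 * norm (?f u) \<le> B"
      using rapidly_decreasing_powr_bound[OF rapidly_decreasing_reflected_deriv, of 1 0] by auto
    have "(?f \<longlongrightarrow> 0) at_top"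
    proof (rule Lim_null_comparison)
      show "\<forall>\<^sub>F u in at_top. norm (?f u) \<le> B / u"
        using eventually_gt_at_top[of 0]
        by eventually_elim (use B in \<open>auto simp: field_simps\<close>)
      show "((\<lambda>u. B / u) \<longlongrightarrow> 0) at_top"
        by (rule tendsto_divide_0[OF tendsto_const filterlim_at_top_imp_at_infinity[OF filterlim_ident]])
    qed
    then show "((?f \<circ> real_of_ereal) \<longlongrightarrow> 0) (at_left \<infinity>)" by (simp add: ereal_tendsto_simps)
  qed auto
  also have "(LBINT u=0..\<infinity>. - ?f' u) = (LBINT u:{0<..}. - ?f' u)"
    by (simp add: interval_integral_to_infinity_eq zero_ereal_def)
  also have "\<dots> = - (LBINT u:{0<..}. ?f' u)" by (simp add: set_lebesgue_integral_def)
  finally have "(LBINT u:{0<..}. ?f' u) = F 0" by (simp add: reflected_deriv_def halfline_deriv_def)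
  with \<open>mellin ?f' 1 = _\<close> show ?thesis
    using complex_deriv_at_0_eq[of 0 1] by simp
qed

end

section \<open>Moving vertical lines of integration\<close>

text \<open>The residue theorem on rectangles of height T(n), whose horizontal sides contribute at
  most 2 M(n) (b - a). The regions and pole sets depend on n so that infinitely many poles can be
  collected in the limit; convexity of the region makes winding numbers vanish outside it. The
  factor is 2 pi without i because integration is over y, with dz = i dy.\<close>

theorem vertical_line_shift:
  fixes K :: "complex \<Rightarrow> complex" and T M :: "nat \<Rightarrow> real"
  assumes ab: "a < b" and T0: "\<And>n. T n > 0" and T: "filterlim T at_top sequentially"
    and S: "\<And>n. open (S n)" "\<And>n. convex (S n)"
      "\<And>n. cbox (Complex a (- T n)) (Complex b (T n)) \<subseteq> S n"
    and P: "\<And>n. finite (P n)" "\<And>n. P n \<subseteq> box (Complex a (- T n)) (Complex b (T n))"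
    and holo: "\<And>n. K holomorphic_on S n - P n"
    and inta: "integrable lborel (\<lambda>y. K (Complex a y))"
    and intb: "integrable lborel (\<lambda>y. K (Complex b y))"
    and bound: "\<And>n x. x \<in> {a..b} \<Longrightarrow> norm (K (Complex x (T n))) \<le> M n"
      "\<And>n x. x \<in> {a..b} \<Longrightarrow> norm (K (Complex x (- T n))) \<le> M n"
    and M: "M \<longlonglongrightarrow> 0"
  shows "(\<lambda>n. 2 * of_real pi * (\<Sum>p\<in>P n. residue K p)) \<longlonglongrightarrow>
    (LBINT y. K (Complex b y)) - (LBINT y. K (Complex a y))"
proof -
  define V where "V x n = (LBINT y:{- T n..T n}. K (Complex x y))" for x n
  define R where "R n = 2 * of_real pi * (\<Sum>p\<in>P n. residue K p)" for n
  have V: "V x \<longlonglongrightarrow> (LBINT y. K (Complex x y))" if "integrable lborel (\<lambda>y. K (Complex x y))" for x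
    unfolding V_def set_lebesgue_integral_def
  proof (rule integral_dominated_convergence[where w = "\<lambda>y. norm (K (Complex x y))"])
    show "AE y in lborel. (\<lambda>n. indicator {- T n..T n} y *\<^sub>R K (Complex x y)) \<longlonglongrightarrow> K (Complex x y)"
    proof (rule AE_I2, rule tendsto_eventually)
      fix y :: real
      have "eventually (\<lambda>n. T n \<ge> \<bar>y\<bar>) sequentially" using T by (simp add: filterlim_at_top)
      then show "eventually (\<lambda>n. indicator {- T n..T n} y *\<^sub>R K (Complex x y) = K (Complex x y)) sequentially"
        by eventually_elim (auto simp: indicator_def)
    qed
  qed (use that in \<open>auto simp: indicator_def\<close>)
  have est: "norm (V b n - V a n - R n) \<le> 2 * M n * (b - a)" for n
  proof -
    let ?T = "T n"
    define a1 a2 a3 a4 where "a1 = Complex a (- ?T)" and "a2 = Complex b (- ?T)"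
      and "a3 = Complex b ?T" and "a4 = Complex a ?T"
    note defs = a1_def a2_def a3_def a4_def
    let ?\<gamma> = "rectpath a1 a3"
    have \<gamma>: "?\<gamma> = linepath a1 a2 +++ linepath a2 a3 +++ linepath a3 a4 +++ linepath a4 a1"
      by (simp add: rectpath_def Let_def defs)
    have le: "Re a1 \<le> Re a3" "Im a1 \<le> Im a3" using ab T0[of n] by (simp_all add: defs)
    have im: "path_image ?\<gamma> \<subseteq> S n - P n"
    proof -
      have "path_image ?\<gamma> \<subseteq> cbox a1 a3 - box a1 a3"
        using path_image_rectpath_cbox_minus_box[OF le] by simp
      then show ?thesis using S(3)[of n] P(2)[of n] by (auto simp: defs)
    qed
    have cont: "continuous_on (path_image ?\<gamma>) K"
      using holomorphic_on_imp_continuous_on[OF holo] im by (rule continuous_on_subset)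
    have pim: "path_image ?\<gamma> = closed_segment a1 a2 \<union> closed_segment a2 a3 \<union> closed_segment a3 a4 \<union> closed_segment a4 a1"
      unfolding \<gamma> by (simp add: path_image_join Un_assoc)
    have ci: "K contour_integrable_on linepath u v" if "closed_segment u v \<subseteq> path_image ?\<gamma>" for u v
      using continuous_on_subset[OF cont that] by (rule contour_integrable_continuous_linepath)
    have c: "K contour_integrable_on linepath a1 a2" "K contour_integrable_on linepath a2 a3"
      "K contour_integrable_on linepath a3 a4" "K contour_integrable_on linepath a4 a1"
      by (rule ci, unfold pim, blast)+
    have "contour_integral ?\<gamma> K = 2 * pi * \<i> * (\<Sum>p\<in>P n. winding_number ?\<gamma> p * residue K p)"
    proof (rule Residue_theorem[OF S(1)[of n] _ P(1) holo _ _ im])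
      show "connected (S n)" using S(2) by (rule convex_connected)
      show "\<forall>z. z \<notin> S n \<longrightarrow> winding_number ?\<gamma> z = 0"
        using im by (intro allI impI winding_number_zero_outside[of _ "S n"] S) auto
    qed auto
    also have "(\<Sum>p\<in>P n. winding_number ?\<gamma> p * residue K p) = (\<Sum>p\<in>P n. residue K p)"
    proof (intro sum.cong refl)
      fix p assume "p \<in> P n"
      then have "winding_number ?\<gamma> p = 1"
        using P(2)[of n] by (intro winding_number_rectpath) (auto simp: defs)
      then show "winding_number ?\<gamma> p * residue K p = residue K p" by simp
    qed
    also have "2 * pi * \<i> * (\<Sum>p\<in>P n. residue K p) = \<i> * R n" by (simp add: R_def)
    finally have 1: "contour_integral ?\<gamma> K = \<i> * R n" .
    have 2: "contour_integral ?\<gamma> K = contour_integral (linepath a1 a2) K + contour_integral (linepath a2 a3) K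
        + contour_integral (linepath a3 a4) K + contour_integral (linepath a4 a1) K"
      unfolding \<gamma> using c by (simp add: contour_integrable_joinI)
    have vert: "contour_integral (linepath (Complex x (- ?T)) (Complex x ?T)) K = \<i> * V x n"
      if "closed_segment (Complex x (- ?T)) (Complex x ?T) \<subseteq> path_image ?\<gamma>" for x
    proof -
      have "continuous_on {- ?T..?T} (\<lambda>y. K (Complex x y))"
      proof (rule continuous_on_compose2[OF continuous_on_subset[OF cont that]])
        show "continuous_on {- ?T..?T} (Complex x)" by (simp add: Complex_eq continuous_intros)
        show "Complex x ` {- ?T..?T} \<subseteq> closed_segment (Complex x (- ?T)) (Complex x ?T)"
          using T0[of n] by (auto simp: closed_segment_same_Re closed_segment_eq_real_ivl)
      qed
      then have "set_integrable lborel {- ?T..?T} (\<lambda>y. K (Complex x y))"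
        by (rule borel_integrable_atLeastAtMost')
      then show ?thesis
        unfolding V_def using T0[of n]
        by (simp add: set_borel_integral_eq_integral contour_integral_linepath_same_Re)
    qed
    have v: "contour_integral (linepath a2 a3) K = \<i> * V b n"
      using vert[of b] pim by (auto simp: defs)
    have "contour_integral (linepath a1 a4) K = \<i> * V a n"
      using vert[of a] pim by (auto simp: defs closed_segment_commute)
    then have v': "contour_integral (linepath a4 a1) K = - (\<i> * V a n)"
      using contour_integral_reversepath[of "linepath a1 a4" K] by simp
    have M0: "M n \<ge> 0" using order.trans[OF norm_ge_zero bound(1)[of a n]] ab by simp
    have h: "norm (contour_integral (linepath a1 a2) K) \<le> M n * norm (a2 - a1)"
    proof (rule contour_integral_bound_linepath[OF c(1) M0])
      fix z assume "z \<in> closed_segment a1 a2"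
      then have "z = Complex (Re z) (- ?T)" "Re z \<in> {a..b}"
        using ab by (auto simp: defs closed_segment_same_Im closed_segment_eq_real_ivl complex_eq_iff)
      then show "norm (K z) \<le> M n" using bound(2)[of "Re z" n] by metis
    qed
    have h': "norm (contour_integral (linepath a3 a4) K) \<le> M n * norm (a4 - a3)"
    proof (rule contour_integral_bound_linepath[OF c(3) M0])
      fix z assume "z \<in> closed_segment a3 a4"
      then have "z = Complex (Re z) ?T" "Re z \<in> {a..b}"
        using ab by (auto simp: defs closed_segment_same_Im closed_segment_eq_real_ivl complex_eq_iff)
      then show "norm (K z) \<le> M n" using bound(1)[of "Re z" n] by metis
    qed
    have n: "norm (a2 - a1) = b - a" "norm (a4 - a3) = b - a"
      using ab by (simp_all add: defs cmod_def)
    have "\<i> * (V b n - V a n - R n) = - (contour_integral (linepath a1 a2) K + contour_integral (linepath a3 a4) K)"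
      using 1 2 v v' by (simp add: algebra_simps)
    then have "norm (V b n - V a n - R n) = norm (contour_integral (linepath a1 a2) K + contour_integral (linepath a3 a4) K)"
      by (metis norm_minus_cancel norm_mult norm_ii mult_1)
    also have "\<dots> \<le> M n * (b - a) + M n * (b - a)"
      using h h' unfolding n by (intro norm_triangle_le add_mono)
    finally show ?thesis by simp
  qed
  have "(\<lambda>n. V b n - V a n - R n) \<longlonglongrightarrow> 0"
  proof (rule Lim_null_comparison)
    show "(\<lambda>n. 2 * M n * (b - a)) \<longlonglongrightarrow> 0"
      using M by (intro tendsto_mult_left_zero tendsto_mult_right_zero)
  qed (use est in auto)
  moreover have "(\<lambda>n. V b n - V a n) \<longlonglongrightarrow> (LBINT y. K (Complex b y)) - (LBINT y. K (Complex a y))"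
    using V inta intb by (intro tendsto_diff) auto
  ultimately have "(\<lambda>n. (V b n - V a n) - (V b n - V a n - R n)) \<longlonglongrightarrow>
      ((LBINT y. K (Complex b y)) - (LBINT y. K (Complex a y))) - 0" by (rule tendsto_diff[rotated])
  then show ?thesis by (simp add: R_def)
qed

section \<open>Integrands of quadratic decay and the smoothed Perron kernel\<close>

lemma integrable_inverse_1_plus_square_real: "integrable lborel (\<lambda>y :: real. 1 / (1 + y\<^sup>2))"
proof -
  have 1: "set_integrable lborel {0..1} (\<lambda>y :: real. 1 / (1 + y\<^sup>2))"
    by (intro borel_integrable_atLeastAtMost' continuous_intros) (auto simp: add_nonneg_eq_0_iff)
  have 2: "set_integrable lborel {1..} (\<lambda>y :: real. 1 / (1 + y\<^sup>2))"
  proof (rule set_integrable_bound)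
    show "set_integrable lborel {1..} (\<lambda>y :: real. y powr (- 2))"
      by (intro set_integrable_powr_atLeast) auto
    show "AE y in lborel. y \<in> {1..} \<longrightarrow> norm (1 / (1 + y\<^sup>2)) \<le> norm (y powr (- 2) :: real)"
    proof (intro AE_I2 impI)
      fix y :: real assume "y \<in> {1..}"
      then have "y powr (- 2) = 1 / y\<^sup>2" by (simp add: powr_minus powr_numeral divide_inverse)
      moreover have "1 / (1 + y\<^sup>2) \<le> 1 / y\<^sup>2" using \<open>y \<in> {1..}\<close>
        by (intro divide_left_mono mult_pos_pos) (auto intro: add_pos_nonneg)
      ultimately show "norm (1 / (1 + y\<^sup>2)) \<le> norm (y powr (- 2))" by (simp add: abs_of_nonneg)
    qed
  qed (simp add: set_borel_measurable_def)
  have "set_integrable lborel ({0..1} \<union> {1..}) (\<lambda>y :: real. 1 / (1 + y\<^sup>2))"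
    using 1 2 by (rule set_integrable_Un) auto
  also have "{0..1} \<union> {1..} = {0 :: real..}" by auto
  finally have 3: "set_integrable lborel {0..} (\<lambda>y :: real. 1 / (1 + y\<^sup>2))" .
  then have "integrable lborel (\<lambda>y :: real. indicator {0..} (0 + (- 1) * y) *\<^sub>R (1 / (1 + (0 + (- 1) * y)\<^sup>2)))"
    unfolding set_integrable_def by (rule lborel_integrable_real_affine) simp
  then have "set_integrable lborel {..0} (\<lambda>y :: real. 1 / (1 + y\<^sup>2))"
    unfolding set_integrable_def
    by (rule Bochner_Integration.integrable_cong[THEN iffD1, rotated -1]) (auto simp: indicator_def)
  with 3 have "set_integrable lborel ({0..} \<union> {..0}) (\<lambda>y :: real. 1 / (1 + y\<^sup>2))"
    by (rule set_integrable_Un) auto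
  also have "{0..} \<union> {..0} = (UNIV :: real set)" by auto
  finally show ?thesis by (simp add: set_integrable_def)
qed

lemma continuous_on_Complex [continuous_intros]:
  "continuous_on A f \<Longrightarrow> continuous_on A g \<Longrightarrow> continuous_on A (\<lambda>x. Complex (f x) (g x))"
  unfolding Complex_eq by (intro continuous_intros)

lemma integrable_vertical_line:
  assumes c: "continuous_on UNIV (\<lambda>y. K (Complex a y))" and b: "\<And>y. norm (K (Complex a y)) \<le> C / (1 + y\<^sup>2)"
  shows "integrable lborel (\<lambda>y. K (Complex a y) :: complex)"
proof (rule Bochner_Integration.integrable_bound)
  show "integrable lborel (\<lambda>y :: real. C * (1 / (1 + y\<^sup>2)))"
    by (intro integrable_mult_right integrable_inverse_1_plus_square_real)
  show "(\<lambda>y. K (Complex a y)) \<in> borel_measurable lborel"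
    using borel_measurable_continuous_onI[OF c] by simp
  have "norm (K (Complex a y)) \<le> norm (C * (1 / (1 + y\<^sup>2)))" for y
    using order.trans[OF b[of y] abs_ge_self] by simp
  then show "AE y in lborel. norm (K (Complex a y)) \<le> norm (C * (1 / (1 + y\<^sup>2)))" by simp
qed

text \<open>For \<open>X \<le> 1\<close> the line of integration is moved to \<open>+\<infinity>\<close>, for \<open>X \<ge> 1\<close> to
  \<open>-\<infinity>\<close>, picking up the residues \<open>1\<close> at \<open>0\<close> and \<open>-1/X\<close> at \<open>-1\<close>.\<close>

definition perron_kernel :: "real \<Rightarrow> complex \<Rightarrow> complex" where
  "perron_kernel X z = of_real X powr z / (z * (z + 1))"

context
  fixes X :: real assumes X: "X > 0"
begin

text \<open>Both |z| and |z + 1| are at least delta times the square root of 1 + (Im z)^2, since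
  delta <= 1; their product gives the integrable quadratic decay.\<close>

lemma norm_perron_kernel_le:
  assumes "Re z > 0 \<or> Re z < - 1" "min (\<bar>Re z\<bar>) (\<bar>Re z + 1\<bar>) \<ge> \<delta>" "0 < \<delta>" "\<delta> \<le> 1"
  shows "norm (perron_kernel X z) \<le> (X powr Re z / \<delta>\<^sup>2) / (1 + (Im z)\<^sup>2)"
proof -
  have sq: "\<delta>\<^sup>2 * (1 + (Im z)\<^sup>2) \<le> (norm w)\<^sup>2" if "\<bar>Re w\<bar> \<ge> \<delta>" "Im w = Im z" for w
  proof -
    have "\<delta>\<^sup>2 \<le> (Re w)\<^sup>2" using that(1) assms(3) power_mono[of \<delta> "\<bar>Re w\<bar>" 2] by simp
    moreover have "\<delta>\<^sup>2 * (Im z)\<^sup>2 \<le> 1 * (Im z)\<^sup>2"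
      using assms(3,4) by (intro mult_right_mono power_le_one) auto
    ultimately show ?thesis using that(2) by (simp add: cmod_power2 distrib_left)
  qed
  have "(\<delta>\<^sup>2 * (1 + (Im z)\<^sup>2)) * (\<delta>\<^sup>2 * (1 + (Im z)\<^sup>2)) \<le> (norm z)\<^sup>2 * (norm (z + 1))\<^sup>2"
    using assms by (intro mult_mono sq) auto
  then have "(\<delta>\<^sup>2 * (1 + (Im z)\<^sup>2))\<^sup>2 \<le> (norm (z * (z + 1)))\<^sup>2"
    by (simp add: norm_mult power_mult_distrib power2_eq_square mult_ac)
  then have d: "\<delta>\<^sup>2 * (1 + (Im z)\<^sup>2) \<le> norm (z * (z + 1))" by (rule power2_le_imp_le) simp
  have pos: "0 < \<delta>\<^sup>2 * (1 + (Im z)\<^sup>2)" using assms(3) by (intro mult_pos_pos) (auto simp: add_pos_nonneg)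
  have "norm (perron_kernel X z) = X powr Re z / norm (z * (z + 1))"
    using X by (simp add: perron_kernel_def norm_divide norm_of_real_powr)
  also have "\<dots> \<le> X powr Re z / (\<delta>\<^sup>2 * (1 + (Im z)\<^sup>2))"
    using d pos by (intro frac_le) auto
  finally show ?thesis by (simp only: divide_divide_eq_left)
qed

lemma perron_kernel_holomorphic: "perron_kernel X holomorphic_on - {0, - 1}"
proof -
  have 1: "(\<lambda>z. of_real X powr z) holomorphic_on - {0, - 1}"
    using X by (intro holomorphic_intros) auto
  have 2: "z * (z + 1) \<noteq> 0" if "z \<in> - {0, - 1}" for z :: complex
    using that by (simp flip: eq_neg_iff_add_eq_0)
  show ?thesis unfolding perron_kernel_def [abs_def]
    by (rule holomorphic_on_divide[OF 1 _ 2]) (intro holomorphic_intros)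
qed

lemma perron_kernel_integrable:
  assumes "x > 0 \<or> x < - 1"
  shows "integrable lborel (\<lambda>y. perron_kernel X (Complex x y))"
proof -
  define \<delta> where "\<delta> = min 1 (min \<bar>x\<bar> \<bar>x + 1\<bar>)"
  have \<delta>: "0 < \<delta>" "\<delta> \<le> 1" "\<delta> \<le> min \<bar>x\<bar> \<bar>x + 1\<bar>" using assms by (auto simp: \<delta>_def)
  show ?thesis
  proof (rule integrable_vertical_line)
    show "continuous_on UNIV (\<lambda>y. perron_kernel X (Complex x y))"
      using assms by (intro continuous_on_compose2[OF holomorphic_on_imp_continuous_on[OF perron_kernel_holomorphic]] continuous_intros)
        (auto simp: complex_eq_iff)
    show "norm (perron_kernel X (Complex x y)) \<le> (X powr x / \<delta>\<^sup>2) / (1 + y\<^sup>2)" for y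
      using norm_perron_kernel_le[of "Complex x y" \<delta>] assms \<delta> by simp
  qed
qed

text \<open>Dominated convergence with majorant 1 / (1 + y^2) and the pointwise bound 1 / |s(n)|.
  Stating the divergence of s(n) through its reciprocal covers both directions.\<close>

lemma perron_kernel_line_limit:
  assumes s: "\<And>n. s n \<ge> 1 \<or> s n \<le> - 2" and l: "(\<lambda>n. 1 / s n) \<longlonglongrightarrow> 0"
    and X1: "\<And>n. X powr s n \<le> 1"
  shows "(\<lambda>n. LBINT y. perron_kernel X (Complex (s n) y)) \<longlonglongrightarrow> 0"
proof -
  have b: "norm (perron_kernel X (Complex (s n) y)) \<le> 1 / (1 + y\<^sup>2)" for n y
  proof -
    have "norm (perron_kernel X (Complex (s n) y)) \<le> (X powr s n / 1\<^sup>2) / (1 + y\<^sup>2)"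
      using norm_perron_kernel_le[of "Complex (s n) y" 1] s[of n] by auto
    also have "\<dots> \<le> 1 / (1 + y\<^sup>2)" using X1[of n] by (intro divide_right_mono) auto
    finally show ?thesis .
  qed
  have "(\<lambda>n. LBINT y. perron_kernel X (Complex (s n) y)) \<longlonglongrightarrow> (LBINT y :: real. 0)"
  proof (rule integral_dominated_convergence[where w = "\<lambda>y. 1 / (1 + y\<^sup>2)"])
    show "integrable lborel (\<lambda>y :: real. 1 / (1 + y\<^sup>2))" by (rule integrable_inverse_1_plus_square_real)
    show "(\<lambda>y. perron_kernel X (Complex (s n) y)) \<in> borel_measurable lborel" for n
      using perron_kernel_integrable[of "s n"] s[of n] by (intro borel_measurable_integrable) auto
    show "AE y in lborel. (\<lambda>n. perron_kernel X (Complex (s n) y)) \<longlonglongrightarrow> 0"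
    proof (rule AE_I2)
      fix y
      have "norm (perron_kernel X (Complex (s n) y)) \<le> norm (1 / s n)" for n
      proof -
        have n0: "Complex (s n) y + 1 \<noteq> 0" "s n \<noteq> 0" "Complex (s n) y \<noteq> 0"
          using s[of n] by (auto simp: complex_eq_iff)
        have "1 \<le> \<bar>Re (Complex (s n) y + 1)\<bar>" using s[of n] by auto
        then have "1 \<le> norm (Complex (s n) y + 1)" using abs_Re_le_cmod order.trans by blast
        moreover have "\<bar>s n\<bar> \<le> norm (Complex (s n) y)" using abs_Re_le_cmod[of "Complex (s n) y"] by simp
        ultimately have "\<bar>s n\<bar> * 1 \<le> norm (Complex (s n) y) * norm (Complex (s n) y + 1)"
          by (intro mult_mono) auto
        then have "X powr s n / (norm (Complex (s n) y) * norm (Complex (s n) y + 1)) \<le> 1 / (\<bar>s n\<bar> * 1)"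
          using X1[of n] n0 by (intro frac_le) auto
        then show ?thesis using X
          by (simp add: perron_kernel_def norm_divide norm_mult norm_of_real_powr)
      qed
      then show "(\<lambda>n. perron_kernel X (Complex (s n) y)) \<longlonglongrightarrow> 0"
        by (intro Lim_null_comparison[OF _ tendsto_norm_zero[OF l]] always_eventually allI)
    qed
    show "AE y in lborel. norm (perron_kernel X (Complex (s n) y)) \<le> 1 / (1 + y\<^sup>2)" for n
      using b by simp
  qed simp
  then show ?thesis by simp
qed

text \<open>The region \<open>S\<close> is left open so that a shift to the right can be made inside
  the half-plane Re z > 0, where no pole occurs, and a shift to the left in the whole plane, where
  both are collected.\<close>

lemma perron_kernel_shift:
  assumes ab: "a < b" and a: "a > 0 \<or> a < - 1" and b: "b > 0 \<or> b < - 1"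
    and S: "open S" "convex S" "{z. a \<le> Re z \<and> Re z \<le> b} \<subseteq> S" and P: "P = S \<inter> {0, - 1}"
      "P \<subseteq> {z. a < Re z \<and> Re z < b}"
  shows "(LBINT y. perron_kernel X (Complex b y)) - (LBINT y. perron_kernel X (Complex a y))
    = 2 * of_real pi * (\<Sum>p\<in>P. residue (perron_kernel X) p)"
proof -
  have fin: "finite P" using P(1) by simp
  define B where "B = X powr a + X powr b"
  have "(\<lambda>n :: nat. 2 * of_real pi * (\<Sum>p\<in>P. residue (perron_kernel X) p)) \<longlonglongrightarrow>
      (LBINT y. perron_kernel X (Complex b y)) - (LBINT y. perron_kernel X (Complex a y))"
  proof (rule vertical_line_shift[where T = "\<lambda>n. real n + 1" and S = "\<lambda>_. S" and P = "\<lambda>_. P"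
        and M = "\<lambda>n. B / (real n + 1)\<^sup>2"])
    show "filterlim (\<lambda>n. real n + 1) at_top sequentially"
      by real_asymp
    show "cbox (Complex a (- (real n + 1))) (Complex b (real n + 1)) \<subseteq> S" for n
      using S(3) by (auto simp: in_cbox_complex_iff)
    show "P \<subseteq> box (Complex a (- (real n + 1))) (Complex b (real n + 1))" for n
      using P by (auto simp: in_box_complex_iff)
    show "perron_kernel X holomorphic_on S - P" for n
      by (rule holomorphic_on_subset[OF perron_kernel_holomorphic]) (use P in auto)
    have bd: "norm (perron_kernel X (Complex x y)) \<le> B / (real n + 1)\<^sup>2"
      if x: "x \<in> {a..b}" and y: "\<bar>y\<bar> = real n + 1" for x y n
    proof -
      have "real n + 1 \<le> norm (Complex x y)" "real n + 1 \<le> norm (Complex x y + 1)"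
        using abs_Im_le_cmod[of "Complex x y"] abs_Im_le_cmod[of "Complex x y + 1"] y by simp_all
      then have "(real n + 1) * (real n + 1) \<le> norm (Complex x y) * norm (Complex x y + 1)"
        by (intro mult_mono) auto
      moreover have "X powr x \<le> B" unfolding B_def using x X by (intro powr_le_add_powr) auto
      moreover have "B \<ge> 0" by (simp add: B_def)
      moreover have "0 < (real n + 1) * (real n + 1)" by simp
      ultimately have "X powr x / (norm (Complex x y) * norm (Complex x y + 1)) \<le> B / ((real n + 1) * (real n + 1))"
        by (intro frac_le) auto
      then show ?thesis using X
        by (simp add: perron_kernel_def norm_divide norm_mult norm_of_real_powr power2_eq_square)
    qed
    show "norm (perron_kernel X (Complex x (real n + 1))) \<le> B / (real n + 1)\<^sup>2"
      "norm (perron_kernel X (Complex x (- (real n + 1)))) \<le> B / (real n + 1)\<^sup>2"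
      if "x \<in> {a..b}" for x n using that by (auto intro!: bd)
    show "(\<lambda>n. B / (real n + 1)\<^sup>2) \<longlonglongrightarrow> 0" by real_asymp
  qed (use ab a b fin S in \<open>auto intro: perron_kernel_integrable\<close>)
  then show ?thesis using LIMSEQ_unique tendsto_const by blast
qed

lemma residue_perron_kernel:
  "residue (perron_kernel X) 0 = 1" "residue (perron_kernel X) (- 1) = - of_real (1 / X)"
proof -
  have h: "(\<lambda>w. complex_of_real X powr w / (w + 1)) holomorphic_on - {- 1}"
    "(\<lambda>w. complex_of_real X powr w / w) holomorphic_on - {0}"
  proof -
    have p: "(\<lambda>z. of_real X powr z) holomorphic_on A" for A
      using X by (intro holomorphic_intros) auto
    show "(\<lambda>w. complex_of_real X powr w / (w + 1)) holomorphic_on - {- 1}"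
      by (intro holomorphic_on_divide p holomorphic_intros) (simp flip: eq_neg_iff_add_eq_0)
    show "(\<lambda>w. complex_of_real X powr w / w) holomorphic_on - {0}"
      by (intro holomorphic_on_divide p holomorphic_intros) simp
  qed
  have "residue (\<lambda>w. (complex_of_real X powr w / (w + 1)) / (w - 0)) 0 = of_real X powr 0 / (0 + 1)"
    by (rule residue_simple[OF _ _ h(1)]) auto
  then show "residue (perron_kernel X) 0 = 1"
    using X by (simp add: perron_kernel_def [abs_def] mult.commute)
  have "residue (\<lambda>w. (complex_of_real X powr w / w) / (w - - 1)) (- 1) = of_real X powr (- 1) / (- 1)"
    by (rule residue_simple[OF _ _ h(2)]) auto
  then show "residue (perron_kernel X) (- 1) = - of_real (1 / X)"
    using X by (simp add: perron_kernel_def [abs_def] powr_minus divide_inverse mult.assoc)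
qed

text \<open>The extra factor z + 1 smooths the jump of Perron's formula. At X = u / y the value is
  proportional to the positive part of (u - y) / u, which is up to the factor u the kernel of
  Taylor's remainder of order two.\<close>

theorem perron_kernel_integral:
  assumes \<sigma>: "\<sigma> > 0"
  shows "(LBINT y. perron_kernel X (Complex \<sigma> y)) = of_real (2 * pi * max 0 (1 - 1 / X))"
proof (cases "X \<ge> 1")
  case False
  define s where "s n = \<sigma> + 1 + real n" for n
  have "(\<lambda>n. LBINT y. perron_kernel X (Complex (s n) y)) \<longlonglongrightarrow> 0"
  proof (rule perron_kernel_line_limit)
    show "(\<lambda>n. 1 / s n) \<longlonglongrightarrow> 0" unfolding s_def by real_asymp
    show "X powr s n \<le> 1" for n
      using False X \<sigma> by (intro powr_le1) (auto simp: s_def)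
  qed (use \<sigma> in \<open>auto simp: s_def\<close>)
  moreover have "(LBINT y. perron_kernel X (Complex (s n) y)) = (LBINT y. perron_kernel X (Complex \<sigma> y))" for n
    using perron_kernel_shift[of \<sigma> "s n" "{z. Re z > 0}" "{}"] \<sigma>
    by (auto simp: s_def open_halfspace_Re_gt convex_halfspace_Re_gt subset_iff)
  ultimately have "(LBINT y. perron_kernel X (Complex \<sigma> y)) = 0"
    by (simp add: LIMSEQ_const_iff)
  moreover have "max 0 (1 - 1 / X) = 0" using False X by (simp add: max_def field_simps)
  ultimately show ?thesis by simp
next
  case True
  define s where "s n = - 2 - real n" for n
  have "(\<lambda>n. LBINT y. perron_kernel X (Complex (s n) y)) \<longlonglongrightarrow> 0"
  proof (rule perron_kernel_line_limit)
    show "(\<lambda>n. 1 / s n) \<longlonglongrightarrow> 0" unfolding s_def by real_asymp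
    show "X powr s n \<le> 1" for n
      using True X powr_mono[of "s n" 0 X] by (auto simp: s_def)
  qed (auto simp: s_def)
  moreover have "(LBINT y. perron_kernel X (Complex (s n) y)) =
      (LBINT y. perron_kernel X (Complex \<sigma> y)) - of_real (2 * pi * (1 - 1 / X))" for n
    using perron_kernel_shift[of "s n" \<sigma> UNIV "{0, - 1}"] \<sigma>
    by (auto simp: s_def residue_perron_kernel algebra_simps)
  ultimately have "(LBINT y. perron_kernel X (Complex \<sigma> y)) - of_real (2 * pi * (1 - 1 / X)) = 0"
    by (simp add: LIMSEQ_const_iff)
  moreover have "max 0 (1 - 1 / X) = 1 - 1 / X" using True by (simp add: max_def field_simps)
  ultimately show ?thesis by simp
qed

end

section \<open>Mellin inversion\<close>

lemma complex_of_real_divide_powr: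
  assumes "u > 0" "y > 0"
  shows "complex_of_real (u / y) powr z = of_real u powr z * of_real y powr (- z)"
  using assms by (simp add: powr_def Ln_of_real ln_div exp_add [symmetric] algebra_simps del: of_real_divide)

lemma integrable_product_real:
  fixes a b :: "real \<Rightarrow> real"
  assumes "integrable lborel a" "integrable lborel b"
  shows "integrable (lborel \<Otimes>\<^sub>M lborel) (\<lambda>(u, v). a u * b v)"
proof (rule lborel_pair.Fubini_integrable)
  show "(\<lambda>(u, v). a u * b v) \<in> borel_measurable (lborel \<Otimes>\<^sub>M lborel)"
    using assms[THEN borel_measurable_integrable] by measurable
  show "integrable lborel (\<lambda>u. LBINT v. norm (case (u, v) of (u, v) \<Rightarrow> a u * b v))"
    using assms by (simp add: abs_mult)
  show "AE u in lborel. integrable lborel (\<lambda>v. case (u, v) of (u, v) \<Rightarrow> a u * b v)"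
    using assms by simp
qed

context decreasing_derivatives
begin

lemma continuous_on_f: "continuous_on {0..} (f n)"
  using decr[of n] unfolding rapidly_decreasing_def by blast

text \<open>Taylor's formula of order two expanded at infinity, where f and u f' tend to 0, so that
  only the remainder integral survives. The function \<open>F\<close> is the antiderivative found by
  integrating by parts.\<close>

lemma taylor_integral:
  assumes y: "y > 0"
  shows "(LBINT u:{y<..}. of_real (u - y) * f 2 u) = f 0 y"
proof -
  define F where "F u = - (of_real (u - y) * f 1 u) - f 0 u" for u
  have d1: "(f 0 has_vector_derivative - f 1 u) (at u)" "(f 1 has_vector_derivative - f 2 u) (at u)"
    if "u > 0" for u using deriv[OF that, of 0] deriv[OF that, of 1] by (simp_all add: numeral_2_eq_2)
  have i: "set_integrable lborel {y<..} (\<lambda>u. of_real (u - y) * f 2 u)"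
  proof (rule set_integrable_bound)
    have "set_integrable lborel {0<..} (\<lambda>u. complex_of_real u powr (2 - 1) * f 2 u)"
      using rapidly_decreasing_mellin_integrable[OF decr, of 2 2] by (simp add: mellin_integrable_def)
    then show "set_integrable lborel {y<..} (\<lambda>u. complex_of_real u powr (2 - 1) * f 2 u)"
      by (rule set_integrable_subset) (use y in auto)
    have "(\<lambda>u. indicator {y<..} u *\<^sub>R (of_real (u - y) * f 2 u)) \<in> borel_measurable borel"
      by (intro borel_measurable_continuous_on_indicator continuous_intros continuous_on_subset[OF continuous_on_f])
        (use y in auto)
    then show "set_borel_measurable lborel {y<..} (\<lambda>u. of_real (u - y) * f 2 u)"
      by (simp add: set_borel_measurable_def)
    have "norm (of_real (u - y) * f 2 u) \<le> norm (complex_of_real u powr (2 - 1) * f 2 u)" if "u > y" for u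
      using that y by (auto simp: norm_mult intro!: mult_right_mono simp flip: of_real_diff)
    then show "AE u in lborel. u \<in> {y<..} \<longrightarrow> norm (of_real (u - y) * f 2 u) \<le> norm (complex_of_real u powr (2 - 1) * f 2 u)"
      by (intro AE_I2) auto
  qed
  have "(LBINT u=y..\<infinity>. of_real (u - y) * f 2 u) = 0 - (- f 0 y)"
  proof (rule interval_integral_FTC_integrable[where F = F])
    fix u :: real assume "ereal y < ereal u"
    then have u: "u > y" "u > 0" using y by auto
    have "((\<lambda>u. complex_of_real (u - y)) has_vector_derivative 1) (at u)"
      by (auto intro!: derivative_eq_intros has_vector_derivative_of_real simp: has_real_derivative_iff_has_vector_derivative[symmetric])
    then have "(F has_vector_derivative - (of_real (u - y) * (- f 2 u) + 1 * f 1 u) - (- f 1 u)) (at u)"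
      unfolding F_def
      by (intro has_vector_derivative_diff has_vector_derivative_minus has_vector_derivative_mult d1 u)
    then show "(F has_vector_derivative of_real (u - y) * f 2 u) (at u)" by simp
    have "continuous_on {0<..} (f 2)" by (rule continuous_on_subset[OF continuous_on_f]) auto
    then have "isCont (f 2) u" using u by (simp add: continuous_on_eq_continuous_at)
    then show "isCont (\<lambda>u. of_real (u - y) * f 2 u) u" by (intro continuous_intros) auto
  next
    have "einterval y \<infinity> = {y<..}" by (auto simp: einterval_def)
    then show "set_integrable lborel (einterval y \<infinity>) (\<lambda>u. of_real (u - y) * f 2 u)" using i by simp
  next
    have "continuous_on {0<..} F" unfolding F_def
      by (intro continuous_intros continuous_on_subset[OF continuous_on_f]) auto
    then have "isCont F y" using y by (simp add: continuous_on_eq_continuous_at)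
    then have "(F \<longlongrightarrow> F y) (at_right y)" by (simp add: isCont_def filterlim_at_split)
    then show "((F \<circ> real_of_ereal) \<longlongrightarrow> - f 0 y) (at_right (ereal y))"
      by (simp add: ereal_tendsto_simps F_def)
  next
    obtain B0 where B0: "\<And>u. u > 0 \<Longrightarrow> u powr 1 * norm (f 0 u) \<le> B0"
      using rapidly_decreasing_powr_bound[OF decr, of 1 0] by auto
    obtain B1 where B1: "\<And>u. u > 0 \<Longrightarrow> u powr 2 * norm (f 1 u) \<le> B1"
      using rapidly_decreasing_powr_bound[OF decr, of 2 1] by auto
    have "(F \<longlongrightarrow> 0) at_top"
    proof (rule Lim_null_comparison)
      show "\<forall>\<^sub>F u in at_top. norm (F u) \<le> (B1 + B0) / u"
        using eventually_gt_at_top[of y]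
      proof eventually_elim
        case (elim u)
        then have u: "u > 0" using y by simp
        have "norm (F u) \<le> norm (of_real (u - y) * f 1 u) + norm (f 0 u)"
          unfolding F_def using norm_triangle_ineq4[of "- (of_real (u - y) * f 1 u)" "f 0 u"] by simp
        also have "norm (of_real (u - y) * f 1 u) \<le> u * norm (f 1 u)"
          unfolding norm_mult norm_of_real using elim y by (intro mult_right_mono) auto
        also have "u * norm (f 1 u) \<le> B1 / u"
          using B1[OF u] u by (simp add: field_simps powr_numeral power2_eq_square)
        also have "norm (f 0 u) \<le> B0 / u" using B0[OF u] u by (simp add: field_simps)
        finally show ?case by (simp add: add_divide_distrib)
      qed
      show "((\<lambda>u. (B1 + B0) / u) \<longlongrightarrow> 0) at_top"
        by (rule tendsto_divide_0[OF tendsto_const filterlim_at_top_imp_at_infinity[OF filterlim_ident]])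
    qed
    then show "((F \<circ> real_of_ereal) \<longlongrightarrow> 0) (at_left \<infinity>)" by (simp add: ereal_tendsto_simps)
  qed auto
  then show ?thesis by (simp add: interval_integral_to_infinity_eq)
qed

text \<open>Two integrations by parts divide the transform by z (z + 1), after which the double
  integral over u and v converges absolutely. By Fubini the integral over the line is evaluated
  first, by the Perron kernel, and what remains is Taylor's formula.\<close>

theorem mellin_inversion:
  assumes y: "y > 0" and \<sigma>: "\<sigma> > 0"
  shows "integrable lborel (\<lambda>v. mellin (f 0) (Complex \<sigma> v) * of_real y powr (- Complex \<sigma> v))"
    and "(LBINT v. mellin (f 0) (Complex \<sigma> v) * of_real y powr (- Complex \<sigma> v)) = 2 * of_real pi * f 0 y"
proof -
  define g where "g u = indicator {0<..} u *\<^sub>R f 2 u" for u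
  have gm [measurable]: "g \<in> borel_measurable borel"
    using rapidly_decreasing_measurable[OF decr, of 2] by (simp add: g_def [abs_def] set_borel_measurable_def)
  \<comment> \<open>The integrand u^(z+1) f''(u) y^(-z) / (z (z + 1)), with one factor u split off
    so that u and y enter the power only through u / y.\<close>
  define Q where "Q u v = of_real u * g u * perron_kernel (u / y) (Complex \<sigma> v)" for u v
  define \<delta> where "\<delta> = min 1 \<sigma>"
  have \<delta>: "0 < \<delta>" "\<delta> \<le> 1" "\<delta> \<le> \<sigma>" using \<sigma> by (auto simp: \<delta>_def)
  define a where "a u = norm (g u) * u powr (\<sigma> + 1) * (y powr (- \<sigma>) / \<delta>\<^sup>2)" for u
  define b where "b v = 1 / (1 + v\<^sup>2)" for v :: real
  have ai: "integrable lborel a"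
  proof -
    have "mellin_integrable (f 2) (of_real (\<sigma> + 2))"
      using \<sigma> by (intro rapidly_decreasing_mellin_integrable decr) simp
    then have "set_integrable lborel {0<..} (\<lambda>u. u powr (\<sigma> + 1) * norm (f 2 u))"
      using mellin_integrable_norm_iff[OF rapidly_decreasing_measurable[OF decr]]
      by (simp add: add.commute)
    then have "integrable lborel (\<lambda>u. indicator {0<..} u *\<^sub>R (u powr (\<sigma> + 1) * norm (f 2 u)) * (y powr (- \<sigma>) / \<delta>\<^sup>2))"
      unfolding set_integrable_def by (rule integrable_mult_left)
    also have "(\<lambda>u. indicator {0<..} u *\<^sub>R (u powr (\<sigma> + 1) * norm (f 2 u)) * (y powr (- \<sigma>) / \<delta>\<^sup>2)) = a"
      by (auto simp: a_def g_def fun_eq_iff indicator_def)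
    finally show ?thesis .
  qed
  have bi: "integrable lborel b" unfolding b_def by (rule integrable_inverse_1_plus_square_real)
  have Qm: "case_prod Q \<in> borel_measurable (lborel \<Otimes>\<^sub>M lborel)"
    unfolding Q_def perron_kernel_def powr_def Complex_eq by measurable
  have Qb: "norm (Q u v) \<le> a u * b v" for u v
  proof (cases "u > 0")
    case True
    have "norm (perron_kernel (u / y) (Complex \<sigma> v)) \<le> ((u / y) powr \<sigma> / \<delta>\<^sup>2) / (1 + v\<^sup>2)"
      using norm_perron_kernel_le[of "u / y" "Complex \<sigma> v" \<delta>] True y \<sigma> \<delta> by auto
    then have "norm (Q u v) \<le> u * norm (g u) * (((u / y) powr \<sigma> / \<delta>\<^sup>2) / (1 + v\<^sup>2))"
      using True unfolding Q_def norm_mult by (intro mult_mono) auto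
    also have "\<dots> = a u * b v"
    proof -
      have "(u / y) powr \<sigma> = u powr \<sigma> * y powr (- \<sigma>)" "u powr (\<sigma> + 1) = u powr \<sigma> * u"
        using True y by (simp_all add: powr_divide powr_add powr_minus_divide)
      then show ?thesis unfolding a_def b_def by simp
    qed
    finally show ?thesis .
  qed (simp add: Q_def a_def g_def)
  have Qi: "integrable (lborel \<Otimes>\<^sub>M lborel) (case_prod Q)"
  proof (rule Bochner_Integration.integrable_bound[OF integrable_product_real[OF ai bi] Qm])
    show "AE x in lborel \<Otimes>\<^sub>M lborel. norm (case x of (u, v) \<Rightarrow> Q u v) \<le> norm (case x of (u, v) \<Rightarrow> a u * b v)"
      using order.trans[OF Qb abs_ge_self] by (intro AE_I2) (auto simp: case_prod_beta')
  qed
  have inner: "(LBINT u. Q u v) = mellin (f 0) (Complex \<sigma> v) * of_real y powr (- Complex \<sigma> v)" for v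
  proof -
    let ?z = "Complex \<sigma> v"
    have z0: "?z \<noteq> 0" "?z + 1 \<noteq> 0" using \<sigma> by (auto simp: complex_eq_iff)
    have "Q u v = indicator {0<..} u *\<^sub>R (of_real u powr ((?z + 2) - 1) * f 2 u) * (of_real y powr (- ?z) / (?z * (?z + 1)))" for u
    proof (cases "u > 0")
      case True
      have "complex_of_real u powr ((?z + 2) - 1) = of_real u powr (?z + 1)" by (simp add: add.commute)
      also have "\<dots> = of_real u powr ?z * of_real u" using True by (simp add: powr_add)
      finally show ?thesis using True y
        by (simp only: Q_def g_def perron_kernel_def complex_of_real_divide_powr[OF True y]) simp
    qed (simp add: Q_def g_def)
    then have "(LBINT u. Q u v) = mellin (f 2) (?z + 2) * (of_real y powr (- ?z) / (?z * (?z + 1)))"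
      unfolding mellin_def set_lebesgue_integral_def by (simp only: integral_mult_left_zero)
    moreover have "mellin (f 0) ?z = mellin (f 2) (?z + 2) / (?z * (?z + 1))"
      using mellin_pochhammer[of ?z 0 2] \<sigma> by (simp add: pochhammer_Suc numeral_2_eq_2)
    ultimately show ?thesis by simp
  qed
  show "integrable lborel (\<lambda>v. mellin (f 0) (Complex \<sigma> v) * of_real y powr (- Complex \<sigma> v))"
    using lborel_pair.integrable_snd[OF Qi] unfolding inner .
  have "(LBINT v. LBINT u. Q u v) = (LBINT u. LBINT v. Q u v)"
    by (rule lborel_pair.Fubini_integral[OF Qi])
  also have "\<dots> = (LBINT u. 2 * of_real pi * (indicator {y<..} u *\<^sub>R (of_real (u - y) * f 2 u)))"
  proof (rule Bochner_Integration.integral_cong[OF refl])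
    fix u :: real
    show "(LBINT v. Q u v) = 2 * of_real pi * (indicator {y<..} u *\<^sub>R (of_real (u - y) * f 2 u))"
    proof (cases "u > 0")
      case True
      have "(LBINT v. Q u v) = of_real u * g u * (LBINT v. perron_kernel (u / y) (Complex \<sigma> v))"
        unfolding Q_def by (rule integral_mult_right_zero)
      also have "(LBINT v. perron_kernel (u / y) (Complex \<sigma> v)) = of_real (2 * pi * max 0 (1 - 1 / (u / y)))"
        using True y \<sigma> by (intro perron_kernel_integral) auto
      also have "1 - 1 / (u / y) = (u - y) / u" using True y by (simp add: field_simps)
      also have "of_real u * g u * of_real (2 * pi * max 0 ((u - y) / u))
          = 2 * of_real pi * (indicator {y<..} u *\<^sub>R (of_real (u - y) * f 2 u))"
      proof (cases "u > y")
        case g: True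
        then have "max 0 ((u - y) / u) = (u - y) / u" using True by simp
        then show ?thesis using g True by (simp add: g_def)
      next
        case False
        then have "(u - y) / u \<le> 0" using True by (simp add: divide_le_0_iff)
        then have "max 0 ((u - y) / u) = 0" by simp
        then show ?thesis using False by simp
      qed
      finally show ?thesis .
    qed (use y in \<open>simp add: Q_def g_def\<close>)
  qed
  also have "\<dots> = 2 * of_real pi * (LBINT u:{y<..}. of_real (u - y) * f 2 u)"
    unfolding set_lebesgue_integral_def by (rule integral_mult_right_zero)
  also have "\<dots> = 2 * of_real pi * f 0 y" by (simp only: taylor_integral[OF y])
  finally show "(LBINT v. mellin (f 0) (Complex \<sigma> v) * of_real y powr (- Complex \<sigma> v)) = 2 * of_real pi * f 0 y"
    unfolding inner .
qed

end

section \<open>The theta function\<close>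

text \<open>After rescaling y by c the Gaussian along the line is a standard normal density times an
  oscillation, and its integral is the characteristic function of the normal distribution.
  Completing the square shows that the value does not depend on the abscissa a.\<close>

lemma gauss_vertical_line:
  fixes a k x :: real
  assumes x: "x > 0"
  defines "h \<equiv> \<lambda>y. exp (of_real (pi * x) * (Complex a y)\<^sup>2 - of_real (2 * pi * k) * Complex a y)"
  shows "integrable lborel h" and "(LBINT y. h y) = of_real (exp (- pi * k\<^sup>2 / x) / sqrt x)"
proof -
  define c where "c = sqrt (2 * pi * x)"
  have c: "c > 0" "c\<^sup>2 = 2 * pi * x" using x by (simp_all add: c_def)
  \<comment> \<open>The frequency for which t c y is the phase 2 pi (x a - k) y of the exponential
    along the line.\<close>
  define t where "t = 2 * pi * (x * a - k) / c"
  define A where "A = exp (pi * x * a\<^sup>2 - 2 * pi * k * a)"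
  define G where "G w = std_normal_density w *\<^sub>R iexp (t * w)" for w
  have Gi: "integrable lborel G"
  proof (rule Bochner_Integration.integrable_bound)
    show "integrable lborel std_normal_density" by (rule integrable_normal_density) simp
    show "G \<in> borel_measurable lborel" unfolding G_def by measurable
  qed (simp add: G_def)
  have "(LBINT w. G w) = char std_normal_distribution t"
    unfolding char_def G_def by (subst integral_density) auto
  also have "\<dots> = of_real (exp (- (t\<^sup>2) / 2))" by (simp add: char_std_normal_distribution)
  finally have GI: "(LBINT w. G w) = of_real (exp (- (t\<^sup>2) / 2))" .
  have h: "h y = of_real (A * sqrt (2 * pi)) * G (0 + c * y)" for y
  proof -
    have "of_real (pi * x) * (Complex a y)\<^sup>2 - of_real (2 * pi * k) * Complex a y
        = of_real (pi * x * a\<^sup>2 - 2 * pi * k * a) + of_real (- (pi * x * y\<^sup>2)) + \<i> * of_real (2 * pi * (x * a - k) * y)"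
      by (simp add: complex_eq_iff power2_eq_square algebra_simps)
    moreover have "2 * pi * (x * a - k) * y = t * (c * y)" using c by (simp add: t_def)
    ultimately have "h y = of_real A * of_real (exp (- (pi * x * y\<^sup>2))) * iexp (t * (c * y))"
      by (simp only: h_def A_def exp_add exp_of_real)
    moreover have "std_normal_density (c * y) = exp (- (pi * x * y\<^sup>2)) / sqrt (2 * pi)"
      using c(2) by (simp add: std_normal_density_def power_mult_distrib)
    ultimately show ?thesis by (simp add: G_def scaleR_conv_of_real)
  qed
  have "integrable lborel (\<lambda>y. G (0 + c * y))" using Gi c by (intro lborel_integrable_real_affine) auto
  then show "integrable lborel h" unfolding h [abs_def] by (rule integrable_mult_right)
  have "(LBINT w. G w) = \<bar>c\<bar> *\<^sub>R (LBINT y. G (0 + c * y))"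
    using c by (intro lborel_integral_real_affine) auto
  then have "(LBINT y. G (0 + c * y)) = of_real (exp (- (t\<^sup>2) / 2) / c)"
    using c by (simp add: GI scaleR_conv_of_real field_simps)
  then have "(LBINT y. h y) = of_real (A * sqrt (2 * pi) * (exp (- (t\<^sup>2) / 2) / c))"
    unfolding h by (simp only: integral_mult_right_zero of_real_mult)
  also have "A * sqrt (2 * pi) * (exp (- (t\<^sup>2) / 2) / c) = (A * exp (- (t\<^sup>2) / 2)) * (sqrt (2 * pi) / c)" by simp
  also have "sqrt (2 * pi) / c = 1 / sqrt x" using x by (simp add: c_def real_sqrt_mult)
  also have "A * exp (- (t\<^sup>2) / 2) = exp (- pi * k\<^sup>2 / x)"
  proof -
    have "t\<^sup>2 = (2 * pi * (x * a - k))\<^sup>2 / (2 * pi * x)" by (simp only: t_def power_divide c)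
    also have "\<dots> = 2 * pi * (x * a - k)\<^sup>2 / x"
      using x by (simp add: power_mult_distrib power2_eq_square field_simps)
    finally have "pi * x * a\<^sup>2 - 2 * pi * k * a + - (t\<^sup>2) / 2 = - pi * k\<^sup>2 / x"
      using x by (simp add: power2_eq_square field_simps)
    then show ?thesis by (simp add: A_def exp_add [symmetric])
  qed
  finally show "(LBINT y. h y) = of_real (exp (- pi * k\<^sup>2 / x) / sqrt x)" by simp
qed

text \<open>The modulus of the k-th term is exp (-2 pi a c(k)) times a Gaussian independent of k, so
  summability of these factors justifies integrating term by term.\<close>

lemma gauss_vertical_line_series:
  fixes a x :: real and c :: "nat \<Rightarrow> real"
  assumes x: "x > 0" and c: "summable (\<lambda>k. exp (- 2 * pi * a * c k))"
  defines "h \<equiv> \<lambda>k y. exp (of_real (pi * x) * (Complex a y)\<^sup>2 - of_real (2 * pi * c k) * Complex a y)"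
  shows "integrable lborel (\<lambda>y. \<Sum>k. h k y)"
    and "(\<lambda>k. of_real (exp (- pi * (c k)\<^sup>2 / x) / sqrt x)) sums (LBINT y. \<Sum>k. h k y)"
proof -
  have i: "integrable lborel (h k)" for k unfolding h_def by (rule gauss_vertical_line(1)[OF x])
  define g where "g y = norm (exp (of_real (pi * x) * (Complex a y)\<^sup>2 - of_real (2 * pi * 0) * Complex a y))" for y
  have gi: "integrable lborel g" unfolding g_def by (intro integrable_norm gauss_vertical_line(1)[OF x])
  have n: "norm (h k y) = exp (- 2 * pi * a * c k) * g y" for k y
  proof -
    have "h k y = exp (of_real (pi * x) * (Complex a y)\<^sup>2 - of_real (2 * pi * 0) * Complex a y) * exp (- of_real (2 * pi * c k) * Complex a y)"
      unfolding h_def exp_add [symmetric] by simp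
    then show ?thesis by (simp add: norm_mult g_def mult_ac)
  qed
  have s: "AE y in lborel. summable (\<lambda>k. norm (h k y))" "summable (\<lambda>k. LBINT y. norm (h k y))"
    unfolding n using c by (auto intro!: summable_mult2)
  show "integrable lborel (\<lambda>y. \<Sum>k. h k y)" by (rule integrable_suminf[OF i s])
  have "(\<lambda>k. LBINT y. h k y) sums (LBINT y. \<Sum>k. h k y)" by (rule sums_integral[OF i s])
  then show "(\<lambda>k. of_real (exp (- pi * (c k)\<^sup>2 / x) / sqrt x)) sums (LBINT y. \<Sum>k. h k y)"
    unfolding h_def gauss_vertical_line(2)[OF x] .
qed

section \<open>Jacobi's theta function and its transformation\<close>

definition jacobi_theta :: "real \<Rightarrow> real" where
  "jacobi_theta x = (\<Sum>\<^sub>\<infinity>k::int. exp (- pi * x * (real_of_int k)\<^sup>2))"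

lemma summable_gauss:
  assumes "x > 0"
  shows "summable (\<lambda>n. exp (- pi * x * (real n)\<^sup>2))"
proof (rule summable_comparison_test')
  show "summable (\<lambda>n. exp (- pi * x) ^ n)" using assms by (intro summable_geometric) simp
  show "norm (exp (- pi * x * (real n)\<^sup>2)) \<le> exp (- pi * x) ^ n" if "n \<ge> 0" for n
  proof -
    have "real n \<le> (real n)\<^sup>2" using self_le_power[of "real n" 2] by (cases "n = 0") auto
    then have "pi * x * real n \<le> pi * x * (real n)\<^sup>2" using assms by (intro mult_left_mono) auto
    then show ?thesis by (simp add: exp_of_nat_mult [symmetric] mult_ac)
  qed
qed

text \<open>The split into nonnegative and negative integers is the one produced by the two vertical
  lines in the Poisson summation below.\<close>

lemma jacobi_theta_has_sum:
  assumes x: "x > 0"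
  shows "((\<lambda>k::int. exp (- pi * x * (real_of_int k)\<^sup>2)) has_sum jacobi_theta x) UNIV"
    and "jacobi_theta x = (\<Sum>n. exp (- pi * x * (real n)\<^sup>2)) + (\<Sum>n. exp (- pi * x * (real (Suc n))\<^sup>2))"
proof -
  let ?e = "\<lambda>k::int. exp (- pi * x * (real_of_int k)\<^sup>2)"
  let ?A = "\<Sum>n. exp (- pi * x * (real n)\<^sup>2)" and ?B = "\<Sum>n. exp (- pi * x * (real (Suc n))\<^sup>2)"
  have s: "summable (\<lambda>n. exp (- pi * x * (real n)\<^sup>2))" by (rule summable_gauss[OF x])
  then have s': "summable (\<lambda>n. exp (- pi * x * (real (Suc n))\<^sup>2))" by (subst summable_Suc_iff)
  have "((?e \<circ> int) has_sum ?A) UNIV"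
    using summable_sums[OF s] by (intro sums_nonneg_imp_has_sum) (auto simp: o_def)
  then have 1: "(?e has_sum ?A) (range int)" by (subst has_sum_reindex) auto
  have "((?e \<circ> (\<lambda>n. - int (Suc n))) has_sum ?B) UNIV"
    using summable_sums[OF s'] by (intro sums_nonneg_imp_has_sum) (auto simp: o_def power2_eq_square algebra_simps)
  then have 2: "(?e has_sum ?B) (range (\<lambda>n. - int (Suc n)))" by (subst has_sum_reindex) (auto simp: inj_on_def)
  have "(?e has_sum (?A + ?B)) (range int \<union> range (\<lambda>n. - int (Suc n)))"
    using 1 2 by (rule has_sum_Un_disjoint) auto
  also have "range int \<union> range (\<lambda>n. - int (Suc n)) = UNIV"
  proof -
    have "k \<in> range int \<union> range (\<lambda>n. - int (Suc n))" for k :: int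
      by (cases k rule: int_cases) (simp, blast)
    then show ?thesis by blast
  qed
  finally have *: "(?e has_sum (?A + ?B)) UNIV" .
  then show eq: "jacobi_theta x = ?A + ?B" by (simp add: jacobi_theta_def infsumI)
  show "(?e has_sum jacobi_theta x) UNIV" using * eq by simp
qed

lemma jacobi_theta_partial_sums:
  assumes x: "x > 0"
  shows "(\<lambda>n. \<Sum>k\<in>{- int n..int n}. exp (- pi * x * (real_of_int k)\<^sup>2)) \<longlonglongrightarrow> jacobi_theta x"
proof -
  have "filterlim (\<lambda>n. {- int n..int n}) (finite_subsets_at_top UNIV) sequentially"
    unfolding filterlim_def le_filter_def eventually_filtermap
  proof (intro allI impI)
    fix P :: "int set \<Rightarrow> bool" assume "eventually P (finite_subsets_at_top UNIV)"
    then obtain X where X: "finite X" "\<And>Y. finite Y \<Longrightarrow> X \<subseteq> Y \<Longrightarrow> P Y"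
      by (auto simp: eventually_finite_subsets_at_top)
    define m where "m = Max (abs ` X)"
    have m: "\<bar>k\<bar> \<le> m" if "k \<in> X" for k
      unfolding m_def using X(1) that by (intro Max_ge) auto
    show "eventually (\<lambda>n. P {- int n..int n}) sequentially"
      using eventually_ge_at_top[of "nat m"]
    proof eventually_elim
      case (elim n)
      have "k \<in> {- int n..int n}" if "k \<in> X" for k using m[OF that] elim by auto
      then show ?case by (intro X(2)) auto
    qed
  qed
  then show ?thesis
    using jacobi_theta_has_sum(1)[OF x] unfolding has_sum_def by (rule filterlim_compose[rotated])
qed

text \<open>Poisson summation: the vertical line shift for \<open>exp (\<pi> x z\<^sup>2) / (exp (2 \<pi> z) - 1)\<close>, which has
  the poles \<open>\<i> k\<close>; on either line the geometric series turns the integral into a sum of Gaussians.\<close>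

theorem jacobi_theta_inverse:
  assumes x: "x > 0"
  shows "jacobi_theta x = jacobi_theta (1 / x) / sqrt x"
proof -
  define N where "N z = exp (of_real (pi * x) * z\<^sup>2)" for z :: complex
  define D where "D z = exp (2 * of_real pi * z) - 1" for z :: complex
  define K where "K z = N z / D z" for z
  have D0: "D z = 0 \<longleftrightarrow> (\<exists>k::int. z = Complex 0 (real_of_int k))" for z
  proof -
    have "D z = 0 \<longleftrightarrow> exp (2 * of_real pi * z) = 1" by (simp add: D_def)
    also have "\<dots> \<longleftrightarrow> Re z = 0 \<and> (\<exists>k::int. 2 * pi * Im z = of_int (2 * k) * pi)"
      by (simp add: exp_eq_1)
    also have "\<dots> \<longleftrightarrow> (\<exists>k::int. z = Complex 0 (real_of_int k))"
      by (auto simp: complex_eq_iff)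
    finally show ?thesis .
  qed
  have Nh: "N holomorphic_on A" for A unfolding N_def by (intro holomorphic_intros)
  have Dh: "D holomorphic_on A" for A unfolding D_def by (intro holomorphic_intros)
  have normN: "norm (N z) = exp (pi * x * ((Re z)\<^sup>2 - (Im z)\<^sup>2))" for z
    by (simp add: N_def Re_power2)
  define P where "P n = (\<lambda>k. Complex 0 (real_of_int k)) ` {- int n..int n}" for n
  \<comment> \<open>At i k the exponential in the denominator is 1, so the derivative of
    \<open>D\<close> is 2 pi, which cancels the factor 2 pi of the line shift.\<close>
  have res: "residue K (Complex 0 (real_of_int k)) = of_real (exp (- pi * x * (real_of_int k)\<^sup>2)) / (2 * of_real pi)" for k
  proof -
    let ?p = "Complex 0 (real_of_int k)"
    have e: "exp (2 * of_real pi * ?p) = 1" using D0[of ?p] by (auto simp: D_def)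
    have "(D has_field_derivative 2 * of_real pi * exp (2 * of_real pi * ?p)) (at ?p)"
      unfolding D_def by (auto intro!: derivative_eq_intros)
    then have "(D has_field_derivative 2 * of_real pi) (at ?p)" by (simp only: e mult_1_right)
    then have "residue K ?p = N ?p / (2 * of_real pi)"
      unfolding K_def using D0[of ?p]
      by (intro residue_simple_pole_deriv[OF Nh Dh open_UNIV connected_UNIV UNIV_I]) (auto simp: N_def)
    moreover have "of_real (pi * x) * ?p\<^sup>2 = of_real (- pi * x * (real_of_int k)\<^sup>2)"
      by (simp add: complex_eq_iff power2_eq_square)
    ultimately show ?thesis by (simp only: N_def exp_of_real)
  qed
  have sum_res: "2 * of_real pi * (\<Sum>p\<in>P n. residue K p)
      = of_real (\<Sum>k\<in>{- int n..int n}. exp (- pi * x * (real_of_int k)\<^sup>2))" for n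
  proof -
    have "(\<Sum>p\<in>P n. residue K p) = (\<Sum>k\<in>{- int n..int n}. residue K (Complex 0 (real_of_int k)))"
      unfolding P_def by (subst sum.reindex) (auto simp: inj_on_def o_def)
    then show ?thesis by (simp add: res sum_distrib_left)
  qed
  \<comment> \<open>For Re z > 0 the series in exp (-2 pi z) converges and starts at k = 1, hence
    the frequencies \<open>Suc k\<close>.\<close>
  have K1: "K (Complex 1 y) = (\<Sum>k. exp (of_real (pi * x) * (Complex 1 y)\<^sup>2 - of_real (2 * pi * real (Suc k)) * Complex 1 y))" for y
  proof -
    let ?z = "Complex 1 y"
    define q where "q = exp (- (2 * of_real pi * ?z))"
    have q: "norm q < 1" by (simp add: q_def)
    have q0: "q \<noteq> 0" by (simp add: q_def)
    have "exp (2 * of_real pi * ?z) = inverse q" by (simp add: q_def exp_minus)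
    then have "K ?z = N ?z / (inverse q - 1)" by (simp add: K_def D_def)
    also have "\<dots> = N ?z * q * (1 / (1 - q))"
    proof -
      have "q \<noteq> 1" using q by auto
      then show ?thesis using q0 by (simp add: field_simps)
    qed
    also have "1 / (1 - q) = (\<Sum>k. q ^ k)" using q by (simp add: suminf_geometric)
    also have "N ?z * q * (\<Sum>k. q ^ k) = (\<Sum>k. N ?z * q * q ^ k)"
      using q by (intro suminf_mult[symmetric] summable_geometric)
    also have "(\<lambda>k. N ?z * q * q ^ k) = (\<lambda>k. exp (of_real (pi * x) * ?z\<^sup>2 - of_real (2 * pi * real (Suc k)) * ?z))"
    proof
      fix k
      have "q * q ^ k = exp (of_nat (Suc k) * (- (2 * of_real pi * ?z)))"
        unfolding exp_of_nat_mult q_def by simp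
      also have "of_nat (Suc k) * (- (2 * of_real pi * ?z)) = - (of_real (2 * pi * real (Suc k)) * ?z)" by simp
      finally show "N ?z * q * q ^ k = exp (of_real (pi * x) * ?z\<^sup>2 - of_real (2 * pi * real (Suc k)) * ?z)"
        by (simp only: N_def mult.assoc exp_add [symmetric]) simp
    qed
    finally show ?thesis .
  qed
  \<comment> \<open>For Re z < 0 the series in exp (2 pi z) is used; it starts at k = 0 and carries
    a minus sign, which turns the difference of the two line integrals into a sum. Frequencies are
    written as -k to fit the preceding lemma with a = -1.\<close>
  have K2: "K (Complex (- 1) y) = - (\<Sum>k. exp (of_real (pi * x) * (Complex (- 1) y)\<^sup>2 - of_real (2 * pi * - real k) * Complex (- 1) y))" for y
  proof -
    let ?z = "Complex (- 1) y"
    define q where "q = exp (2 * of_real pi * ?z)"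
    have q: "norm q < 1" by (simp add: q_def)
    have "K ?z = - (N ?z * (1 / (1 - q)))"
    proof -
      have "q \<noteq> 1" using q by auto
      then have "N ?z / (q - 1) = - (N ?z * (1 / (1 - q)))" by (simp add: field_simps)
      moreover have "D ?z = q - 1" by (simp only: D_def q_def)
      ultimately show ?thesis by (simp only: K_def)
    qed
    also have "1 / (1 - q) = (\<Sum>k. q ^ k)" using q by (simp add: suminf_geometric)
    also have "N ?z * (\<Sum>k. q ^ k) = (\<Sum>k. N ?z * q ^ k)"
      using q by (intro suminf_mult[symmetric] summable_geometric)
    also have "(\<lambda>k. N ?z * q ^ k) = (\<lambda>k. exp (of_real (pi * x) * ?z\<^sup>2 - of_real (2 * pi * - real k) * ?z))"
    proof
      fix k
      have "q ^ k = exp (of_nat k * (2 * of_real pi * ?z))" unfolding exp_of_nat_mult q_def by simp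
      then show "N ?z * q ^ k = exp (of_real (pi * x) * ?z\<^sup>2 - of_real (2 * pi * - real k) * ?z)"
        by (simp only: N_def exp_add [symmetric]) (simp add: mult_ac)
    qed
    finally show ?thesis .
  qed
  have sm: "summable (\<lambda>k. exp (- (2 * pi)) ^ k)" by (intro summable_geometric) simp
  have c1: "summable (\<lambda>k. exp (- 2 * pi * 1 * real (Suc k)))"
  proof -
    have "(\<lambda>k. exp (- 2 * pi * 1 * real (Suc k))) = (\<lambda>k. exp (- (2 * pi)) ^ Suc k)"
      unfolding exp_of_nat_mult [symmetric] by (simp add: mult_ac)
    then show ?thesis using sm by (simp only: summable_Suc_iff)
  qed
  have c2: "summable (\<lambda>k. exp (- 2 * pi * - 1 * - real k))"
  proof -
    have "(\<lambda>k. exp (- 2 * pi * - 1 * - real k)) = (\<lambda>k. exp (- (2 * pi)) ^ k)"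
      unfolding exp_of_nat_mult [symmetric] by (simp add: mult_ac)
    then show ?thesis using sm by simp
  qed
  note L1 = gauss_vertical_line_series[OF x c1, folded K1]
    and L2 = gauss_vertical_line_series[OF x c2]
  have i2: "integrable lborel (\<lambda>y. K (Complex (- 1) y))" unfolding K2 using L2(1) by simp
  have I2: "(LBINT y. K (Complex (- 1) y)) = - (LBINT y. \<Sum>k. exp (of_real (pi * x) * (Complex (- 1) y)\<^sup>2 - of_real (2 * pi * - real k) * Complex (- 1) y))"
    unfolding K2 by simp
  have "(\<lambda>n. 2 * of_real pi * (\<Sum>p\<in>P n. residue K p)) \<longlonglongrightarrow>
      (LBINT y. K (Complex 1 y)) - (LBINT y. K (Complex (- 1) y))"
  \<comment> \<open>The height lies midway between poles: there exp (2 pi z) = - exp (2 pi Re z), so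
    the denominator has modulus at least 1 and the Gaussian decides. The slab |Im z| < n + 1
    contains exactly the poles with |k| <= n.\<close>
  proof (rule vertical_line_shift[where T = "\<lambda>n. real n + 1 / 2" and S = "\<lambda>n. {z. - (real n + 1) < Im z} \<inter> {z. Im z < real n + 1}"
        and M = "\<lambda>n. exp (pi * x * (1 - (real n + 1 / 2)\<^sup>2))"])
    show "filterlim (\<lambda>n. real n + 1 / 2) at_top sequentially" by real_asymp
    show "open ({z. - (real n + 1) < Im z} \<inter> {z. Im z < real n + 1})" for n
      by (intro open_Int open_halfspace_Im_gt open_halfspace_Im_lt)
    show "convex ({z. - (real n + 1) < Im z} \<inter> {z. Im z < real n + 1})" for n
      by (intro convex_Int convex_halfspace_Im_gt convex_halfspace_Im_lt)
    show "cbox (Complex (- 1) (- (real n + 1 / 2))) (Complex 1 (real n + 1 / 2))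
        \<subseteq> {z. - (real n + 1) < Im z} \<inter> {z. Im z < real n + 1}" for n
      by (auto simp: in_cbox_complex_iff)
    show "finite (P n)" for n by (simp add: P_def)
    show "P n \<subseteq> box (Complex (- 1) (- (real n + 1 / 2))) (Complex 1 (real n + 1 / 2))" for n
    proof
      fix p assume "p \<in> P n"
      then obtain k where k: "p = Complex 0 (real_of_int k)" "- int n \<le> k" "k \<le> int n" by (auto simp: P_def)
      then have "- real n \<le> real_of_int k" "real_of_int k \<le> real n" by linarith+
      then show "p \<in> box (Complex (- 1) (- (real n + 1 / 2))) (Complex 1 (real n + 1 / 2))"
        by (simp add: k(1) in_box_complex_iff)
    qed
    show "K holomorphic_on {z. - (real n + 1) < Im z} \<inter> {z. Im z < real n + 1} - P n" for n
      unfolding K_def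
    proof (rule holomorphic_on_divide[OF Nh Dh])
      fix z assume z: "z \<in> {z. - (real n + 1) < Im z} \<inter> {z. Im z < real n + 1} - P n"
      show "D z \<noteq> 0"
      proof
        assume "D z = 0"
        then obtain k :: int where k: "z = Complex 0 (real_of_int k)" using D0 by blast
        with z have "- (real n + 1) < real_of_int k" "real_of_int k < real n + 1" by auto
        then have "- int n \<le> k" "k \<le> int n" by linarith+
        with k z show False by (auto simp: P_def)
      qed
    qed
    show "integrable lborel (\<lambda>y. K (Complex 1 y))" by (rule L1(1))
    have bd: "norm (K (Complex u v)) \<le> exp (pi * x * (1 - (real n + 1 / 2)\<^sup>2))"
      if u: "u \<in> {- 1..1}" and v: "\<bar>v\<bar> = real n + 1 / 2" for u v n
    proof -
      have "exp (2 * of_real pi * Complex u v) = - of_real (exp (2 * pi * u))"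
      proof -
        have c: "cos (2 * pi * v) = - 1"
        proof -
          have "cos (2 * pi * v) = cos (2 * pi * \<bar>v\<bar>)" by (simp add: abs_if)
          also have "2 * pi * \<bar>v\<bar> = real (2 * n + 1) * pi" by (simp add: v algebra_simps)
          also have "cos \<dots> = - 1" by (subst cos_npi) simp
          finally show ?thesis .
        qed
        then have s: "sin (2 * pi * v) = 0" using sin_cos_squared_add[of "2 * pi * v"] by simp
        show ?thesis by (simp add: exp_eq_polar c s complex_eq_iff Re_exp Im_exp)
      qed
      then have "D (Complex u v) = - of_real (exp (2 * pi * u) + 1)" by (simp add: D_def)
      then have "norm (D (Complex u v)) = exp (2 * pi * u) + 1"
        by (simp only: norm_minus_cancel norm_of_real) (simp add: add_nonneg_nonneg)
      then have "norm (D (Complex u v)) \<ge> 1" by simp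
      then have "norm (K (Complex u v)) \<le> norm (N (Complex u v)) / 1"
        unfolding K_def norm_divide by (intro frac_le) auto
      also have "\<dots> \<le> exp (pi * x * (1 - (real n + 1 / 2)\<^sup>2))"
      proof -
        have "\<bar>u\<bar> \<le> 1" using u by auto
        then have "u\<^sup>2 \<le> 1" by (simp add: abs_square_le_1)
        moreover have "v\<^sup>2 = (real n + 1 / 2)\<^sup>2" using v by (metis power2_abs)
        ultimately show ?thesis using x by (simp add: normN)
      qed
      finally show ?thesis .
    qed
    show "norm (K (Complex u (real n + 1 / 2))) \<le> exp (pi * x * (1 - (real n + 1 / 2)\<^sup>2))"
      "norm (K (Complex u (- (real n + 1 / 2)))) \<le> exp (pi * x * (1 - (real n + 1 / 2)\<^sup>2))"
      if "u \<in> {- 1..1}" for u n using that by (intro bd; simp)+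
    have "filterlim (\<lambda>n. (pi * x) * ((real n + 1 / 2)\<^sup>2 - 1)) at_top sequentially"
      using x by (intro filterlim_tendsto_pos_mult_at_top[OF tendsto_const]) (simp, real_asymp)
    then have "filterlim (\<lambda>n. - ((pi * x) * ((real n + 1 / 2)\<^sup>2 - 1))) at_bot sequentially"
      by (simp add: filterlim_uminus_at_bot)
    then have "(\<lambda>n. exp (- ((pi * x) * ((real n + 1 / 2)\<^sup>2 - 1)))) \<longlonglongrightarrow> 0"
      by (rule filterlim_compose[OF exp_at_bot])
    then show "(\<lambda>n. exp (pi * x * (1 - (real n + 1 / 2)\<^sup>2))) \<longlonglongrightarrow> 0" by (simp add: right_diff_distrib)
  qed (use i2 in auto)
  moreover have "(\<lambda>n. 2 * of_real pi * (\<Sum>p\<in>P n. residue K p)) \<longlonglongrightarrow> of_real (jacobi_theta x)"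
    unfolding sum_res using jacobi_theta_partial_sums[OF x] by (intro tendsto_of_real)
  ultimately have "complex_of_real (jacobi_theta x) = (LBINT y. K (Complex 1 y)) - (LBINT y. K (Complex (- 1) y))"
    using LIMSEQ_unique by blast
  moreover have "(\<lambda>k. complex_of_real (exp (- pi * (real (Suc k))\<^sup>2 / x) / sqrt x)) sums
      of_real ((\<Sum>k. exp (- pi * (1 / x) * (real (Suc k))\<^sup>2)) / sqrt x)"
  proof (intro sums_of_real)
    have "summable (\<lambda>k. exp (- pi * (1 / x) * (real k)\<^sup>2))" using x by (intro summable_gauss) simp
    then have "summable (\<lambda>k. exp (- pi * (1 / x) * (real (Suc k))\<^sup>2))" by (subst summable_Suc_iff)
    then have "(\<lambda>k. exp (- pi * (1 / x) * (real (Suc k))\<^sup>2) / sqrt x) sums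
        ((\<Sum>k. exp (- pi * (1 / x) * (real (Suc k))\<^sup>2)) / sqrt x)"
      by (intro sums_divide summable_sums)
    then show "(\<lambda>k. exp (- pi * (real (Suc k))\<^sup>2 / x) / sqrt x) sums
        ((\<Sum>k. exp (- pi * (1 / x) * (real (Suc k))\<^sup>2)) / sqrt x)" by simp
  qed
  then have "(LBINT y. K (Complex 1 y)) = of_real ((\<Sum>k. exp (- pi * (1 / x) * (real (Suc k))\<^sup>2)) / sqrt x)"
    using L1(2) sums_unique2 by blast
  moreover have "(\<lambda>k. complex_of_real (exp (- pi * (- real k)\<^sup>2 / x) / sqrt x)) sums
      of_real ((\<Sum>k. exp (- pi * (1 / x) * (real k)\<^sup>2)) / sqrt x)"
    using summable_gauss[of "1 / x"] x
    by (intro sums_of_real) (auto intro!: sums_divide summable_sums)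
  then have "(LBINT y. K (Complex (- 1) y)) = - of_real ((\<Sum>k. exp (- pi * (1 / x) * (real k)\<^sup>2)) / sqrt x)"
    unfolding I2 using L2(2) sums_unique2 by auto
  ultimately have "complex_of_real (jacobi_theta x) = of_real (jacobi_theta (1 / x) / sqrt x)"
    using jacobi_theta_has_sum(2)[of "1 / x"] x by (simp add: add_divide_distrib)
  then show ?thesis by (simp only: of_real_eq_iff)
qed

section \<open>The Dirichlet series and the theta series of sums of two squares\<close>

lemma has_sum_product_complex:
  fixes f :: "'a \<Rightarrow> complex" and g :: "'b \<Rightarrow> complex"
  assumes f: "(f has_sum a) A" "(\<lambda>x. norm (f x)) summable_on A" and g: "(g has_sum b) B" "(\<lambda>x. norm (g x)) summable_on B"
  shows "((\<lambda>(x, y). f x * g y) has_sum a * b) (A \<times> B)"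
proof -
  have "(\<lambda>p. norm (case p of (x, y) \<Rightarrow> f x * g y)) summable_on (A \<times> B)"
    unfolding Infinite_Sum.abs_summable_on_Sigma_iff
  proof
    show "\<forall>x\<in>A. (\<lambda>y. norm (case (x, y) of (x, y) \<Rightarrow> f x * g y)) summable_on B"
      using g(2) by (auto simp: norm_mult intro!: summable_on_cmult_right)
    have "(\<lambda>x. norm (norm (f x) * (\<Sum>\<^sub>\<infinity>y\<in>B. norm (g y)))) summable_on A"
      using f(2) by (auto simp: abs_mult intro!: summable_on_cmult_left)
    then show "(\<lambda>x. norm (\<Sum>\<^sub>\<infinity>y\<in>B. norm (case (x, y) of (x, y) \<Rightarrow> f x * g y))) summable_on A"
      by (simp add: norm_mult infsum_cmult_right')
  qed
  then have s: "(\<lambda>(x, y). f x * g y) summable_on (A \<times> B)" by (rule Infinite_Sum.abs_summable_summable)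
  have "(\<Sum>\<^sub>\<infinity>(x, y)\<in>A \<times> B. f x * g y) = (\<Sum>\<^sub>\<infinity>x\<in>A. \<Sum>\<^sub>\<infinity>y\<in>B. f x * g y)"
    using s by (rule infsum_Sigma'_banach[symmetric])
  also have "\<dots> = (\<Sum>\<^sub>\<infinity>x\<in>A. f x) * (\<Sum>\<^sub>\<infinity>y\<in>B. g y)"
    by (simp add: infsum_cmult_right' infsum_cmult_left')
  also have "\<dots> = a * b" using f(1) g(1) by (simp add: infsumI)
  finally show ?thesis using s by (metis has_sum_infsum)
qed

text \<open>Regrouping along finite fibres; applied to pairs (a, b) according to a^2 + b^2 and to
  pairs (d, e) according to d e.\<close>

lemma has_sum_fibers:
  fixes f :: "'b \<Rightarrow> complex"
  assumes "(f has_sum S) B" "bij_betw h (Sigma N F) B" "\<And>n. n \<in> N \<Longrightarrow> finite (F n)"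
  shows "((\<lambda>n. \<Sum>y\<in>F n. f (h (n, y))) has_sum S) N"
proof (rule has_sum_Sigma[OF isUCont_plus])
  show "((\<lambda>p. f (h p)) has_sum S) (Sigma N F)"
    using assms(1,2) by (simp add: has_sum_reindex_bij_betw)
qed (use assms(3) in auto)

text \<open>In the squared series the term of (a, b) depends only on a^2 + b^2, and pairs with the
  same value are grouped. The index starts at 0, so the constant term r_0 = 1 is included.\<close>

lemma r2_theta_series:
  assumes x: "x > 0"
  shows "(\<lambda>n. real (r2 n) * exp (- pi * x * real n)) sums (jacobi_theta x)\<^sup>2"
proof -
  define e where "e k = complex_of_real (exp (- pi * x * (real_of_int k)\<^sup>2))" for k
  note th = jacobi_theta_has_sum(1)[OF x]
  have e: "(e has_sum of_real (jacobi_theta x)) UNIV"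
    unfolding e_def using has_sum_of_real[OF th] .
  have ea: "(\<lambda>k. norm (e k)) summable_on UNIV"
    using th unfolding e_def by (auto simp: has_sum_imp_summable)
  have p: "((\<lambda>(a, b). e a * e b) has_sum of_real (jacobi_theta x) * of_real (jacobi_theta x)) (UNIV \<times> UNIV)"
    by (rule has_sum_product_complex[OF e ea e ea])
  have bij: "bij_betw snd (Sigma UNIV norm_reps) (UNIV \<times> UNIV)"
  proof (rule bij_betw_imageI)
    show "inj_on snd (Sigma UNIV norm_reps)"
    proof (rule inj_onI)
      fix p q :: "nat \<times> int \<times> int"
      assume "p \<in> Sigma UNIV norm_reps" "q \<in> Sigma UNIV norm_reps" "snd p = snd q"
      then show "p = q" by (cases p, cases q) (auto simp: norm_reps_def)
    qed
    show "snd ` Sigma UNIV norm_reps = UNIV \<times> UNIV"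
    proof (intro equalityI subsetI)
      fix ab :: "int \<times> int"
      obtain a b where ab: "ab = (a, b)" by (cases ab)
      have "int (nat (a\<^sup>2 + b\<^sup>2)) = a\<^sup>2 + b\<^sup>2" by simp
      then have "(nat (a\<^sup>2 + b\<^sup>2), ab) \<in> Sigma UNIV norm_reps" by (simp add: norm_reps_def ab)
      then show "ab \<in> snd ` Sigma UNIV norm_reps" by (metis image_eqI snd_conv)
    qed auto
  qed
  have "((\<lambda>n. \<Sum>y\<in>norm_reps n. (case snd (n, y) of (a, b) \<Rightarrow> e a * e b)) has_sum
      of_real (jacobi_theta x) * of_real (jacobi_theta x)) UNIV"
    by (rule has_sum_fibers[OF p bij finite_norm_reps])
  also have "(\<lambda>n. \<Sum>y\<in>norm_reps n. (case snd (n, y) of (a, b) \<Rightarrow> e a * e b))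
      = (\<lambda>n. complex_of_real (real (r2 n) * exp (- pi * x * real n)))"
  proof
    fix n
    have "(case snd (n, y) of (a, b) \<Rightarrow> e a * e b) = of_real (exp (- pi * x * real n))"
      if y: "y \<in> norm_reps n" for y
    proof -
      obtain a b where ab: "y = (a, b)" "a\<^sup>2 + b\<^sup>2 = int n" using y by (auto simp: norm_reps_def)
      have "real_of_int (a\<^sup>2 + b\<^sup>2) = real n" by (simp only: ab(2) of_int_of_nat_eq)
      then have "real n = (real_of_int a)\<^sup>2 + (real_of_int b)\<^sup>2" by simp
      then show ?thesis by (simp add: ab(1) e_def exp_add [symmetric] distrib_left del: of_real_exp flip: of_real_mult)
    qed
    then have "(\<Sum>y\<in>norm_reps n. (case snd (n, y) of (a, b) \<Rightarrow> e a * e b))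
        = (\<Sum>y\<in>norm_reps n. of_real (exp (- pi * x * real n)))" by (intro sum.cong refl)
    then show "(\<Sum>y\<in>norm_reps n. (case snd (n, y) of (a, b) \<Rightarrow> e a * e b))
        = complex_of_real (real (r2 n) * exp (- pi * x * real n))"
      by (simp only: sum_constant r2_eq_card of_real_mult of_real_of_nat_eq)
  qed
  finally have "(\<lambda>n. complex_of_real (real (r2 n) * exp (- pi * x * real n))) sums of_real ((jacobi_theta x)\<^sup>2)"
    by (simp add: has_sum_imp_sums power2_eq_square)
  then show ?thesis by (simp only: sums_of_real_iff)
qed

text \<open>For Re s > 1 both series converge absolutely, so their product may be rearranged
  according to n = d e; the inner sums are divisor sums of the character.\<close>

lemma r2_dirichlet_series:
  assumes s: "Re s > 1"
  shows "(\<lambda>n. of_nat (r2 (Suc n)) * of_nat (Suc n) powr (- s)) sums (4 * riemann_zeta s * L_chi4 s)"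
proof -
  have norm_p: "norm (of_nat (Suc n) powr (- s) :: complex) = real (Suc n) powr (- Re s)" for n
    using norm_of_real_powr[of "real (Suc n)" "- s"] by simp
  have smr: "summable (\<lambda>n. real (Suc n) powr (- Re s))"
    using s by (subst summable_Suc_iff) (simp add: summable_real_powr_iff)
  define p where "p n = complex_of_nat n powr (- s)" for n
  have pz: "((p \<circ> Suc) has_sum riemann_zeta s) UNIV" and pza: "(\<lambda>n. norm ((p \<circ> Suc) n)) summable_on UNIV"
  proof -
    have sn: "summable (\<lambda>n. norm ((p \<circ> Suc) n))" using smr by (simp add: p_def norm_p del: of_nat_Suc)
    then show "((p \<circ> Suc) has_sum riemann_zeta s) UNIV"
      using riemann_zeta_sums[OF s] by (intro norm_summable_imp_has_sum) (auto simp: p_def o_def simp del: of_nat_Suc)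
    show "(\<lambda>n. norm ((p \<circ> Suc) n)) summable_on UNIV"
      using norm_summable_imp_summable_on[of "\<lambda>n. norm ((p \<circ> Suc) n)"] sn by simp
  qed
  have S: "range Suc = {1..}" by (auto simp: image_iff) (metis Suc_le_D)
  have z: "(p has_sum riemann_zeta s) {1..}" and za: "(\<lambda>n. norm (p n)) summable_on {1..}"
    using pz pza unfolding S [symmetric] by (simp_all add: has_sum_reindex summable_on_reindex o_def)
  define q where "q n = complex_of_int (chi4 n) * p n" for n
  have q_le: "norm (q n) \<le> norm (p n)" for n
    by (simp add: q_def norm_mult chi4_def)
  have qa: "(\<lambda>n. norm (q n)) summable_on A" if "A \<subseteq> {1..}" for A
    by (rule Infinite_Sum.abs_summable_on_comparison_test[OF summable_on_subset_banach[OF za that] q_le])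
  \<comment> \<open>The sum over odd numbers becomes unordered by absolute convergence and is then
    extended by the even numbers, on which the character is 0.\<close>
  have q: "(q has_sum L_chi4 s) {1..}"
  proof -
    let ?h = "\<lambda>k :: nat. 2 * k + 1"
    have sums: "(q \<circ> ?h) sums L_chi4 s"
      using L_chi4_sums[of s] s by (simp only: q_def p_def o_def chi4_odd) simp
    have "(\<lambda>n. norm (q n)) summable_on (range ?h)" by (rule qa) auto
    then have "((\<lambda>n. norm (q n)) \<circ> ?h) summable_on UNIV"
      by (subst (asm) summable_on_reindex) (auto simp: inj_on_def)
    then have "(\<lambda>k. norm ((q \<circ> ?h) k)) summable_on UNIV" by (simp add: o_def)
    then have "(q \<circ> ?h) summable_on UNIV" by (rule Infinite_Sum.abs_summable_summable)
    then have "((q \<circ> ?h) has_sum L_chi4 s) UNIV"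
      using has_sum_imp_sums sums sums_unique2 by (metis has_sum_infsum)
    then have "(q has_sum L_chi4 s) (range ?h)" by (subst has_sum_reindex) (auto simp: inj_on_def)
    moreover have zero: "q n = 0" if n: "n \<notin> range ?h" for n
    proof -
      have "even n"
      proof (rule ccontr)
        assume "odd n"
        then obtain k where "n = ?h k" by (elim oddE)
        with n show False by blast
      qed
      then have "chi4 n = 0" unfolding chi4_def by presburger
      then show "q n = 0" by (simp add: q_def)
    qed
    have "(q has_sum L_chi4 s) (range ?h) \<longleftrightarrow> (q has_sum L_chi4 s) {1..}"
      by (rule has_sum_cong_neutral) (use zero in auto)
    ultimately show ?thesis by simp
  qed
  have prod: "((\<lambda>(d, e). q d * p e) has_sum L_chi4 s * riemann_zeta s) ({1..} \<times> {1..})"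
    by (rule has_sum_product_complex[OF q qa[OF order_refl] z za])
  have bij: "bij_betw (\<lambda>(n, d). (d, n div d)) (Sigma {1..} (\<lambda>n :: nat. {d. d dvd n})) ({1..} \<times> {1..})"
  proof (rule bij_betwI[where g = "\<lambda>(d, e). (d * e, d)"])
    show "(\<lambda>(n, d). (d, n div d)) \<in> Sigma {1..} (\<lambda>n :: nat. {d. d dvd n}) \<rightarrow> {1..} \<times> {1..}"
      by (auto simp: Suc_le_eq dvd_pos_nat dvd_div_eq_0_iff intro: Nat.gr0I)
    show "(\<lambda>(d, e). (d * e, d)) \<in> {1..} \<times> {1..} \<rightarrow> Sigma {1..} (\<lambda>n :: nat. {d. d dvd n})"
      by (auto simp: Suc_le_eq)
  qed (auto simp: Suc_le_eq)
  have "((\<lambda>n. \<Sum>d | d dvd n. (case (case (n, d) of (n, d) \<Rightarrow> (d, n div d)) of (d, e) \<Rightarrow> q d * p e)) has_sum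
      L_chi4 s * riemann_zeta s) {1..}"
    by (rule has_sum_fibers[OF prod bij]) auto
  then have "((\<lambda>n. 4 * (\<Sum>d | d dvd n. q d * p (n div d))) has_sum 4 * (L_chi4 s * riemann_zeta s)) {1..}"
    by (intro has_sum_cmult_right) simp
  also have "?this \<longleftrightarrow> ((\<lambda>n. of_nat (r2 n) * p n) has_sum 4 * (L_chi4 s * riemann_zeta s)) {1..}"
  proof (rule has_sum_cong)
    fix n :: nat assume "n \<in> {1..}"
    then have n: "n > 0" by simp
    have "q d * p (n div d) = of_int (chi4 d) * p n" if "d dvd n" for d
    proof -
      from that obtain e where e: "n = d * e" by blast
      with n have "d > 0" "e > 0" by auto
      then have "p n = p d * p e"
        unfolding e p_def using powr_times_real[of "of_nat d" "of_nat e" "- s"] by simp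
      then show ?thesis using \<open>d > 0\<close> by (simp add: q_def e)
    qed
    then have "4 * (\<Sum>d | d dvd n. q d * p (n div d)) = 4 * (\<Sum>d | d dvd n. of_int (chi4 d) * p n)"
      by (intro arg_cong[of _ _ "(*) 4"] sum.cong) auto
    also have "\<dots> = of_int (4 * chi4_divisor_sum n) * p n"
      by (simp add: chi4_divisor_sum_def sum_distrib_right)
    also have "\<dots> = of_nat (r2 n) * p n"
      unfolding r2_eq_chi4_divisor_sum[OF n, symmetric] by simp
    finally show "4 * (\<Sum>d | d dvd n. q d * p (n div d)) = of_nat (r2 n) * p n" .
  qed
  finally have "((\<lambda>n. of_nat (r2 n) * p n) has_sum 4 * (L_chi4 s * riemann_zeta s)) (range Suc)"
    unfolding S .
  then have "((\<lambda>n. of_nat (r2 (Suc n)) * p (Suc n)) has_sum 4 * (L_chi4 s * riemann_zeta s)) UNIV"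
    by (simp add: has_sum_reindex o_def)
  then show ?thesis
    using has_sum_imp_sums by (force simp: p_def mult_ac simp del: of_nat_Suc)
qed

section \<open>Gamma integrals and the Mellin transform of the theta series\<close>

lemma summable_r2_powr:
  assumes "x > 3"
  shows "summable (\<lambda>n. real (r2 (Suc n)) * real (Suc n) powr (- x))"
proof (rule summable_comparison_test')
  have "summable (\<lambda>n. real n powr (2 - x))" using assms by (simp add: summable_real_powr_iff)
  then have "summable (\<lambda>n. real (Suc n) powr (2 - x))" by (subst summable_Suc_iff)
  then show "summable (\<lambda>n. 9 * real (Suc n) powr (2 - x))" by (rule summable_mult)
  show "norm (real (r2 (Suc n)) * real (Suc n) powr (- x)) \<le> 9 * real (Suc n) powr (2 - x)" for n
  proof -
    have "real (r2 (Suc n)) \<le> real ((2 * Suc n + 1)\<^sup>2)" by (intro of_nat_mono r2_le)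
    also have "\<dots> = (2 * real (Suc n) + 1)\<^sup>2" by simp
    also have "\<dots> \<le> (3 * real (Suc n))\<^sup>2" by (intro power_mono) auto
    also have "\<dots> = 9 * real (Suc n) powr 2" by (simp add: power_mult_distrib powr_numeral del: of_nat_Suc)
    finally have "real (r2 (Suc n)) * real (Suc n) powr (- x) \<le> 9 * real (Suc n) powr 2 * real (Suc n) powr (- x)"
      by (intro mult_right_mono) auto
    also have "\<dots> = 9 * real (Suc n) powr (2 - x)" by (simp only: mult.assoc powr_add [symmetric]) simp
    finally show ?thesis by simp
  qed
qed

text \<open>Euler's integral after the substitution of c u for u.\<close>

lemma
  assumes z: "Re z > 0" and c: "c > 0"
  shows gamma_integrable: "integrable lborel (\<lambda>u. indicator {0<..} u *\<^sub>R (of_real u powr (z - 1) * of_real (exp (- c * u))))"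
    and gamma_integral: "(LBINT u. indicator {0<..} u *\<^sub>R (of_real u powr (z - 1) * of_real (exp (- c * u))))
      = Gamma z * of_real c powr (- z)"
proof -
  define h where "h u = indicator {0<..} u *\<^sub>R (complex_of_real u powr (z - 1) / of_real (exp u))" for u
  have hs: "set_integrable lborel {0<..} (\<lambda>u. complex_of_real u powr (z - 1) / of_real (exp u))"
    by (rule set_integrable_lborel_if_absolutely_integrable[OF absolutely_integrable_Gamma_integral'[OF z]])
      (unfold set_borel_measurable_def, measurable)
  then have hi: "integrable lborel h" by (simp add: set_integrable_def h_def [abs_def])
  have hI: "(LBINT u. h u) = Gamma z"
    using set_borel_integral_eq_integral(2)[OF hs] Gamma_integral_complex'[OF z]
    by (simp add: set_lebesgue_integral_def h_def integral_unique)
  have e: "indicator {0<..} u *\<^sub>R (of_real u powr (z - 1) * of_real (exp (- c * u)))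
      = of_real c powr (1 - z) * h (0 + c * u)" for u
  proof (cases "u > 0")
    case True
    have "complex_of_real (c * u) powr (z - 1) = of_real c powr (z - 1) * of_real u powr (z - 1)"
      using c True powr_times_real[of "of_real c" "of_real u" "z - 1"] by simp
    moreover have 1: "of_real c powr (1 - z) * complex_of_real c powr (z - 1) = 1"
      using c by (simp add: powr_add [symmetric])
    then have "of_real c powr (1 - z) * (of_real c powr (z - 1) * w) = w" for w
      by (simp add: mult.assoc [symmetric])
    ultimately show ?thesis using c True 1
      by (simp add: h_def exp_minus divide_inverse mult.assoc del: of_real_mult flip: of_real_inverse)
  qed (use c in \<open>simp add: h_def zero_less_mult_iff\<close>)
  have "integrable lborel (\<lambda>u. h (0 + c * u))" using hi c by (intro lborel_integrable_real_affine) auto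
  then show "integrable lborel (\<lambda>u. indicator {0<..} u *\<^sub>R (of_real u powr (z - 1) * of_real (exp (- c * u))))"
    unfolding e by (rule integrable_mult_right)
  have "Gamma z = \<bar>c\<bar> *\<^sub>R (LBINT u. h (0 + c * u))"
    unfolding hI [symmetric] using c by (intro lborel_integral_real_affine) auto
  then have "(LBINT u. h (0 + c * u)) = Gamma z / of_real c" using c by (simp add: scaleR_conv_of_real)
  then have "(LBINT u. indicator {0<..} u *\<^sub>R (of_real u powr (z - 1) * of_real (exp (- c * u))))
      = of_real c powr (1 - z) * (Gamma z / of_real c)"
    unfolding e by (simp only: integral_mult_right_zero)
  also have "\<dots> = Gamma z * of_real c powr (- z)" using c by (simp add: powr_diff powr_minus field_simps)
  finally show "(LBINT u. indicator {0<..} u *\<^sub>R (of_real u powr (z - 1) * of_real (exp (- c * u))))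
      = Gamma z * of_real c powr (- z)" .
qed

text \<open>The square of theta without its constant term, which would spoil convergence of the
  Mellin integral at infinity.\<close>

definition r2_theta :: "real \<Rightarrow> complex" where
  "r2_theta u = of_real (\<Sum>n. real (r2 (Suc n)) * exp (- (pi * real (Suc n)) * u))"

lemma r2_theta_measurable [measurable]: "r2_theta \<in> borel_measurable borel"
  unfolding r2_theta_def by measurable

lemma r2_theta_sums:
  assumes "u > 0"
  shows "(\<lambda>n. real (r2 (Suc n)) * exp (- (pi * real (Suc n)) * u)) sums ((jacobi_theta u)\<^sup>2 - 1)"
proof -
  have "(\<lambda>n. real (r2 (Suc n)) * exp (- pi * u * real (Suc n))) sums
      ((jacobi_theta u)\<^sup>2 - real (r2 0) * exp (- pi * u * real 0))"
    using r2_theta_series[OF assms] by (subst sums_Suc_iff) simp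
  then show ?thesis by (simp add: r2_0 mult_ac del: of_nat_Suc One_nat_def)
qed

lemma r2_theta_eq: "u > 0 \<Longrightarrow> r2_theta u = of_real ((jacobi_theta u)\<^sup>2 - 1)"
  unfolding r2_theta_def using r2_theta_sums sums_unique by metis

text \<open>The square of theta transforms with the factor u instead of its square root. Removing
  the constant term on both sides leaves the inhomogeneity u - 1, from which the two poles will
  come.\<close>

lemma r2_theta_inverse:
  assumes u: "u > 0"
  shows "r2_theta (1 / u) = of_real u * r2_theta u + of_real (u - 1)"
proof -
  have "jacobi_theta u = jacobi_theta (1 / u) / sqrt u" by (rule jacobi_theta_inverse[OF u])
  then have "jacobi_theta (1 / u) = sqrt u * jacobi_theta u" using u by (simp add: field_simps)
  then have "(jacobi_theta (1 / u))\<^sup>2 = u * (jacobi_theta u)\<^sup>2" using u by (simp add: power_mult_distrib)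
  then show ?thesis using u by (simp add: r2_theta_eq algebra_simps)
qed

text \<open>Termwise integration of the exponential series, each term giving a Gamma integral. The
  integrals of the absolute values are summable for Re z > 3 by the crude bound on r_n.\<close>

lemma
  assumes z: "Re z > 3"
  shows mellin_r2_theta_integrable: "mellin_integrable r2_theta z"
    and mellin_r2_theta: "mellin r2_theta z = 4 * of_real pi powr (- z) * Gamma z * riemann_zeta z * L_chi4 z"
proof -
  define f where "f n u = indicator {0<..} u *\<^sub>R (of_real u powr (z - 1) * of_real (exp (- (pi * real (Suc n)) * u)))"
    for n u
  define F where "F n u = of_nat (r2 (Suc n)) * f n u" for n u
  have z0: "Re z > 0" and c: "pi * real (Suc n) > 0" for n using z by (simp_all del: of_nat_Suc)
  have fi: "integrable lborel (f n)" and fI: "(LBINT u. f n u) = Gamma z * of_real (pi * real (Suc n)) powr (- z)" for n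
    unfolding f_def by (rule gamma_integrable[OF z0 c], rule gamma_integral[OF z0 c])
  have Fi: "integrable lborel (F n)" for n unfolding F_def using fi by simp
  \<comment> \<open>The modulus of the integrand is the same integrand at the real point Re z, so
    the Gamma integral evaluates it as well.\<close>
  have fn: "(LBINT u. norm (f n u)) = norm (Gamma (of_real (Re z)) :: complex) * (pi * real (Suc n)) powr (- Re z)" for n
  proof -
    have "complex_of_real (LBINT u. norm (f n u)) = (LBINT u. of_real (norm (f n u)))" by simp
    also have "\<dots> = (LBINT u. indicator {0<..} u *\<^sub>R (of_real u powr (of_real (Re z) - 1) * of_real (exp (- (pi * real (Suc n)) * u))))"
    proof (intro Bochner_Integration.integral_cong refl)
      fix u :: real
      have "complex_of_real u powr (of_real (Re z) - 1) = of_real (u powr (Re z - 1))" if "u > 0"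
        using that powr_of_real[of u "Re z - 1"] by simp
      then show "complex_of_real (norm (f n u)) = indicator {0<..} u *\<^sub>R (of_real u powr (of_real (Re z) - 1) * of_real (exp (- (pi * real (Suc n)) * u)))"
        by (cases "u > 0") (simp_all add: f_def norm_mult norm_of_real_powr)
    qed
    also have "\<dots> = Gamma (of_real (Re z)) * of_real (pi * real (Suc n)) powr (- of_real (Re z))"
      by (rule gamma_integral) (use z0 c in auto)
    finally have "norm (complex_of_real (LBINT u. norm (f n u))) = norm (Gamma (of_real (Re z)) * complex_of_real (pi * real (Suc n)) powr (- of_real (Re z)))"
      by simp
    then show ?thesis using c[of n] by (simp only: norm_mult norm_of_real_powr norm_of_real) (simp del: of_nat_Suc)
  qed
  have sum_pt: "(\<lambda>n. F n u) sums (indicator {0<..} u *\<^sub>R (of_real u powr (z - 1) * r2_theta u))"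
    and abs_pt: "summable (\<lambda>n. norm (F n u))" for u
  proof -
    show "(\<lambda>n. F n u) sums (indicator {0<..} u *\<^sub>R (of_real u powr (z - 1) * r2_theta u))"
    proof (cases "u > 0")
      case True
      have "(\<lambda>n. of_real u powr (z - 1) * complex_of_real (real (r2 (Suc n)) * exp (- (pi * real (Suc n)) * u))) sums
          (of_real u powr (z - 1) * of_real ((jacobi_theta u)\<^sup>2 - 1))"
        using r2_theta_sums[OF True] by (intro sums_mult) (simp only: sums_of_real_iff)
      then show ?thesis using True by (simp add: F_def f_def r2_theta_eq mult_ac del: of_nat_Suc)
    qed (simp add: F_def f_def)
    show "summable (\<lambda>n. norm (F n u))"
    proof (cases "u > 0")
      case True
      have "summable (\<lambda>n. u powr (Re z - 1) * (real (r2 (Suc n)) * exp (- (pi * real (Suc n)) * u)))"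
        using r2_theta_sums[OF True] by (intro summable_mult sums_summable)
      then show ?thesis using True by (simp add: F_def f_def norm_mult norm_of_real_powr mult_ac del: of_nat_Suc)
    qed (simp add: F_def f_def)
  qed
  have abs_int: "summable (\<lambda>n. LBINT u. norm (F n u))"
  proof -
    have "(LBINT u. norm (F n u)) = norm (Gamma (of_real (Re z)) :: complex) * pi powr (- Re z) * (real (r2 (Suc n)) * real (Suc n) powr (- Re z))" for n
      by (simp add: F_def norm_mult fn powr_mult del: of_nat_Suc)
    then show ?thesis using summable_r2_powr[OF z] by (simp add: summable_mult)
  qed
  have eq: "(\<lambda>u. \<Sum>n. F n u) = (\<lambda>u. indicator {0<..} u *\<^sub>R (of_real u powr (z - 1) * r2_theta u))"
    using sums_unique[OF sum_pt] by auto
  show "mellin_integrable r2_theta z"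
    unfolding mellin_integrable_def set_integrable_def eq [symmetric]
    by (rule integrable_suminf[OF Fi _ abs_int]) (simp add: abs_pt)
  have "(\<lambda>n. LBINT u. F n u) sums mellin r2_theta z"
    unfolding mellin_def set_lebesgue_integral_def eq [symmetric]
    by (rule sums_integral[OF Fi _ abs_int]) (simp add: abs_pt)
  moreover have "(LBINT u. F n u) = (of_real pi powr (- z) * Gamma z) * (of_nat (r2 (Suc n)) * of_nat (Suc n) powr (- z))" for n
    unfolding F_def integral_mult_right_zero fI
    using powr_times_real[of "of_real pi" "of_real (real (Suc n))" "- z"] by (simp del: of_nat_Suc)
  moreover have "(\<lambda>n. (of_real pi powr (- z) * Gamma z) * (of_nat (r2 (Suc n)) * of_nat (Suc n) powr (- z))) sums
      ((of_real pi powr (- z) * Gamma z) * (4 * riemann_zeta z * L_chi4 z))"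
    using z by (intro sums_mult r2_dirichlet_series) simp
  ultimately have "mellin r2_theta z = (of_real pi powr (- z) * Gamma z) * (4 * riemann_zeta z * L_chi4 z)"
    using sums_unique2 by simp
  then show "mellin r2_theta z = 4 * of_real pi powr (- z) * Gamma z * riemann_zeta z * L_chi4 z" by simp
qed

section \<open>The functional equation\<close>

lemma set_integral_inverse_real:
  fixes f :: "real \<Rightarrow> real"
  assumes i: "set_integrable lborel {0<..<1} f"
  shows "set_integrable lborel {1<..} (\<lambda>v. 1 / v\<^sup>2 * f (1 / v))"
    and "(LBINT u:{0<..<1}. f u) = (LBINT v:{1<..}. 1 / v\<^sup>2 * f (1 / v))"
proof -
  let ?h = "\<lambda>u. indicator {0<..<1} u *\<^sub>R f u"
  have hm: "?h \<in> borel_measurable borel"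
    using i unfolding set_integrable_def by (metis borel_measurable_integrable measurable_lborel2)
  have "f absolutely_integrable_on {0<..<1}"
    using i hm unfolding set_integrable_def by (simp add: integrable_completion)
  moreover have im: "(\<lambda>v. 1 / v) ` {1<..} = {0 :: real<..<1}"
  proof (intro equalityI subsetI)
    fix u :: real assume "u \<in> {0<..<1}"
    then show "u \<in> (\<lambda>v. 1 / v) ` {1<..}" by (intro image_eqI[of _ _ "1 / u"]) auto
  qed auto
  ultimately have "f absolutely_integrable_on ((\<lambda>v. 1 / v) ` {1<..}) \<and>
      integral ((\<lambda>v. 1 / v) ` {1<..}) f = integral {0<..<1} f" by simp
  moreover have "((\<lambda>v. 1 / v) has_field_derivative - (1 / v\<^sup>2)) (at v within {1<..})" if "v \<in> {1<..}" for v :: real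
    using that by (auto intro!: derivative_eq_intros simp: power2_eq_square)
  ultimately have *: "(\<lambda>v. \<bar>- (1 / v\<^sup>2)\<bar> * f (1 / v)) absolutely_integrable_on {1<..} \<and>
      integral {1<..} (\<lambda>v. \<bar>- (1 / v\<^sup>2)\<bar> * f (1 / v)) = integral {0<..<1} f"
    by (subst has_absolute_integral_change_of_variables_1') (auto simp: inj_on_def)
  then have ai: "(\<lambda>v. 1 / v\<^sup>2 * f (1 / v)) absolutely_integrable_on {1<..}"
    and eq: "integral {1<..} (\<lambda>v. 1 / v\<^sup>2 * f (1 / v)) = integral {0<..<1} f" by simp_all
  show i': "set_integrable lborel {1<..} (\<lambda>v. 1 / v\<^sup>2 * f (1 / v))"
  proof (rule set_integrable_lborel_if_absolutely_integrable[OF ai])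
    have "(\<lambda>v. indicator {1<..} v * (1 / v\<^sup>2 * ?h (1 / v))) \<in> borel_measurable borel"
      using hm by measurable
    also have "(\<lambda>v. indicator {1<..} v * (1 / v\<^sup>2 * ?h (1 / v))) = (\<lambda>v. indicator {1<..} v *\<^sub>R (1 / v\<^sup>2 * f (1 / v)))"
      by (auto simp: indicator_def fun_eq_iff)
    finally show "set_borel_measurable borel {1<..} (\<lambda>v. 1 / v\<^sup>2 * f (1 / v))"
      by (simp add: set_borel_measurable_def)
  qed
  show "(LBINT u:{0<..<1}. f u) = (LBINT v:{1<..}. 1 / v\<^sup>2 * f (1 / v))"
    using set_borel_integral_eq_integral(2)[OF i] set_borel_integral_eq_integral(2)[OF i'] eq by simp
qed

lemma set_integrable_complex_of_real:
  assumes "set_integrable M A f"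
  shows "set_integrable M A (\<lambda>x. complex_of_real (f x))"
proof -
  have "integrable M (\<lambda>x. complex_of_real (indicator A x *\<^sub>R f x))"
    using assms unfolding set_integrable_def by (rule integrable_of_real)
  also have "(\<lambda>x. complex_of_real (indicator A x *\<^sub>R f x)) = (\<lambda>x. indicator A x *\<^sub>R complex_of_real (f x))"
    by (simp add: fun_eq_iff indicator_def)
  finally show ?thesis unfolding set_integrable_def .
qed

lemma set_integral_inverse:
  fixes f :: "real \<Rightarrow> complex"
  assumes i: "set_integrable lborel {0<..<1} f"
  shows "(LBINT u:{0<..<1}. f u) = (LBINT v:{1<..}. of_real (1 / v\<^sup>2) * f (1 / v))"
proof -
  have iR: "set_integrable lborel {0<..<1} (\<lambda>u. Re (f u))" and iI: "set_integrable lborel {0<..<1} (\<lambda>u. Im (f u))"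
    using integrable_Re[OF i[unfolded set_integrable_def]] integrable_Im[OF i[unfolded set_integrable_def]]
    by (simp_all add: set_integrable_def)
  have jR: "set_integrable lborel {1<..} (\<lambda>v. 1 / v\<^sup>2 * Re (f (1 / v)))"
    and jI: "set_integrable lborel {1<..} (\<lambda>v. 1 / v\<^sup>2 * Im (f (1 / v)))"
    using set_integral_inverse_real(1)[OF iR] set_integral_inverse_real(1)[OF iI] by simp_all
  let ?k = "\<lambda>v. of_real (1 / v\<^sup>2) * f (1 / v)"
  have "set_integrable lborel {1<..} (\<lambda>v. of_real (1 / v\<^sup>2 * Re (f (1 / v))) + \<i> * of_real (1 / v\<^sup>2 * Im (f (1 / v))))"
    by (intro set_integral_add set_integrable_mult_right set_integrable_complex_of_real jR jI)
  also have "(\<lambda>v. of_real (1 / v\<^sup>2 * Re (f (1 / v))) + \<i> * of_real (1 / v\<^sup>2 * Im (f (1 / v)))) = ?k"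
    by (simp add: fun_eq_iff complex_eq_iff)
  finally have j: "set_integrable lborel {1<..} ?k" .
  show ?thesis
  proof (rule complex_eqI)
    have "Re (LBINT u:{0<..<1}. f u) = (LBINT u:{0<..<1}. Re (f u))"
      using integral_Re[OF i[unfolded set_integrable_def]] by (simp add: set_lebesgue_integral_def)
    also have "\<dots> = (LBINT v:{1<..}. Re (?k v))" using set_integral_inverse_real(2)[OF iR] by simp
    also have "\<dots> = Re (LBINT v:{1<..}. ?k v)"
      using integral_Re[OF j[unfolded set_integrable_def]] by (simp add: set_lebesgue_integral_def)
    finally show "Re (LBINT u:{0<..<1}. f u) = Re (LBINT v:{1<..}. ?k v)" .
    have "Im (LBINT u:{0<..<1}. f u) = (LBINT u:{0<..<1}. Im (f u))"
      using integral_Im[OF i[unfolded set_integrable_def]] by (simp add: set_lebesgue_integral_def)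
    also have "\<dots> = (LBINT v:{1<..}. Im (?k v))" using set_integral_inverse_real(2)[OF iI] by simp
    also have "\<dots> = Im (LBINT v:{1<..}. ?k v)"
      using integral_Im[OF j[unfolded set_integrable_def]] by (simp add: set_lebesgue_integral_def)
    finally show "Im (LBINT u:{0<..<1}. f u) = Im (LBINT v:{1<..}. ?k v)" .
  qed
qed

definition r2_theta_tail :: "real \<Rightarrow> complex" where
  "r2_theta_tail u = indicator {1..} u *\<^sub>R r2_theta u"

lemma r2_theta_tail_measurable [measurable]: "r2_theta_tail \<in> borel_measurable borel"
  unfolding r2_theta_tail_def by measurable

text \<open>On [1, oo) a larger real part only enlarges the integrand, so convergence far to the
  right gives convergence everywhere; the cut-off at 1 is what makes the transform entire.\<close>

lemma mellin_r2_theta_tail_integrable: "mellin_integrable r2_theta_tail z"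
proof -
  define a where "a = max 4 (Re z)"
  have sm: "set_borel_measurable borel {0<..} r2_theta" "set_borel_measurable borel {0<..} r2_theta_tail"
    by (simp_all add: set_borel_measurable_def)
  have "mellin_integrable r2_theta (of_real a)"
    by (rule mellin_r2_theta_integrable) (simp add: a_def)
  then have ia: "set_integrable lborel {0<..} (\<lambda>u. u powr (a - 1) * norm (r2_theta u))"
    by (simp add: mellin_integrable_norm_iff[OF sm(1)])
  have "set_integrable lborel {0<..} (\<lambda>u. u powr (Re z - 1) * norm (r2_theta_tail u))"
  proof (rule set_integrable_bound[OF ia])
    have "norm (u powr (Re z - 1) * norm (r2_theta_tail u)) \<le> norm (u powr (a - 1) * norm (r2_theta u))" for u
      by (auto simp: r2_theta_tail_def indicator_def a_def intro!: mult_right_mono powr_mono)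
    then show "AE u in lborel. u \<in> {0<..} \<longrightarrow>
        norm (u powr (Re z - 1) * norm (r2_theta_tail u)) \<le> norm (u powr (a - 1) * norm (r2_theta u))"
      by simp
  qed (simp add: set_borel_measurable_def)
  then show ?thesis by (simp add: mellin_integrable_norm_iff[OF sm(2)])
qed

lemma mellin_r2_theta_tail_holomorphic: "mellin r2_theta_tail holomorphic_on A"
proof -
  have "mellin r2_theta_tail field_differentiable at z" for z
  proof -
    have "mellin r2_theta_tail holomorphic_on {w. Re z - 1 < Re w \<and> Re w < Re z + 1}"
      by (intro mellin_holomorphic_strip mellin_r2_theta_tail_integrable) (simp add: set_borel_measurable_def)
    from holomorphic_on_imp_differentiable_at[OF this open_Re_strip, of z] show ?thesis by simp
  qed
  then show ?thesis by (auto simp: holomorphic_on_def intro: field_differentiable_at_within)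
qed

text \<open>The entire part of the completed function, in Riemann's form; the symmetry of the
  functional equation is visible in the definition.\<close>

definition r2_entire :: "complex \<Rightarrow> complex" where
  "r2_entire z = mellin r2_theta_tail z + mellin r2_theta_tail (1 - z)"

lemma r2_entire_reflect: "r2_entire (1 - z) = r2_entire z"
  by (simp add: r2_entire_def)

lemma r2_entire_holomorphic: "r2_entire holomorphic_on A"
proof -
  have "(mellin r2_theta_tail \<circ> (\<lambda>z. 1 - z)) holomorphic_on A"
    by (rule holomorphic_on_compose_gen[OF _ mellin_r2_theta_tail_holomorphic]) (auto intro!: holomorphic_intros)
  then show ?thesis unfolding r2_entire_def [abs_def]
    by (auto simp: o_def intro!: holomorphic_intros mellin_r2_theta_tail_holomorphic)
qed

lemma set_integral_open_closed_halfline: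
  fixes f :: "real \<Rightarrow> complex"
  assumes "f \<in> borel_measurable borel"
  shows "(LBINT v:{a<..}. f v) = (LBINT v:{a..}. f v)"
  unfolding set_lebesgue_integral_def
proof (rule integral_cong_AE)
  have "AE v in lborel. v \<noteq> a" by (rule AE_lborel_singleton)
  then show "AE v in lborel. indicator {a<..} v *\<^sub>R f v = indicator {a..} v *\<^sub>R f v"
    by eventually_elim (auto simp: indicator_def)
qed (use assms in measurable)

text \<open>Riemann's argument: the integral is cut at 1 and inverted on (0, 1). The homogeneous
  part of the transformation gives the tail transform at 1 - z; of the inhomogeneity, u contributes
  1 / (z - 1) and -1 contributes -1 / z.\<close>

lemma mellin_r2_theta_split:
  assumes z: "Re z > 3"
  shows "mellin r2_theta z = r2_entire z + 1 / (z - 1) - 1 / z"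
proof -
  let ?p = "\<lambda>u. complex_of_real u powr (z - 1) * r2_theta u"
  have i: "set_integrable lborel {0<..} ?p"
    using mellin_r2_theta_integrable[OF z] by (simp add: mellin_integrable_def)
  have i0: "set_integrable lborel {0<..<1} ?p" and i1: "set_integrable lborel {1..} ?p"
    by (rule set_integrable_subset[OF i]; auto)+
  have un: "{0<..} = {0<..<1} \<union> {1 :: real..}" by auto
  have "mellin r2_theta z = (LBINT u:{0<..<1} \<union> {1..}. ?p u)" unfolding mellin_def un ..
  also have "\<dots> = (LBINT u:{0<..<1}. ?p u) + (LBINT u:{1..}. ?p u)"
    by (rule set_integral_Un[OF _ i0 i1]) auto
  also have "(LBINT u:{1..}. ?p u) = mellin r2_theta_tail z"
    unfolding mellin_def set_lebesgue_integral_def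
    by (intro Bochner_Integration.integral_cong) (auto simp: r2_theta_tail_def indicator_def)
  also have "(LBINT u:{0<..<1}. ?p u) = (LBINT v:{1<..}. of_real (1 / v\<^sup>2) * ?p (1 / v))"
    by (rule set_integral_inverse[OF i0])
  also have "\<dots> = (LBINT v:{1..}. of_real (1 / v\<^sup>2) * ?p (1 / v))"
    by (rule set_integral_open_closed_halfline) measurable
  also have "\<dots> = (LBINT v:{1..}. (of_real v powr ((1 - z) - 1) * r2_theta_tail v + of_real v powr (- (z - 1) - 1))
      - of_real v powr (- z - 1))"
  proof (intro set_lebesgue_integral_cong allI impI)
    fix v :: real assume "v \<in> {1..}"
    then have v: "v \<ge> 1" "v > 0" by auto
    have "complex_of_real (1 / v) powr (z - 1) = of_real v powr (1 - z)"
      using v by (simp add: powr_def Ln_of_real ln_div algebra_simps flip: of_real_divide)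
    moreover have "complex_of_real v powr (1 - z) = of_real v powr (- z - 1) * of_real v ^ 2"
      using v by (simp add: powr_def exp_add [symmetric] exp_diff field_simps power2_eq_square exp_minus)
    moreover have "complex_of_real v powr (- z) = of_real v powr (- z - 1) * of_real v"
      using v by (simp add: powr_diff)
    ultimately show "of_real (1 / v\<^sup>2) * ?p (1 / v) = (of_real v powr ((1 - z) - 1) * r2_theta_tail v + of_real v powr (- (z - 1) - 1)) - of_real v powr (- z - 1)"
      using v by (simp add: r2_theta_inverse r2_theta_tail_def field_simps)
  qed auto
  also have "\<dots> = (LBINT v:{1..}. of_real v powr ((1 - z) - 1) * r2_theta_tail v) + (LBINT v:{1..}. of_real v powr (- (z - 1) - 1))
      - (LBINT v:{1..}. of_real v powr (- z - 1))"
  proof -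
    have "set_integrable lborel {1..} (\<lambda>v. complex_of_real v powr ((1 - z) - 1) * r2_theta_tail v)"
      by (rule set_integrable_subset[OF mellin_r2_theta_tail_integrable[unfolded mellin_integrable_def]]) auto
    moreover have "set_integrable lborel {1..} (\<lambda>v. complex_of_real v powr (- (z - 1) - 1))"
      using set_integrable_powr_atLeast_complex[of z 1] z by simp
    moreover have "set_integrable lborel {1..} (\<lambda>v. complex_of_real v powr (- z - 1))"
      using set_integrable_powr_atLeast_complex[of "z + 1" 1] z by simp
    ultimately show ?thesis by (simp only: set_integral_diff set_integral_add)
  qed
  also have "(LBINT v:{1..}. of_real v powr ((1 - z) - 1) * r2_theta_tail v) = mellin r2_theta_tail (1 - z)"
    unfolding mellin_def set_lebesgue_integral_def
    by (intro Bochner_Integration.integral_cong) (auto simp: r2_theta_tail_def indicator_def)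
  also have "(LBINT v:{1..}. complex_of_real v powr (- (z - 1) - 1)) = 1 / (z - 1)"
    using z by (subst set_integral_powr_atLeast_complex) auto
  also have "(LBINT v:{1..}. complex_of_real v powr (- z - 1)) = 1 / z"
    using z by (subst set_integral_powr_atLeast_complex) auto
  finally show ?thesis by (simp add: r2_entire_def algebra_simps)
qed

text \<open>The Mellin transform of the theta series proves this for Re z > 3, and the identity
  theorem extends it. Moving Gamma to the right as \<open>rGamma\<close> makes both sides
  holomorphic on the plane without 0 and 1.\<close>

theorem zeta_mult_L_chi4:
  assumes z: "z \<noteq> 0" "z \<noteq> 1"
  shows "4 * riemann_zeta z * L_chi4 z = rGamma z * (of_real pi powr z * (r2_entire z + 1 / (z - 1) - 1 / z))"
proof (rule analytic_continuation_open[of "{s. Re s > 3}" "UNIV - {0, 1}"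
    "\<lambda>z. 4 * riemann_zeta z * L_chi4 z"
    "\<lambda>z. rGamma z * (of_real pi powr z * (r2_entire z + 1 / (z - 1) - 1 / z))"])
  show "{s. Re s > 3} \<noteq> {}" by (auto intro!: exI[of _ 4])
  show "connected (UNIV - {0, 1 :: complex})" by (intro connected_open_delete_finite) auto
  show "(\<lambda>z. 4 * riemann_zeta z * L_chi4 z) holomorphic_on UNIV - {0, 1}"
    by (intro holomorphic_intros holomorphic_on_subset[OF riemann_zeta_holomorphic]
        holomorphic_on_subset[OF L_chi4_holomorphic]) auto
  show "(\<lambda>z. rGamma z * (of_real pi powr z * (r2_entire z + 1 / (z - 1) - 1 / z))) holomorphic_on UNIV - {0, 1}"
    by (intro holomorphic_intros r2_entire_holomorphic) auto
  show "4 * riemann_zeta w * L_chi4 w = rGamma w * (of_real pi powr w * (r2_entire w + 1 / (w - 1) - 1 / w))"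
    if "w \<in> {s. Re s > 3}" for w
  proof -
    have w: "Re w > 3" using that by simp
    have "w \<notin> \<int>\<^sub>\<le>\<^sub>0" using w by (auto elim!: nonpos_Ints_cases)
    then have "rGamma w * Gamma w = 1" by (simp add: rGamma_inverse_Gamma Gamma_eq_zero_iff)
    moreover have "complex_of_real pi powr w * of_real pi powr (- w) = 1" by (simp add: powr_add [symmetric])
    moreover have "r2_entire w + 1 / (w - 1) - 1 / w = 4 * of_real pi powr (- w) * Gamma w * riemann_zeta w * L_chi4 w"
      using mellin_r2_theta_split[OF w] mellin_r2_theta[OF w] by simp
    then have "rGamma w * (of_real pi powr w * (r2_entire w + 1 / (w - 1) - 1 / w))
        = (rGamma w * Gamma w) * (of_real pi powr w * of_real pi powr (- w)) * (4 * riemann_zeta w * L_chi4 w)"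
      by (simp only: mult_ac)
    ultimately show ?thesis by simp
  qed
qed (use z in \<open>auto intro: open_halfspace_Re_gt\<close>)

section \<open>The summation formula\<close>

text \<open>The product 4 Gamma zeta L with its removable singularities filled in. The power of pi
  undoes the factor under which the completed function is symmetric, so the symmetry holds for
  pi^(-z) times this function.\<close>

definition r2_xi :: "complex \<Rightarrow> complex" where
  "r2_xi z = of_real pi powr z * (r2_entire z + 1 / (z - 1) - 1 / z)"

lemma r2_xi_holomorphic: "r2_xi holomorphic_on - {0, 1}"
  unfolding r2_xi_def [abs_def] by (intro holomorphic_intros r2_entire_holomorphic) auto

lemma r2_xi_eq_zeta_L:
  assumes "z \<noteq> 1" "z \<notin> \<int>\<^sub>\<le>\<^sub>0"
  shows "4 * Gamma z * riemann_zeta z * L_chi4 z = r2_xi z"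
proof -
  have z0: "z \<noteq> 0" using assms(2) by auto
  have g: "Gamma z * rGamma z = 1" using assms(2) by (simp add: rGamma_inverse_Gamma Gamma_eq_zero_iff)
  have "4 * Gamma z * riemann_zeta z * L_chi4 z = Gamma z * (4 * riemann_zeta z * L_chi4 z)" by simp
  also have "\<dots> = (Gamma z * rGamma z) * r2_xi z"
    unfolding zeta_mult_L_chi4[OF z0 assms(1)] r2_xi_def by (simp only: mult.assoc)
  finally show ?thesis by (simp add: g)
qed

lemma eventually_not_Ints: "eventually (\<lambda>w. w \<notin> \<int>) (at (s :: complex))"
proof -
  have "closed (\<int> - {s})" by (rule closed_subset_Ints) auto
  then have "open (- (\<int> - {s}))" by (rule open_Compl)
  then have "eventually (\<lambda>w. w \<in> - (\<int> - {s})) (nhds s)"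
    by (rule eventually_nhds_in_open) simp
  then show ?thesis unfolding eventually_at_filter by eventually_elim auto
qed

lemma isCont_r2_xi:
  assumes "z \<noteq> 0" "z \<noteq> 1"
  shows "isCont r2_xi z"
proof -
  have "open (- {0, 1 :: complex})" by (intro open_Compl finite_imp_closed) simp
  then show ?thesis
    using holomorphic_on_imp_continuous_on[OF r2_xi_holomorphic] assms
    by (simp add: continuous_on_eq_continuous_at)
qed

text \<open>Off the integers the product is r2_xi(-w) / 4, and a punctured neighbourhood of s
  contains no integers near s. Continuity of \<open>r2_xi\<close> at -s then supplies the limit,
  also at the positive integers, where Gamma(-w) has a pole.\<close>

lemma remove_sings_Gamma_zeta_L:
  assumes s: "Re s > 0"
  shows "remove_sings (\<lambda>w. Gamma (- w) * riemann_zeta (- w) * L_chi4 (- w)) s = r2_xi (- s) / 4"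
proof (rule remove_sings_eqI)
  have s0: "- s \<noteq> 0" "- s \<noteq> 1" using s by (auto simp: complex_eq_iff)
  have "isCont (\<lambda>w. r2_xi (- w)) s"
    using isCont_o2[of s uminus r2_xi] isCont_r2_xi[OF s0] by (simp add: continuous_minus)
  then have l: "(\<lambda>w. r2_xi (- w) / 4) \<midarrow>s\<rightarrow> r2_xi (- s) / 4"
    unfolding isCont_def by (intro tendsto_divide) auto
  have ev: "\<forall>\<^sub>F w in at s. r2_xi (- w) / 4 = Gamma (- w) * riemann_zeta (- w) * L_chi4 (- w)"
    using eventually_not_Ints
  proof eventually_elim
    case (elim w)
    then have "- w \<notin> \<int>" by (simp add: minus_in_Ints_iff)
    then have "- w \<noteq> 1" "- w \<notin> \<int>\<^sub>\<le>\<^sub>0" using nonpos_Ints_subset_Ints by (force, blast)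
    then show ?case using r2_xi_eq_zeta_L[of "- w", symmetric] by simp
  qed
  show "(\<lambda>w. Gamma (- w) * riemann_zeta (- w) * L_chi4 (- w)) \<midarrow>s\<rightarrow> r2_xi (- s) / 4"
    by (rule Lim_transform_eventually[OF l ev])
qed

text \<open>Evaluate the product of the two completed functions at s + 1 by the duplication formula,
  then apply the symmetry under z -> 1 - z at z = -s. The factor pi^s left over is compensated by
  the power of -t / pi in the second integral.\<close>

lemma xi_mult_xi4_reflect:
  assumes s: "Re s > 0"
  shows "xi (s + 1) * xi4 (s + 1) = of_real pi powr s * r2_xi (- s) / 2"
proof -
  have "s + 1 \<notin> \<int>\<^sub>\<le>\<^sub>0" using s by (auto elim!: nonpos_Ints_cases simp: complex_eq_iff)
  moreover have s0: "s \<noteq> 0" "- s - 1 \<noteq> 0" using s by (auto simp: complex_eq_iff)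
  ultimately have "xi (s + 1) * xi4 (s + 1) = of_real pi powr (- (s + 1)) * r2_xi (s + 1) / 2"
    using xi_mult_xi4[of "s + 1"] r2_xi_eq_zeta_L[of "s + 1", symmetric] by simp
  also have "\<dots> = (of_real pi powr (- (s + 1)) * of_real pi powr (s + 1)) * (r2_entire (s + 1) + 1 / s - 1 / (s + 1)) / 2"
    by (simp add: r2_xi_def)
  also have "of_real pi powr (- (s + 1)) * complex_of_real pi powr (s + 1) = of_real pi powr s * of_real pi powr (- s)"
    unfolding powr_add [symmetric] by simp
  also have "r2_entire (s + 1) = r2_entire (- s)" using r2_entire_reflect[of "- s"] by (simp add: add.commute)
  also have "r2_entire (- s) + 1 / s - 1 / (s + 1) = r2_entire (- s) + 1 / (- s - 1) - 1 / (- s)"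
  proof -
    have "- s - 1 = - (s + 1)" by simp
    then show ?thesis by (simp only: minus_divide_right [symmetric]) simp
  qed
  finally show ?thesis by (simp only: r2_xi_def mult.assoc)
qed

section \<open>The contour shift for a fixed Schwartz function, with x = -t\<close>

locale schwartz_summation =
  fixes F :: "real \<Rightarrow> complex" and x :: real
  assumes F: "F \<in> schwartz_halfline" and x: "x > 0"
begin

sublocale decreasing_derivatives "reflected_deriv F"
  by (rule decreasing_derivatives_reflected_deriv[OF F])

text \<open>Four times the integrand of the first integral, in the variable z = -s that is natural
  for Mellin transforms.\<close>

definition integrand :: "complex \<Rightarrow> complex" where
  "integrand z = r2_xi z * complex_deriv_at_0 F (- z) * of_real x powr (- z)"

lemma deriv_reflected_holomorphic: "(\<lambda>z. complex_deriv_at_0 F (- z)) holomorphic_on A"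
proof -
  have "(complex_deriv_at_0 F \<circ> uminus) holomorphic_on A"
    by (rule holomorphic_on_compose_gen[OF _ complex_deriv_at_0_holomorphic[OF F]]) (auto intro!: holomorphic_intros)
  then show ?thesis by (simp add: o_def)
qed

lemma integrand_holomorphic: "integrand holomorphic_on - {0, 1}"
  unfolding integrand_def [abs_def] using x
  by (intro holomorphic_intros r2_xi_holomorphic deriv_reflected_holomorphic) auto

text \<open>Gamma(z) cancels against the reciprocal Gamma in the derivative of complex order up to 1
  / \<open>pochhammer z k\<close>. The decay in Im z can then be read off from the k linear
  factors.\<close>

lemma integrand_eq_mellin:
  assumes z: "z \<noteq> 1" "z \<notin> \<int>\<^sub>\<le>\<^sub>0" and k: "Re z > - real k"
  shows "integrand z = 4 * (riemann_zeta z * L_chi4 z) * (mellin (reflected_deriv F k) (of_nat k + z) / pochhammer z k)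
    * of_real x powr (- z)"
proof -
  have g: "Gamma z * rGamma z = 1" using z(2) by (simp add: rGamma_inverse_Gamma Gamma_eq_zero_iff)
  have "pochhammer z k \<noteq> 0" using z(2) by (auto simp: pochhammer_eq_0_iff)
  then have "Gamma z * rGamma (of_nat k + z) = 1 / pochhammer z k"
    using g pochhammer_rGamma[of z k] by (simp add: add.commute field_simps)
  moreover have "complex_deriv_at_0 F (- z) = rGamma (of_nat k + z) * mellin (reflected_deriv F k) (of_nat k + z)"
    using complex_deriv_at_0_eq[OF F, of "- z" k] k by simp
  ultimately have "Gamma z * complex_deriv_at_0 F (- z) = mellin (reflected_deriv F k) (of_nat k + z) / pochhammer z k"
    by (simp add: mult.assoc [symmetric])
  moreover have "integrand z = 4 * (riemann_zeta z * L_chi4 z) * (Gamma z * complex_deriv_at_0 F (- z)) * of_real x powr (- z)"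
    unfolding integrand_def r2_xi_eq_zeta_L[OF z, symmetric] by (simp only: mult_ac)
  ultimately show ?thesis by simp
qed

text \<open>Polynomial growth of the \<open>L\<close>-functions is beaten by \<open>k\<close>-fold partial integration in the Mellin
  transform.\<close>

lemma integrand_bound:
  assumes c: "c > 0"
  obtains C where "C \<ge> 0"
    "\<And>z. - c \<le> Re z \<Longrightarrow> Re z \<le> 4 \<Longrightarrow> \<bar>Im z\<bar> \<ge> 1 \<Longrightarrow> norm (integrand z) \<le> C / (1 + (Im z)\<^sup>2)"
proof -
  have "strip_polynomial_bound {s. \<bar>Im s\<bar> \<ge> 1} (- c) (\<lambda>z. riemann_zeta z * L_chi4 z)"
    by (intro strip_polynomial_bound_mult riemann_zeta_bound strip_polynomial_bound_subset[OF L_chi4_bound]) auto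
  then obtain C1 N where C1: "\<And>z. \<bar>Im z\<bar> \<ge> 1 \<Longrightarrow> - c \<le> Re z \<Longrightarrow> Re z \<le> 4 \<Longrightarrow>
      norm (riemann_zeta z * L_chi4 z) \<le> C1 * (1 + norm z) ^ N"
    unfolding strip_polynomial_bound_def by (metis (mono_tags, lifting) mem_Collect_eq)
  \<comment> \<open>N + 2 factors beat the growth of degree N and leave quadratic decay; the
    remaining ones ensure Re (k + z) >= 1 on the strip, where the Mellin transform is uniformly
    bounded.\<close>
  define k where "k = N + 2 + nat \<lceil>c + 1\<rceil>"
  have k: "k \<ge> N + 2" "real k \<ge> c + 1" unfolding k_def by (simp, linarith)
  obtain C2 where C2: "\<And>z. - c \<le> Re z \<Longrightarrow> Re z \<le> 4 \<Longrightarrow>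
      norm (mellin (reflected_deriv F k) (of_nat k + z)) \<le> C2"
  proof -
    have "mellin_integrable (reflected_deriv F k) (of_real 1)"
      "mellin_integrable (reflected_deriv F k) (of_real (real k + 4))"
      by (rule rapidly_decreasing_mellin_integrable[OF decr]; simp)+
    from mellin_integrable_between(2)[OF rapidly_decreasing_measurable[OF decr] this]
    show ?thesis by (rule that) (use k in auto)
  qed
  define B where "B = \<bar>C1\<bar> * (c + 6) ^ N * \<bar>C2\<bar> * (x powr c + x powr (- 4))"
  have bound: "norm (integrand z) \<le> (8 * B) / (1 + (Im z)\<^sup>2)" if z: "- c \<le> Re z" "Re z \<le> 4" "\<bar>Im z\<bar> \<ge> 1" for z
  proof -
    define y where "y = \<bar>Im z\<bar>"
    have y: "y \<ge> 1" using z by (simp add: y_def)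
    have zi: "z \<noteq> 1" "z \<notin> \<int>\<^sub>\<le>\<^sub>0" using z(3) by (auto elim!: nonpos_Ints_cases)
    \<comment> \<open>Since y >= 1, the bounded real part, at most c + 4 in modulus, can be absorbed
      into a multiple of y.\<close>
    have nz: "1 + norm z \<le> (c + 6) * y"
    proof -
      have "norm z \<le> \<bar>Re z\<bar> + y" unfolding y_def by (rule cmod_le)
      moreover have "\<bar>Re z\<bar> \<le> c + 4" using z c by (simp add: abs_le_iff)
      ultimately have "1 + norm z \<le> (c + 5) * 1 + 1 * y" by argo
      also have "\<dots> \<le> (c + 5) * y + 1 * y" using y c by (intro add_mono mult_left_mono) auto
      finally show ?thesis by (simp add: algebra_simps)
    qed
    have "norm (riemann_zeta z * L_chi4 z) \<le> C1 * (1 + norm z) ^ N" using z by (intro C1) auto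
    also have "\<dots> \<le> \<bar>C1\<bar> * ((c + 6) * y) ^ N"
      using nz by (intro mult_mono power_mono) (auto intro: add_nonneg_nonneg)
    finally have 1: "norm (riemann_zeta z * L_chi4 z) \<le> \<bar>C1\<bar> * (c + 6) ^ N * y ^ N"
      by (simp add: power_mult_distrib)
    have "y ^ k \<le> norm (pochhammer z k)"
    proof -
      have "(\<Prod>i<k. y) \<le> (\<Prod>i<k. norm (z + of_nat i))"
      proof (intro prod_mono)
        fix i show "0 \<le> y \<and> y \<le> norm (z + of_nat i)"
          using abs_Im_le_cmod[of "z + of_nat i"] by (simp add: y_def)
      qed
      then show ?thesis by (simp add: pochhammer_prod prod_norm atLeast0LessThan)
    qed
    then have 2: "norm (mellin (reflected_deriv F k) (of_nat k + z) / pochhammer z k) \<le> \<bar>C2\<bar> / y ^ k"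
      unfolding norm_divide using C2[OF z(1,2)] y by (intro frac_le) auto
    have "x powr (- Re z) \<le> x powr (- 4) + x powr c" using x z by (intro powr_le_add_powr) auto
    then have 3: "norm (of_real x powr (- z) :: complex) \<le> x powr c + x powr (- 4)"
      using x by (simp add: norm_of_real_powr add.commute)
    have integrand_z: "integrand z = 4 * (riemann_zeta z * L_chi4 z) * (mellin (reflected_deriv F k) (of_nat k + z) / pochhammer z k)
        * of_real x powr (- z)" by (rule integrand_eq_mellin[OF zi]) (use k z in linarith)
    have "norm (integrand z) = 4 * (norm (riemann_zeta z * L_chi4 z) *
        norm (mellin (reflected_deriv F k) (of_nat k + z) / pochhammer z k) * norm (of_real x powr (- z) :: complex))"
      unfolding integrand_z by (simp only: norm_mult norm_numeral mult.assoc)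
    also have "\<dots> \<le> 4 * ((\<bar>C1\<bar> * (c + 6) ^ N * y ^ N) * (\<bar>C2\<bar> / y ^ k) * (x powr c + x powr (- 4)))"
      using 1 2 3 y c by (intro mult_mono mult_nonneg_nonneg add_nonneg_nonneg) auto
    also have "\<dots> = 4 * B * (y ^ N / y ^ k)" by (simp add: B_def)
    also have "\<dots> \<le> 4 * B * (2 / (1 + y\<^sup>2))"
    proof (intro mult_left_mono)
      have "y ^ N / y ^ k \<le> 1 / y\<^sup>2"
      proof -
        have "y ^ N * y\<^sup>2 \<le> y ^ k" unfolding power_add [symmetric] using y k by (intro power_increasing) auto
        then show ?thesis using y by (simp add: field_simps)
      qed
      also have "1 / y\<^sup>2 \<le> 2 / (1 + y\<^sup>2)"
      proof -
        have "1 \<le> y\<^sup>2" using y by (simp add: one_le_power)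
        have "1 / y\<^sup>2 = 2 / (2 * y\<^sup>2)" by simp
        also have "\<dots> \<le> 2 / (1 + y\<^sup>2)" using \<open>1 \<le> y\<^sup>2\<close> by (intro frac_le) (auto intro: add_pos_nonneg)
        finally show ?thesis .
      qed
      finally show "y ^ N / y ^ k \<le> 2 / (1 + y\<^sup>2)" .
      show "0 \<le> 4 * B" using c by (simp add: B_def)
    qed
    finally show ?thesis by (simp add: y_def)
  qed
  have "8 * B \<ge> 0" using c by (simp add: B_def)
  then show ?thesis using bound by (rule that)
qed

text \<open>For |y| >= 1 the quadratic decay applies; for |y| <= 1 the integrand is continuous
  because both lines avoid the poles, and the factor 2 accounts for 1 + y^2 <= 2.\<close>

lemma integrand_line_integrable:
  assumes c: "c > 0" and a: "a = - c \<or> a = 4"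
  shows "integrable lborel (\<lambda>y. integrand (Complex a y))"
proof -
  obtain C where C: "C \<ge> 0" "\<And>z. - c \<le> Re z \<Longrightarrow> Re z \<le> 4 \<Longrightarrow> \<bar>Im z\<bar> \<ge> 1 \<Longrightarrow> norm (integrand z) \<le> C / (1 + (Im z)\<^sup>2)"
    using integrand_bound[OF c] by blast
  have cont: "continuous_on UNIV (\<lambda>y. integrand (Complex a y))"
    using a c by (intro continuous_on_compose2[OF holomorphic_on_imp_continuous_on[OF integrand_holomorphic]] continuous_intros)
      (auto simp: complex_eq_iff)
  have "compact ((\<lambda>y. integrand (Complex a y)) ` {- 1..1})"
    by (intro compact_continuous_image continuous_on_subset[OF cont]) auto
  then obtain B where B: "\<And>y. y \<in> {- 1..1} \<Longrightarrow> norm (integrand (Complex a y)) \<le> B"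
    by (meson compact_imp_bounded bounded_iff imageI)
  have B0: "B \<ge> 0" using order.trans[OF norm_ge_zero B[of 0]] by simp
  have pos: "1 + y\<^sup>2 > 0" for y :: real by (simp add: add_pos_nonneg)
  show ?thesis
  proof (rule integrable_vertical_line[OF cont])
    fix y
    show "norm (integrand (Complex a y)) \<le> (C + 2 * B) / (1 + y\<^sup>2)"
    proof (cases "\<bar>y\<bar> \<ge> 1")
      case True
      then have "norm (integrand (Complex a y)) \<le> C / (1 + y\<^sup>2)" using C(2)[of "Complex a y"] a c by auto
      also have "\<dots> \<le> (C + 2 * B) / (1 + y\<^sup>2)" using B0 pos[of y] by (intro divide_right_mono) auto
      finally show ?thesis .
    next
      case False
      then have "y\<^sup>2 \<le> 1" by (simp add: abs_square_le_1)
      then have "B * (1 + y\<^sup>2) \<le> B * 2" using B0 by (intro mult_left_mono) auto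
      then have "B \<le> (C + 2 * B) / (1 + y\<^sup>2)" using C(1) pos[of y] by (simp add: le_divide_eq)
      moreover have "norm (integrand (Complex a y)) \<le> B" using False by (intro B) auto
      ultimately show ?thesis by linarith
    qed
  qed
qed

text \<open>The poles are those of 1 / (z - 1) and -1 / z, the remaining factors being entire. At 0
  they contribute the value F(0), at 1 the factor pi from pi^z, 1 / x from x^(-z) and the derivative
  of order -1.\<close>

lemma residue_integrand:
  shows "residue integrand 0 = - F 0" and "residue integrand 1 = of_real (pi / x) * complex_deriv_at_0 F (- 1)"
proof -
  define N where "N z = of_real pi powr z * complex_deriv_at_0 F (- z) * of_real x powr (- z)" for z
  have Nh: "N holomorphic_on A" for A
    unfolding N_def using x by (intro holomorphic_intros deriv_reflected_holomorphic) auto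
  have integrand_N: "integrand z = N z * (r2_entire z + 1 / (z - 1) - 1 / z)" for z by (simp add: integrand_def N_def r2_xi_def mult_ac)
  have "residue integrand 0 = residue (\<lambda>z. (N z * ((r2_entire z + 1 / (z - 1)) * z - 1)) / (z - 0)) 0"
  proof (rule residue_cong[OF _ refl])
    show "\<forall>\<^sub>F z in at 0. integrand z = (N z * ((r2_entire z + 1 / (z - 1)) * z - 1)) / (z - 0)"
      using eventually_neq_at_within[of 0] by eventually_elim (simp add: integrand_N diff_divide_distrib right_diff_distrib)
  qed
  also have "\<dots> = N 0 * ((r2_entire 0 + 1 / (0 - 1)) * 0 - 1)"
    by (rule residue_simple[of "- {1}"]) (auto intro!: holomorphic_intros Nh r2_entire_holomorphic)
  finally show "residue integrand 0 = - F 0" using x by (simp add: N_def complex_deriv_at_0_0[OF F])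
  have "residue integrand 1 = residue (\<lambda>z. (N z * ((r2_entire z - 1 / z) * (z - 1) + 1)) / (z - 1)) 1"
  proof (rule residue_cong[OF _ refl])
    show "\<forall>\<^sub>F z in at 1. integrand z = (N z * ((r2_entire z - 1 / z) * (z - 1) + 1)) / (z - 1)"
      using eventually_neq_at_within[of 1]
    proof eventually_elim
      case (elim z)
      have "N z * (a * (z - 1) + 1) / (z - 1) = N z * (a + 1 / (z - 1))" for a
        using elim by (simp add: divide_simps)
      from this[of "r2_entire z - 1 / z"] show ?case by (simp add: integrand_N algebra_simps)
    qed
  qed
  also have "\<dots> = N 1 * ((r2_entire 1 - 1 / 1) * (1 - 1) + 1)"
    by (rule residue_simple[of "- {0}"]) (auto intro!: holomorphic_intros Nh r2_entire_holomorphic)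
  finally show "residue integrand 1 = of_real (pi / x) * complex_deriv_at_0 F (- 1)"
    using x by (simp add: N_def powr_minus divide_inverse mult_ac)
qed

lemma integrand_line_shift:
  assumes c: "c > 0"
  shows "(LBINT y. integrand (Complex 4 y)) - (LBINT y. integrand (Complex (- c) y))
    = 2 * of_real pi * (of_real (pi / x) * complex_deriv_at_0 F (- 1) - F 0)"
proof -
  obtain C where C: "C \<ge> 0" "\<And>z. - c \<le> Re z \<Longrightarrow> Re z \<le> 4 \<Longrightarrow> \<bar>Im z\<bar> \<ge> 1 \<Longrightarrow> norm (integrand z) \<le> C / (1 + (Im z)\<^sup>2)"
    using integrand_bound[OF c] by blast
  have "(\<lambda>n :: nat. 2 * of_real pi * (\<Sum>p\<in>{0, 1}. residue integrand p)) \<longlonglongrightarrow>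
      (LBINT y. integrand (Complex 4 y)) - (LBINT y. integrand (Complex (- c) y))"
  proof (rule vertical_line_shift[where T = "\<lambda>n. real n + 1" and S = "\<lambda>_. UNIV" and P = "\<lambda>_. {0, 1}"
        and M = "\<lambda>n. C / (1 + (real n + 1)\<^sup>2)"])
    show "filterlim (\<lambda>n. real n + 1) at_top sequentially" by real_asymp
    show "{0, 1} \<subseteq> box (Complex (- c) (- (real n + 1))) (Complex 4 (real n + 1))" for n
      using c by (auto simp: in_box_complex_iff)
    show "integrand holomorphic_on UNIV - {0, 1}" using integrand_holomorphic by (simp add: Compl_eq_Diff_UNIV)
    show "norm (integrand (Complex u (real n + 1))) \<le> C / (1 + (real n + 1)\<^sup>2)"
      if "u \<in> {- c..4}" for u n using C(2)[of "Complex u (real n + 1)"] that by simp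
    show "norm (integrand (Complex u (- (real n + 1)))) \<le> C / (1 + (real n + 1)\<^sup>2)"
      if "u \<in> {- c..4}" for u n using C(2)[of "Complex u (- (real n + 1))"] that by (simp add: power2_eq_square algebra_simps)
    show "(\<lambda>n. C / (1 + (real n + 1)\<^sup>2)) \<longlonglongrightarrow> 0" by real_asymp
  qed (use c in \<open>auto intro: integrand_line_integrable\<close>)
  then have "(LBINT y. integrand (Complex 4 y)) - (LBINT y. integrand (Complex (- c) y)) = 2 * of_real pi * (\<Sum>p\<in>{0, 1}. residue integrand p)"
    using LIMSEQ_unique tendsto_const by blast
  then show ?thesis by (simp add: residue_integrand)
qed

text \<open>On Re z = 4 the Dirichlet series converges absolutely and can be integrated term by
  term; the n-th term is r_n times Mellin inversion at the point n x.\<close>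

lemma integrand_line_series:
  "(\<lambda>n. of_nat (r2 (Suc n)) * (2 * of_real pi * F (- (real (Suc n) * x)))) sums (LBINT y. integrand (Complex 4 y))"
proof -
  define m where "m y = mellin (reflected_deriv F 0) (Complex 4 y)" for y
  define h where "h n y = of_nat (r2 (Suc n)) * (m y * of_real (real (Suc n) * x) powr (- Complex 4 y))" for n y
  have pos: "real (Suc n) * x > 0" for n using x by simp
  have hi: "integrable lborel (h n)" for n
    unfolding h_def m_def by (intro integrable_mult_right mellin_inversion(1) pos) simp
  have hI: "(LBINT y. h n y) = of_nat (r2 (Suc n)) * (2 * of_real pi * F (- (real (Suc n) * x)))" for n
    unfolding h_def m_def integral_mult_right_zero
    by (subst mellin_inversion(2)[OF pos]) (simp_all add: reflected_deriv_def halfline_deriv_def)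
  have hs: "h n y = (of_nat (r2 (Suc n)) * of_nat (Suc n) powr (- Complex 4 y)) * (m y * of_real x powr (- Complex 4 y))" for n y
    unfolding h_def using powr_times_real[of "of_real (real (Suc n))" "of_real x" "- Complex 4 y"] x
    by (simp del: of_nat_Suc)
  have hn: "norm (h n y) = (real (r2 (Suc n)) * real (Suc n) powr (- 4)) * norm (m y * of_real x powr (- Complex 4 y))" for n y
    unfolding hs norm_mult using norm_of_real_powr[of "real (Suc n)" "- Complex 4 y"] by (simp del: of_nat_Suc)
  have sr: "summable (\<lambda>n. real (r2 (Suc n)) * real (Suc n) powr (- 4))" by (rule summable_r2_powr) simp
  have s: "AE y in lborel. summable (\<lambda>n. norm (h n y))" "summable (\<lambda>n. LBINT y. norm (h n y))"
    unfolding hn integral_mult_right_zero using sr by (auto intro!: summable_mult2)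
  have "(\<Sum>n. h n y) = integrand (Complex 4 y)" for y
  proof -
    let ?z = "Complex 4 y"
    have z: "?z \<noteq> 1" "?z \<notin> \<int>\<^sub>\<le>\<^sub>0" by (auto elim!: nonpos_Ints_cases simp: complex_eq_iff)
    have "(\<lambda>n. h n y) sums ((4 * riemann_zeta ?z * L_chi4 ?z) * (m y * of_real x powr (- ?z)))"
      unfolding hs by (intro sums_mult2 r2_dirichlet_series) simp
    moreover have "integrand ?z = (4 * riemann_zeta ?z * L_chi4 ?z) * (m y * of_real x powr (- ?z))"
      using integrand_eq_mellin[OF z, of 0] by (simp add: m_def)
    ultimately show ?thesis by (simp add: sums_iff)
  qed
  then show ?thesis using sums_integral[OF hi s] unfolding hI by simp
qed

end

theorem mainTheorem6:
  fixes F :: "real \<Rightarrow> complex" and c t :: real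
  assumes "F \<in> schwartz_halfline" and "c > 0" and "t < 0"
  shows "summable (\<lambda>n. of_nat (r2 (Suc n)) * F (real (Suc n) * t))
    \<and> vline_integrable c (\<lambda>s.
        remove_sings (\<lambda>w. Gamma (- w) * riemann_zeta (- w) * L_chi4 (- w)) s
          * complex_deriv_at_0 F s * of_real (- t) powr s)
    \<and> vline_integrable c (\<lambda>s.
        xi (s + 1) * xi4 (s + 1) * complex_deriv_at_0 F s * of_real (- t / pi) powr s)
    \<and> 1 / 4 * (\<Sum>n. of_nat (r2 (Suc n)) * F (real (Suc n) * t))
        = - of_real (pi / (4 * t)) * complex_deriv_at_0 F (- 1) - 1 / 4 * F 0
          + 1 / (2 * \<i> * of_real pi) * vline_integral c (\<lambda>s.
              remove_sings (\<lambda>w. Gamma (- w) * riemann_zeta (- w) * L_chi4 (- w)) s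
                * complex_deriv_at_0 F s * of_real (- t) powr s)
    \<and> 1 / 4 * (\<Sum>n. of_nat (r2 (Suc n)) * F (real (Suc n) * t))
        = - of_real (pi / (4 * t)) * complex_deriv_at_0 F (- 1) - 1 / 4 * F 0
          + 1 / (4 * \<i> * of_real pi) * vline_integral c (\<lambda>s.
              xi (s + 1) * xi4 (s + 1) * complex_deriv_at_0 F s * of_real (- t / pi) powr s)"
proof -
  define x where "x = - t"
  have x: "x > 0" using assms by (simp add: x_def)
  interpret schwartz_summation F x by standard (use assms x in auto)
  let ?A = "\<lambda>s. remove_sings (\<lambda>w. Gamma (- w) * riemann_zeta (- w) * L_chi4 (- w)) s
      * complex_deriv_at_0 F s * of_real (- t) powr s"
  let ?B = "\<lambda>s. xi (s + 1) * xi4 (s + 1) * complex_deriv_at_0 F s * of_real (- t / pi) powr s"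
  \<comment> \<open>With s = -z the line Re s = c becomes Re z = -c with y reversed. The affine form
    \<open>0 + (- 1) * y\<close> is kept for the change of variables below.\<close>
  have A: "?A (Complex c y) = 1 / 4 * integrand (Complex (- c) (0 + (- 1) * y))" for y
  proof -
    have m: "Complex (- c) (0 + (- 1) * y) = - Complex c y" by (simp add: complex_eq_iff)
    have rs: "remove_sings (\<lambda>w. Gamma (- w) * riemann_zeta (- w) * L_chi4 (- w)) (Complex c y)
        = r2_xi (- Complex c y) / 4"
      using assms(2) by (intro remove_sings_Gamma_zeta_L) simp
    have "- t = x" by (simp add: x_def)
    then show ?thesis unfolding m rs integrand_def by simp
  qed
  \<comment> \<open>The factor pi^s from the functional equation meets pi^(-s) from the power of -t
    / pi, so both integrals reduce to the same one, here with 1/2 in place of 1/4.\<close>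
  have B: "?B (Complex c y) = 1 / 2 * integrand (Complex (- c) (0 + (- 1) * y))" for y
  proof -
    let ?s = "Complex c y"
    have m: "Complex (- c) (0 + (- 1) * y) = - ?s" by (simp add: complex_eq_iff)
    have 1: "complex_of_real (- t / pi) powr ?s = of_real x powr ?s * of_real pi powr (- ?s)"
      using complex_of_real_divide_powr[OF x pi_gt_zero, of ?s] by (simp add: x_def)
    have 2: "complex_of_real pi powr ?s * of_real pi powr (- ?s) = 1" by (simp add: powr_add [symmetric])
    have 3: "xi (?s + 1) * xi4 (?s + 1) = of_real pi powr ?s * r2_xi (- ?s) / 2"
      using assms(2) by (intro xi_mult_xi4_reflect) simp
    have "?B ?s = (of_real pi powr ?s * r2_xi (- ?s) / 2) * complex_deriv_at_0 F ?s
        * (of_real x powr ?s * of_real pi powr (- ?s))" by (simp only: 1 3)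
    also have "\<dots> = (of_real pi powr ?s * of_real pi powr (- ?s))
        * (r2_xi (- ?s) * complex_deriv_at_0 F ?s * of_real x powr ?s) / 2"
      by (simp only: times_divide_eq_left times_divide_eq_right mult_ac)
    also have "\<dots> = 1 / 2 * integrand (- ?s)" unfolding 2 by (simp add: integrand_def)
    finally show ?thesis unfolding m .
  qed
  define J where "J = (LBINT y. integrand (Complex (- c) y))"
  have i: "integrable lborel (\<lambda>y. integrand (Complex (- c) (0 + (- 1) * y)))"
    using assms(2) by (intro lborel_integrable_real_affine integrand_line_integrable[of c]) auto
  have J: "(LBINT y. integrand (Complex (- c) (0 + (- 1) * y))) = J"
    unfolding J_def by (subst lborel_integral_real_affine[of "- 1" _ 0]) auto
  have "vline_integrable c ?A" "vline_integrable c ?B"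
    unfolding vline_integrable_def A B using i by (intro integrable_mult_right; simp)+
  moreover have VA: "vline_integral c ?A = \<i> * (1 / 4 * J)" and VB: "vline_integral c ?B = \<i> * (1 / 2 * J)"
    unfolding vline_integral_def A B integral_mult_right_zero J by simp_all
  have eq: "- (real (Suc n) * x) = real (Suc n) * t" for n by (simp add: x_def)
  \<comment> \<open>The two residues together; a quarter of them gives the explicit terms, with the
    sign change x = -t.\<close>
  define R where "R = of_real (pi / x) * complex_deriv_at_0 F (- 1) - F 0"
  have "(\<lambda>n. of_nat (r2 (Suc n)) * (2 * of_real pi * F (real (Suc n) * t))) sums (J + 2 * of_real pi * R)"
  proof -
    have "(LBINT y. integrand (Complex 4 y)) = J + 2 * of_real pi * R"
      using integrand_line_shift[OF assms(2)] unfolding J_def R_def by (simp only: diff_eq_eq add.commute)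
    then show ?thesis using integrand_line_series unfolding eq by simp
  qed
  then have "(\<lambda>n. of_nat (r2 (Suc n)) * (2 * of_real pi * F (real (Suc n) * t)) / (2 * of_real pi)) sums
      ((J + 2 * of_real pi * R) / (2 * of_real pi))" by (rule sums_divide)
  then have sums: "(\<lambda>n. of_nat (r2 (Suc n)) * F (real (Suc n) * t)) sums (J / (2 * of_real pi) + R)"
    by (simp add: add_divide_distrib)
  have R: "1 / 4 * R = - of_real (pi / (4 * t)) * complex_deriv_at_0 F (- 1) - 1 / 4 * F 0"
    using assms(3) by (simp add: R_def x_def field_simps)
  have main: "1 / 4 * (\<Sum>n. of_nat (r2 (Suc n)) * F (real (Suc n) * t))
      = - of_real (pi / (4 * t)) * complex_deriv_at_0 F (- 1) - 1 / 4 * F 0 + J / (8 * of_real pi)"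
    unfolding sums_unique[OF sums, symmetric] R [symmetric] by (simp add: distrib_left)
  \<comment> \<open>The prefactors 1/2 and 1/4 balance the weights 1/4 and 1/2 of the two
    integrals.\<close>
  have "1 / (2 * \<i> * of_real pi) * vline_integral c ?A = J / (8 * of_real pi)"
    "1 / (4 * \<i> * of_real pi) * vline_integral c ?B = J / (8 * of_real pi)"
    unfolding VA VB by (simp_all add: field_simps)
  ultimately show ?thesis using main sums_summable[OF sums] by simp
qed

end
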